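(* Let $P\subset\mathbb R^2$ be a convex polygon, let $\Theta\subset S^1$ be the set of unit normals to its sides, and let $\gamma\in L^\infty(\mathbb T^2)$ be non-negative. Suppose that $\gamma$ satisfies the generalized geometric control condition in the directions $\Theta$: there exist $L,c_0>0$ such that $$\liminf_{\delta\to0}\ \inf_{x\in\mathbb T^2}\ \inf_{\nu\in\Theta}\ \frac{1}{|\Gamma_{x,\nu,L,\delta}|}\int_{\Gamma_{x,\nu,L,\delta}}\gamma(y)\,dy\ \ge\ c_0 .$$ Then there exists a constant $C>0$, depending on $P$ and $\gamma$ but independent of $R$, such that $$\|f\|_{L^2(\mathbb T^2)}^2\le C\int_{\mathbb T^2}|f(x)|^2\gamma(x)\,dx$$ for every $R\ge1$ and every $f\in L^2(\mathbb T^2)$ satisfying $\operatorname{supp}\widehat f\subset\Lambda_R(P)$.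
   Context: $\mathbb T^2=\mathbb R^2/\mathbb Z^2$ with Lebesgue measure, and $\widehat f(k)=\int_{\mathbb T^2}f(x)e^{-2\pi i k\cdot x}\,dx$ for $k\in\mathbb Z^2$. For $x\in\mathbb T^2$, $\nu\in S^1$, $L,\delta>0$, set $\mathcal G_{x,\nu,L}:=\{x+t\nu:0\le t\le L\}\subset\mathbb T^2$ (addition modulo $\mathbb Z^2$) and $\Gamma_{x,\nu,L,\delta}:=\{y\in\mathbb T^2:\operatorname{dist}(y,\mathcal G_{x,\nu,L})<\delta\}$; $|\cdot|$ denotes Lebesgue measure of sets. $\Lambda_R(P):=\{\xi\in\mathbb Z^2:\operatorname{dist}(\xi,R\,\partial P)\le1\}$, where $R\,\partial P$ is the $R$-dilate of the boundary of $P$. Polygons are nondegenerate (nonempty interior). *)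

theory Defs
  imports "HOL-Analysis.Analysis"
begin

text \<open>
  The torus $\mathbb{R}^2/\mathbb{Z}^2$ is handled through the covering plane: a point is given by
  any of its representatives in the plane, a function on the torus is a lattice-periodic function,
  a subset of the torus is its (lattice-invariant) preimage, and Lebesgue measure on the torus is
  Lebesgue measure on the fundamental cell $[0,1)^2$.
\<close>

definition int_lattice :: "(real^2) set" where
  "int_lattice = {k. \<forall>i. k $ i \<in> \<int>}"

definition unit_cell :: "(real^2) set" where
  "unit_cell = {x. \<forall>i. 0 \<le> x $ i \<and> x $ i < 1}"

definition torus :: "(real^2) measure" where
  "torus = lebesgue_on unit_cell"

definition lattice_periodic :: "(real^2 \<Rightarrow> 'a) \<Rightarrow> bool" where
  "lattice_periodic f \<longleftrightarrow> (\<forall>x. \<forall>k\<in>int_lattice. f (x + k) = f x)"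

definition torus_L2 :: "(real^2 \<Rightarrow> complex) \<Rightarrow> bool" where
  "torus_L2 f \<longleftrightarrow> lattice_periodic f \<and> f \<in> borel_measurable torus
     \<and> integrable torus (\<lambda>x. (norm (f x))\<^sup>2)"

definition L2_norm_torus :: "(real^2 \<Rightarrow> complex) \<Rightarrow> real" where
  "L2_norm_torus f = sqrt (LINT x|torus. (norm (f x))\<^sup>2)"

definition torus_Linf :: "(real^2 \<Rightarrow> real) \<Rightarrow> bool" where
  "torus_Linf g \<longleftrightarrow> lattice_periodic g \<and> g \<in> borel_measurable torus
     \<and> (\<exists>M. AE x in torus. \<bar>g x\<bar> \<le> M)"

definition fourier_coeff :: "(real^2 \<Rightarrow> complex) \<Rightarrow> real^2 \<Rightarrow> complex" where
  "fourier_coeff f k =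
     (LINT x|torus. f x * exp (- (2 * of_real pi * \<i> * of_real (k \<bullet> x))))"

definition fourier_support :: "(real^2 \<Rightarrow> complex) \<Rightarrow> (real^2) set" where
  "fourier_support f = {k \<in> int_lattice. fourier_coeff f k \<noteq> 0}"

definition geodesic :: "real^2 \<Rightarrow> real^2 \<Rightarrow> real \<Rightarrow> (real^2) set" where
  "geodesic x \<nu> L = {x + t *\<^sub>R \<nu> + k | t k. 0 \<le> t \<and> t \<le> L \<and> k \<in> int_lattice}"

text \<open>
  Since \<^const>\<open>geodesic\<close> contains all lattice translates of the segment, the Euclidean distance to it
  is the distance in the flat metric of the torus.
\<close>

definition tube :: "real^2 \<Rightarrow> real^2 \<Rightarrow> real \<Rightarrow> real \<Rightarrow> (real^2) set" where
  "tube x \<nu> L \<delta> = {y. infdist y (geodesic x \<nu> L) < \<delta>}"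

definition tube_average :: "(real^2 \<Rightarrow> real) \<Rightarrow> real^2 \<Rightarrow> real^2 \<Rightarrow> real \<Rightarrow> real \<Rightarrow> real" where
  "tube_average \<gamma> x \<nu> L \<delta> =
     (LINT y:tube x \<nu> L \<delta>|torus. \<gamma> y) / measure torus (tube x \<nu> L \<delta> \<inter> unit_cell)"

text \<open>The infima and the lower limit are taken in the extended reals, where they always exist.\<close>

definition generalized_GCC :: "(real^2 \<Rightarrow> real) \<Rightarrow> (real^2) set \<Rightarrow> bool" where
  "generalized_GCC \<gamma> \<Theta> \<longleftrightarrow> (\<exists>L>0. \<exists>c\<^sub>0>0.
     Liminf (at_right 0) (\<lambda>\<delta>. INF x. INF \<nu>\<in>\<Theta>. ereal (tube_average \<gamma> x \<nu> L \<delta>)) \<ge> ereal c\<^sub>0)"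

definition convex_polygon :: "(real^2) set \<Rightarrow> bool" where
  "convex_polygon P \<longleftrightarrow> polytope P \<and> interior P \<noteq> {}"

text \<open>Both unit normals of each side are included, the inward as well as the outward one.\<close>

definition side_normals :: "(real^2) set \<Rightarrow> (real^2) set" where
  "side_normals P = {\<nu>. norm \<nu> = 1 \<and>
     (\<exists>e. e edge_of P \<and> (\<forall>u\<in>e. \<forall>v\<in>e. orthogonal \<nu> (u - v)))}"

definition boundary_frequencies :: "real \<Rightarrow> (real^2) set \<Rightarrow> (real^2) set" where
  "boundary_frequencies R P = {\<xi> \<in> int_lattice. infdist \<xi> ((\<lambda>p. R *\<^sub>R p) ` frontier P) \<le> 1}"

end

theory Submission
  imports Defs "HOL-Probability.Probability"
begin

text \<open>
  The GCC gives, for almost every \<open>x\<close> and every side normal \<open>\<nu>\<close>, a lower bound for the integral of \<open>\<gamma>\<close>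
  over the segment from \<open>x\<close> to \<open>x + L\<nu>\<close>. If the spectrum of \<open>f\<close> lies near a line \<open>\<xi> \<bullet> \<nu> = \<lambda>\<close>, then along
  such segments \<open>f\<close> is, up to a phase, band-limited to \<open>[-1, 1]\<close>; Taylor expansion to degree \<open>d\<close> costs a
  factor decaying like \<open>1/d!\<close>, while a Remez inequality for polynomials costs only \<open>K^d\<close>, so the
  estimate holds for a single strip. For two opposite sides one first averages over one period
  \<open>1/|\<lambda>\<^sub>2 - \<lambda>\<^sub>1|\<close> of the relative phase.

  Two transversal sides interact through \<open>\<Sum> a(\<xi>) cnj(a(\<eta>)) c(\<xi> - \<eta>)\<close>, where \<open>a\<close> and \<open>c\<close> are the coefficients
  of \<open>f\<close> and \<open>\<gamma>\<close>. The difference \<open>\<xi> - \<eta>\<close> takes each value boundedly often, so by Bessel's inequality the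
  part with \<open>\<xi> - \<eta>\<close> outside a finite set is small; in the remaining part \<open>\<xi>\<close> is near the intersection
  point of the two side lines. There the spectrum lies in a translated strictly convex cone, and
  Szego's argument \<open>\<integral> |F|\<^sup>2 e\<^sup>v \<ge> |\<integral> F|\<^sup>2 e\<^bsup>\<integral> v\<^esup>\<close> (for \<open>F\<close> with spectrum in a half-plane), applied with \<open>v\<close>
  a large multiple of the indicator function of a set where \<open>\<gamma>\<close> is bounded below, controls finitely
  many coefficients one after the other by \<open>\<epsilon> \<parallel>f\<parallel>\<^sup>2 + C \<integral> \<gamma>|f|\<^sup>2\<close>. The same argument settles bounded \<open>R\<close>.
\<close>

section \<open>The torus as a probability space\<close>

text \<open>Everything must be uniform in \<open>R\<close>, and \<gamma> is merely bounded, so its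
  Fourier coefficients need not decay at any rate. Two devices replace decay. Bessel's inequality
  produces one finite set of differences that is valid for all \<open>R\<close>. What remains sits
  at a corner whose position moves with \<open>R\<close>; since multiplication by a character leaves
  the modulus of \<open>f\<close> unchanged, the corner can be brought near the origin and one fixed
  cone serves all \<open>R\<close>. An irrational direction orders the lattice points of this cone
  totally, with finitely many below any level, and so lets the coefficients be removed one at a
  time. In Szego's inequality the exponent is \<open>lam\<close> times the indicator of a set
  \<open>K\<close>: division by \<open>exp (lam * |K|)\<close> makes the part off \<open>K\<close>
  small compared with the full norm, while on \<open>K\<close> the factor \<open>exp lam\<close> is
  paid for by \<gamma>. Opposite sides are not transversal, so differences of their frequencies do
  repeat without bound. Averaging over the relative phase works only for strips far apart, and this
  is what separates large \<open>R\<close> from bounded \<open>R\<close>.\<close>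

lemma int_lattice_add [intro]: "k \<in> int_lattice \<Longrightarrow> l \<in> int_lattice \<Longrightarrow> k + l \<in> int_lattice"
  and int_lattice_diff [intro]: "k \<in> int_lattice \<Longrightarrow> l \<in> int_lattice \<Longrightarrow> k - l \<in> int_lattice"
  and int_lattice_uminus [intro]: "k \<in> int_lattice \<Longrightarrow> - k \<in> int_lattice"
  and int_lattice_0 [simp, intro]: "0 \<in> int_lattice"
  by (auto simp: int_lattice_def)

lemma countable_int_lattice: "countable int_lattice"
proof -
  have "int_lattice \<subseteq> (\<lambda>p. vector [of_int (fst p), of_int (snd p)]) ` (UNIV :: (int \<times> int) set)"
  proof
    fix k :: "real^2" assume "k \<in> int_lattice"
    then obtain a b where "k $ 1 = of_int a" "k $ 2 = of_int b"
      unfolding int_lattice_def Ints_def by fastforce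
    then have "k = vector [of_int (fst (a, b)), of_int (snd (a, b))]"
      by (simp add: vec_eq_iff forall_2)
    then show "k \<in> (\<lambda>p. vector [of_int (fst p), of_int (snd p)]) ` (UNIV :: (int \<times> int) set)"
      by blast
  qed
  then show ?thesis by (rule countable_subset) simp
qed

lemma int_lattice_norm_lt_1:
  assumes "k \<in> int_lattice" "norm k < 1" shows "k = 0"
proof -
  have "k $ i = 0" for i
  proof -
    have "\<bar>k $ i\<bar> < 1" using assms(2) component_le_norm_cart[of k i] by linarith
    moreover have "k $ i \<in> \<int>" using assms by (simp add: int_lattice_def)
    ultimately show ?thesis by (metis Ints_nonzero_abs_less1)
  qed
  then show ?thesis by (simp add: vec_eq_iff)
qed

lemma finite_int_lattice_bounded:
  assumes "A \<subseteq> int_lattice" "bounded A" shows "finite A"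
proof -
  obtain B where B: "\<And>k. k \<in> A \<Longrightarrow> norm k \<le> B" using assms(2) unfolding bounded_iff by blast
  let ?Z = "of_int ` {-\<lceil>B\<rceil>..\<lceil>B\<rceil>} :: real set"
  have "A \<subseteq> (\<lambda>p. vector [fst p, snd p]) ` (?Z \<times> ?Z)"
  proof
    fix k assume k: "k \<in> A"
    have *: "k $ i \<in> ?Z" for i
    proof -
      obtain z where z: "k $ i = of_int z"
        using k assms(1) unfolding int_lattice_def Ints_def by auto
      have "\<bar>k $ i\<bar> \<le> B" using component_le_norm_cart[of k i] B[OF k] by linarith
      then have "z \<in> {-\<lceil>B\<rceil>..\<lceil>B\<rceil>}" unfolding z by (simp; linarith)
      then show ?thesis using z by blast
    qed
    have "k = vector [fst (k $ 1, k $ 2), snd (k $ 1, k $ 2)]"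
      by (simp add: vec_eq_iff forall_2)
    then show "k \<in> (\<lambda>p. vector [fst p, snd p]) ` (?Z \<times> ?Z)"
      using * by blast
  qed
  then show ?thesis by (rule finite_subset) simp
qed

lemma lattice_periodicI:
  "(\<And>x k. k \<in> int_lattice \<Longrightarrow> f (x + k) = f x) \<Longrightarrow> lattice_periodic f"
  by (simp add: lattice_periodic_def)

definition cell_rep :: "real^2 \<Rightarrow> real^2" where
  "cell_rep x = (\<chi> i. frac (x $ i))"

lemma cell_rep_in_cell [simp]: "cell_rep x \<in> unit_cell"
  by (simp add: cell_rep_def unit_cell_def frac_lt_1)

lemma cell_rep_diff: "x - cell_rep x \<in> int_lattice"
  by (simp add: cell_rep_def int_lattice_def frac_def)

lemma lattice_periodic_cell_rep: "lattice_periodic f \<Longrightarrow> f (cell_rep x) = f x"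
  using cell_rep_diff[of x] unfolding lattice_periodic_def
  by (metis add.commute diff_add_cancel)

lemma cell_unique:
  assumes "x \<in> unit_cell" "y \<in> unit_cell" "x - y \<in> int_lattice" shows "x = y"
proof -
  have "x $ i = y $ i" for i
  proof -
    have "0 \<le> x $ i" "x $ i < 1" "0 \<le> y $ i" "y $ i < 1" using assms by (auto simp: unit_cell_def)
    then have "\<bar>x $ i - y $ i\<bar> < 1" by linarith
    moreover have "x $ i - y $ i \<in> \<int>" using assms by (simp add: int_lattice_def)
    ultimately show ?thesis by (metis Ints_nonzero_abs_less1 eq_iff_diff_eq_0)
  qed
  then show ?thesis by (simp add: vec_eq_iff)
qed

lemma cell_rep_eq_iff: "cell_rep x = y \<longleftrightarrow> y \<in> unit_cell \<and> x - y \<in> int_lattice"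
proof
  assume "cell_rep x = y" then show "y \<in> unit_cell \<and> x - y \<in> int_lattice"
    using cell_rep_in_cell cell_rep_diff by blast
next
  assume *: "y \<in> unit_cell \<and> x - y \<in> int_lattice"
  have "cell_rep x - y \<in> int_lattice"
    using int_lattice_diff[OF conjunct2[OF *] cell_rep_diff[of x]] by simp
  then show "cell_rep x = y" using * cell_unique[OF cell_rep_in_cell] by blast
qed

lemma cell_rep_id: "x \<in> unit_cell \<Longrightarrow> cell_rep x = x"
  by (simp add: cell_rep_eq_iff)

lemma lattice_periodic_cell_rep_comp: "lattice_periodic (\<lambda>x. f (cell_rep x))"
proof (rule lattice_periodicI)
  fix x k :: "real^2" assume "k \<in> int_lattice"
  then have "cell_rep (x + k) = cell_rep x"
    unfolding cell_rep_eq_iff using int_lattice_add[OF _ cell_rep_diff[of x]]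
    by (simp add: algebra_simps)
  then show "f (cell_rep (x + k)) = f (cell_rep x)" by simp
qed

lemma sets_unit_cell [measurable, simp]: "unit_cell \<in> sets borel"
proof -
  have "unit_cell = (\<Inter>i. {x. 0 \<le> x $ i} \<inter> {x. x $ i < 1})" by (auto simp: unit_cell_def)
  also have "\<dots> \<in> sets borel"
    by (intro sets.finite_INT sets.Int borel_closed borel_open closed_Collect_le open_Collect_less continuous_intros) auto
  finally show ?thesis .
qed

lemma measurable_cell_rep [measurable]: "cell_rep \<in> borel \<rightarrow>\<^sub>M borel"
proof (subst borel_measurable_euclidean_space, intro ballI)
  fix b :: "real^2" assume "b \<in> Basis"
  then obtain i where b: "b = axis i 1" by (auto simp: Basis_vec_def)
  have "(\<lambda>x. cell_rep x \<bullet> b) = (\<lambda>x. x $ i - of_int \<lfloor>x $ i\<rfloor>)"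
    by (simp add: b cell_rep_def inner_axis frac_def)
  also have "\<dots> \<in> borel_measurable borel" by measurable
  finally show "(\<lambda>x. cell_rep x \<bullet> b) \<in> borel_measurable borel" .
qed

text \<open>
  Compositions such as \<open>(x, t) \<mapsto> f (x + t \<nu>)\<close> preserve Borel but not Lebesgue measurability, so
  everything is done with the Borel measure \<open>tm\<close>; the passage from \<^const>\<open>torus\<close> comes last.
\<close>

definition tm :: "(real^2) measure" where
  "tm = density lborel (\<lambda>x. ennreal (indicator unit_cell x))"

lemma sets_tm [measurable_cong, simp]: "sets tm = sets borel"
  and space_tm [simp]: "space tm = UNIV"
  by (simp_all add: tm_def)

lemma emeasure_tm: "A \<in> sets borel \<Longrightarrow> emeasure tm A = emeasure lborel (A \<inter> unit_cell)"
  by (simp add: tm_def emeasure_density ennreal_indicator flip: indicator_inter_arith)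
     (metis inf_commute nn_integral_indicator sets.Int sets_lborel sets_unit_cell)

lemma emeasure_unit_cell: "emeasure lborel unit_cell = 1"
proof (rule antisym)
  have 1: "box 0 (1::real^2) \<subseteq> unit_cell" "unit_cell \<subseteq> cbox 0 (1::real^2)"
    by (auto simp: unit_cell_def mem_box_cart less_imp_le)
  have one: "b \<in> Basis \<Longrightarrow> 1 \<bullet> b = 1" for b :: "real^2"
    by (auto simp: Basis_vec_def inner_axis)
  have 2: "emeasure lborel (cbox 0 (1::real^2)) = 1" "emeasure lborel (box 0 (1::real^2)) = 1"
    using one by (simp_all add: emeasure_lborel_cbox_eq emeasure_lborel_box_eq)
  show "emeasure lborel unit_cell \<le> 1" "1 \<le> emeasure lborel unit_cell"
    using emeasure_mono[OF 1(1), of lborel] emeasure_mono[OF 1(2), of lborel] 2 by simp_all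
qed

interpretation tm: prob_space tm
  by (rule prob_spaceI) (simp add: emeasure_tm emeasure_unit_cell)

lemma AE_tm_iff: "(AE x in tm. P x) \<longleftrightarrow> (AE x in lborel. x \<in> unit_cell \<longrightarrow> P x)"
  unfolding tm_def by (subst AE_density) (auto simp: indicator_def)

lemma integral_tm:
  fixes f :: "real^2 \<Rightarrow> 'b::{banach, second_countable_topology}"
  assumes "f \<in> borel_measurable borel"
  shows "(LINT x|tm. f x) = (LINT x|torus. f x)"
proof -
  have "(LINT x|tm. f x) = (LINT x|lborel. indicator unit_cell x *\<^sub>R f x)"
    unfolding tm_def by (rule integral_density) (use assms in auto)
  also have "\<dots> = (LINT x|lebesgue. indicator unit_cell x *\<^sub>R f x)"
    by (rule integral_completion[symmetric]) (use assms in measurable)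
  also have "\<dots> = (LINT x|torus. f x)"
    unfolding torus_def by (rule integral_restrict_space[symmetric]) simp
  finally show ?thesis .
qed

text \<open>Translation carries the cell out of itself. The cell is cut into the countably many
  pieces on which one lattice vector \<open>k\<close> brings \<open>x + a\<close> back into it; each
  piece is moved by a plain translation of the plane, and the images again tile \<open>A\<close>
  inside the cell.\<close>

lemma emeasure_tm_shift:
  assumes A: "A \<in> sets borel"
  shows "emeasure tm {x. cell_rep (x + a) \<in> A} = emeasure tm A"
proof -
  let ?X = "\<lambda>k. {x \<in> unit_cell. x + a - k \<in> A \<inter> unit_cell}"
  let ?Y = "\<lambda>k. {y \<in> unit_cell \<inter> A. y - a + k \<in> unit_cell}"
  have [measurable]: "A \<in> sets borel" by fact
  have "emeasure tm {x. cell_rep (x + a) \<in> A} = emeasure lborel ({x. cell_rep (x + a) \<in> A} \<inter> unit_cell)"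
    by (rule emeasure_tm) measurable
  also have "{x. cell_rep (x + a) \<in> A} \<inter> unit_cell = (\<Union>k\<in>int_lattice. ?X k)" (is "?l = ?r")
  proof (intro set_eqI iffI)
    fix x assume "x \<in> ?l"
    then show "x \<in> ?r" using cell_rep_diff[of "x + a"]
      by (intro UN_I[of "x + a - cell_rep (x + a)"]) auto
  next
    fix x assume "x \<in> ?r"
    then obtain k where k: "k \<in> int_lattice" "x \<in> ?X k" by blast
    then have "cell_rep (x + a) = x + a - k" by (simp add: cell_rep_eq_iff)
    then show "x \<in> ?l" using k by simp
  qed
  also have "emeasure lborel \<dots> = (\<integral>\<^sup>+k. emeasure lborel (?X k) \<partial>count_space int_lattice)"
  proof (rule emeasure_UN_countable)
    show "disjoint_family_on ?X int_lattice"
      unfolding disjoint_family_on_def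
    proof (intro ballI impI)
      fix k l :: "real^2" assume kl: "k \<in> int_lattice" "l \<in> int_lattice" "k \<noteq> l"
      show "?X k \<inter> ?X l = {}"
      proof (rule ccontr)
        assume "?X k \<inter> ?X l \<noteq> {}"
        then obtain x where "x + a - k \<in> unit_cell" "x + a - l \<in> unit_cell" by blast
        then have "x + a - k = x + a - l"
          using kl by (intro cell_unique) (auto simp: algebra_simps)
        then show False using kl by simp
      qed
    qed
  qed (auto intro: countable_int_lattice)
  also have "\<dots> = (\<integral>\<^sup>+k. emeasure lborel (?Y k) \<partial>count_space int_lattice)"
  proof (rule nn_integral_cong)
    fix k
    have "emeasure lborel (?X k) = emeasure lborel ((+) (a - k) -` ?Y k)"
      by (rule arg_cong[where f="emeasure lborel"]) (auto simp: algebra_simps)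
    also have "\<dots> = emeasure (distr lborel borel ((+) (a - k))) (?Y k)"
      by (subst emeasure_distr) auto
    also have "\<dots> = emeasure lborel (?Y k)" by (simp add: lborel_distr_plus)
    finally show "emeasure lborel (?X k) = emeasure lborel (?Y k)" .
  qed
  also have "\<dots> = emeasure lborel (\<Union>k\<in>int_lattice. ?Y k)"
  proof (rule emeasure_UN_countable[symmetric])
    show "disjoint_family_on ?Y int_lattice"
      unfolding disjoint_family_on_def
    proof (intro ballI impI)
      fix k l :: "real^2" assume kl: "k \<in> int_lattice" "l \<in> int_lattice" "k \<noteq> l"
      show "?Y k \<inter> ?Y l = {}"
      proof (rule ccontr)
        assume "?Y k \<inter> ?Y l \<noteq> {}"
        then obtain x where "x - a + k \<in> unit_cell" "x - a + l \<in> unit_cell" by blast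
        then have "x - a + k = x - a + l"
          using kl by (intro cell_unique) (auto simp: algebra_simps)
        then show False using kl by simp
      qed
    qed
  qed (auto intro: countable_int_lattice)
  also have "(\<Union>k\<in>int_lattice. ?Y k) = A \<inter> unit_cell"
  proof (intro set_eqI iffI)
    fix y assume y: "y \<in> A \<inter> unit_cell"
    have "- (y - a - cell_rep (y - a)) \<in> int_lattice"
      using cell_rep_diff[of "y - a"] by (rule int_lattice_uminus)
    then show "y \<in> (\<Union>k\<in>int_lattice. ?Y k)" using y
      by (intro UN_I[of "- (y - a - cell_rep (y - a))"]) auto
  qed auto
  also have "emeasure lborel (A \<inter> unit_cell) = emeasure tm A"
    by (simp add: emeasure_tm)
  finally show ?thesis .
qed

lemma distr_tm_shift: "distr tm borel (\<lambda>x. cell_rep (x + a)) = tm"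
  by (rule measure_eqI) (auto simp: emeasure_distr vimage_def emeasure_tm_shift)

lemma integral_tm_shift:
  fixes f :: "real^2 \<Rightarrow> 'b::{banach, second_countable_topology}"
  assumes [measurable]: "f \<in> borel_measurable borel" and "lattice_periodic f"
  shows "(LINT x|tm. f (x + a)) = (LINT x|tm. f x)"
proof -
  have "(LINT x|tm. f x) = (LINT x|distr tm borel (\<lambda>x. cell_rep (x + a)). f x)"
    by (simp add: distr_tm_shift)
  also have "\<dots> = (LINT x|tm. f (cell_rep (x + a)))"
    by (rule integral_distr) measurable
  finally show ?thesis using assms(2) by (simp add: lattice_periodic_cell_rep)
qed

lemma AE_tm_shift:
  assumes "AE x in tm. P x" and "{x. P x} \<in> sets borel" and "lattice_periodic P"
  shows "AE x in tm. P (x + a)"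
proof -
  have "AE x in distr tm borel (\<lambda>x. cell_rep (x + a)). P x"
    using assms(1) by (subst distr_tm_shift)
  then have "AE x in tm. P (cell_rep (x + a))"
    by (subst (asm) AE_distr_iff) (use assms(2) in auto)
  then show ?thesis using assms(3) by (simp add: lattice_periodic_cell_rep)
qed

section \<open>Characters and trigonometric sums\<close>

definition ech :: "real^2 \<Rightarrow> real^2 \<Rightarrow> complex" where
  "ech k x = cis (2 * pi * (k \<bullet> x))"

lemma norm_ech [simp]: "norm (ech k x) = 1"
  and ech_0 [simp]: "ech 0 x = 1"
  and ech_add: "ech (k + l) x = ech k x * ech l x"
  and ech_add_right: "ech k (x + y) = ech k x * ech k y"
  and cnj_ech: "cnj (ech k x) = ech (- k) x"
  by (simp_all add: ech_def cis_mult inner_add distrib_left cis_cnj)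

lemma ech_scaleR_right: "ech k (t *\<^sub>R v) = cis (2 * pi * (t * (k \<bullet> v)))"
  by (simp add: ech_def)

lemma ech_mult_cnj: "ech k x * cnj (ech l x) = ech (k - l) x"
  by (simp add: cnj_ech flip: ech_add)

lemma continuous_on_ech [continuous_intros]:
  "continuous_on A g \<Longrightarrow> continuous_on A (\<lambda>x. ech k (g x))"
  unfolding ech_def by (intro continuous_intros)

lemma measurable_ech [measurable]: "ech k \<in> borel_measurable borel"
  by (intro borel_measurable_continuous_onI continuous_intros)

lemma int_lattice_inner: "k \<in> int_lattice \<Longrightarrow> l \<in> int_lattice \<Longrightarrow> k \<bullet> l \<in> \<int>"
  by (auto simp: inner_vec_def int_lattice_def)

lemma ech_lattice: "k \<in> int_lattice \<Longrightarrow> l \<in> int_lattice \<Longrightarrow> ech k l = 1"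
  using int_lattice_inner[of k l] by (auto simp: ech_def elim!: Ints_cases)

lemma integrable_tm_bounded:
  fixes f :: "real^2 \<Rightarrow> 'b::{banach, second_countable_topology}"
  assumes "f \<in> borel_measurable borel" "\<And>x. norm (f x) \<le> B"
  shows "integrable tm f"
  by (rule tm.integrable_const_bound[of _ B]) (use assms in auto)

lemma integral_ech:
  assumes "k \<in> int_lattice"
  shows "(LINT x|tm. ech k x) = (if k = 0 then 1 else 0)"
proof (cases "k = 0")
  case True then show ?thesis by (simp add: tm.prob_space[simplified])
next
  case False
  \<comment> \<open>Half a period in the direction of \<open>k\<close>: here
    \<open>k \<bullet> a = 1 / 2\<close>, so translating by \<open>a\<close> flips the sign of
    \<open>ech k\<close>, and invariance makes the integral its own negative.\<close>
  define a where "a = (1 / (2 * (k \<bullet> k))) *\<^sub>R k"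
  have "ech k a = -1" using False by (simp add: a_def ech_def)
  then have "(LINT x|tm. ech k x) = (LINT x|tm. - ech k x)"
    using integral_tm_shift[of "ech k" a] assms
    by (simp add: lattice_periodic_def ech_add_right ech_lattice)
  then have "(LINT x|tm. ech k x) = 0" by simp
  then show ?thesis using False by simp
qed

lemma measurable_cnj [measurable]: "cnj \<in> borel_measurable borel"
  by (intro borel_measurable_continuous_onI continuous_intros)

text \<open>The frequency set is kept apart from the coefficients, so that the spectrum can be split
  or thinned out while \<open>a\<close> stays the same function.\<close>

definition tsum :: "(real^2) set \<Rightarrow> (real^2 \<Rightarrow> complex) \<Rightarrow> real^2 \<Rightarrow> complex" where
  "tsum S a x = (\<Sum>k\<in>S. a k * ech k x)"

lemma measurable_tsum [measurable]: "tsum S a \<in> borel_measurable borel"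
  unfolding tsum_def by measurable

lemma norm_tsum_le: "norm (tsum S a x) \<le> (\<Sum>k\<in>S. norm (a k))"
  unfolding tsum_def by (rule order_trans[OF norm_sum]) (simp add: norm_mult)

lemma lattice_periodic_tsum: "S \<subseteq> int_lattice \<Longrightarrow> lattice_periodic (tsum S a)"
  unfolding lattice_periodic_def tsum_def
  by (auto intro!: sum.cong simp: ech_add_right ech_lattice subset_iff)

lemma tsum_union:
  "finite S \<Longrightarrow> finite T \<Longrightarrow> S \<inter> T = {} \<Longrightarrow> tsum (S \<union> T) a x = tsum S a x + tsum T a x"
  by (simp add: tsum_def sum.union_disjoint)

lemma integrable_tsum_cnj:
  assumes [measurable]: "g \<in> borel_measurable borel" and g: "\<And>x. norm (g x) \<le> M"
  shows "integrable tm (\<lambda>x. g x * (tsum S a x * cnj (tsum T b x)))"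
proof (rule integrable_tm_bounded)
  fix x
  have M: "0 \<le> M" using g[of x] norm_ge_zero order_trans by blast
  show "norm (g x * (tsum S a x * cnj (tsum T b x)))
      \<le> M * ((\<Sum>k\<in>S. norm (a k)) * (\<Sum>k\<in>T. norm (b k)))"
    unfolding norm_mult complex_mod_cnj
    by (intro mult_mono g norm_tsum_le) (auto intro!: mult_nonneg_nonneg sum_nonneg M)
qed measurable

lemma integral_tsum_cnj:
  assumes [measurable]: "g \<in> borel_measurable borel" and g: "\<And>x. norm (g x) \<le> M"
    and "finite S" "finite T"
  shows "(LINT x|tm. g x * (tsum S a x * cnj (tsum T b x)))
       = (\<Sum>k\<in>S. \<Sum>l\<in>T. a k * cnj (b l) * (LINT x|tm. g x * ech (k - l) x))"
proof -
  have int: "integrable tm (\<lambda>x. g x * ech k x)" for k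
    by (rule integrable_tm_bounded[of _ M]) (auto simp: norm_mult g)
  have "g x * (tsum S a x * cnj (tsum T b x))
      = (\<Sum>k\<in>S. \<Sum>l\<in>T. a k * cnj (b l) * (g x * ech (k - l) x))" for x
  proof -
    have "tsum S a x * cnj (tsum T b x)
        = (\<Sum>k\<in>S. \<Sum>l\<in>T. (a k * ech k x) * (cnj (b l) * cnj (ech l x)))"
      unfolding tsum_def cnj_sum complex_cnj_mult sum_product ..
    then show ?thesis
      by (simp add: sum_distrib_left mult_ac flip: ech_mult_cnj)
  qed
  then show ?thesis using int by (simp add: Bochner_Integration.integral_sum)
qed

lemma integral_tsum_cnj_1:
  assumes "finite S" "S \<subseteq> int_lattice"
  shows "(LINT x|tm. tsum S a x * cnj (tsum S b x)) = (\<Sum>k\<in>S. a k * cnj (b k))"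
proof -
  have "(LINT x|tm. tsum S a x * cnj (tsum S b x))
      = (\<Sum>k\<in>S. \<Sum>l\<in>S. a k * cnj (b l) * (LINT x|tm. ech (k - l) x))"
    using integral_tsum_cnj[of "\<lambda>_. 1" 1 S S a b] assms by simp
  also have "\<dots> = (\<Sum>k\<in>S. \<Sum>l\<in>S. if k = l then a k * cnj (b l) else 0)"
  proof (intro sum.cong refl)
    fix k l assume "k \<in> S" "l \<in> S"
    then have "k - l \<in> int_lattice" using assms by auto
    then show "a k * cnj (b l) * (LINT x|tm. ech (k - l) x) = (if k = l then a k * cnj (b l) else 0)"
      by (simp add: integral_ech)
  qed
  finally show ?thesis using assms by simp
qed

lemma complex_of_real_integral_tm:
  "complex_of_real (LINT x|tm. f x) = (LINT x|tm. complex_of_real (f x))"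
  by simp

lemma parseval:
  assumes "finite S" "S \<subseteq> int_lattice"
  shows "(LINT x|tm. (norm (tsum S a x))\<^sup>2) = (\<Sum>k\<in>S. (norm (a k))\<^sup>2)"
proof -
  have "complex_of_real (LINT x|tm. (norm (tsum S a x))\<^sup>2) = (LINT x|tm. tsum S a x * cnj (tsum S a x))"
    unfolding complex_of_real_integral_tm by (intro Bochner_Integration.integral_cong) (auto simp flip: complex_norm_square)
  also have "\<dots> = complex_of_real (\<Sum>k\<in>S. (norm (a k))\<^sup>2)"
    unfolding integral_tsum_cnj_1[OF assms] by (simp flip: complex_norm_square)
  finally show ?thesis unfolding of_real_eq_iff .
qed

lemma integral_tsum_ech:
  assumes "finite S" "S \<subseteq> int_lattice" "l \<in> int_lattice"
  shows "(LINT x|tm. tsum S a x * cnj (ech l x)) = (if l \<in> S then a l else 0)"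
proof -
  have "(LINT x|tm. tsum S a x * cnj (ech l x)) = (\<Sum>k\<in>S. a k * (LINT x|tm. ech (k - l) x))"
    using integral_tsum_cnj[of "\<lambda>_. 1" 1 S "{l}" a "\<lambda>_. 1"] assms by (simp add: tsum_def)
  also have "\<dots> = (\<Sum>k\<in>S. if k = l then a k else 0)"
  proof (intro sum.cong refl)
    fix k assume "k \<in> S"
    then have "k - l \<in> int_lattice" using assms by auto
    then show "a k * (LINT x|tm. ech (k - l) x) = (if k = l then a k else 0)" by (simp add: integral_ech)
  qed
  finally show ?thesis using assms by simp
qed

section \<open>Trigonometric polynomials and uniqueness of Fourier coefficients\<close>

text \<open>The index is a set of admissible frequencies, not the exact spectrum. A product then
  only requires that sums of frequencies stay admissible, which is how spectra confined to a
  half-plane are tracked.\<close>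

inductive trig_poly :: "(real^2) set \<Rightarrow> (real^2 \<Rightarrow> complex) \<Rightarrow> bool" for A where
  trig_poly_mono: "k \<in> A \<Longrightarrow> trig_poly A (\<lambda>x. c * ech k x)"
| trig_poly_zero: "trig_poly A (\<lambda>x. 0)"
| trig_poly_add: "trig_poly A f \<Longrightarrow> trig_poly A g \<Longrightarrow> trig_poly A (\<lambda>x. f x + g x)"

lemma trig_poly_const: "0 \<in> A \<Longrightarrow> trig_poly A (\<lambda>x. c)"
  using trig_poly_mono[of 0 A c] by simp

lemma trig_poly_mult:
  assumes "trig_poly A f" "trig_poly B g" and AB: "\<And>k l. k \<in> A \<Longrightarrow> l \<in> B \<Longrightarrow> k + l \<in> C"
  shows "trig_poly C (\<lambda>x. f x * g x)"
  using assms(1)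
proof (induction rule: trig_poly.induct)
  case (trig_poly_mono k c)
  show ?case using assms(2)
  proof (induction rule: trig_poly.induct)
    case (trig_poly_mono l d)
    have "trig_poly C (\<lambda>x. (c * d) * ech (k + l) x)"
      by (rule trig_poly.trig_poly_mono[OF AB]) fact+
    then show ?case by (simp add: ech_add mult_ac)
  next
    case (trig_poly_add f g)
    then show ?case by (auto simp: distrib_left intro: trig_poly.trig_poly_add)
  qed (simp add: trig_poly_zero)
next
  case (trig_poly_add f g)
  then show ?case by (auto simp: distrib_right intro: trig_poly.trig_poly_add)
qed (simp add: trig_poly_zero)

lemma trig_poly_cmult: "trig_poly A f \<Longrightarrow> trig_poly A (\<lambda>x. c * f x)"
  using trig_poly_mult[OF trig_poly_const[of "{0}" c], of A f A] by simp

lemma trig_poly_tsum: "finite S \<Longrightarrow> S \<subseteq> A \<Longrightarrow> trig_poly A (tsum S a)"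
  unfolding tsum_def
  by (induction S rule: finite_induct) (auto intro: trig_poly.intros)

lemma trig_poly_continuous: "trig_poly A f \<Longrightarrow> continuous_on UNIV f"
  by (induction rule: trig_poly.induct) (auto intro!: continuous_intros)

lemma trig_poly_measurable: "trig_poly A f \<Longrightarrow> f \<in> borel_measurable borel"
  by (intro borel_measurable_continuous_onI trig_poly_continuous)

lemma trig_poly_bounded: "trig_poly A f \<Longrightarrow> \<exists>B. \<forall>x. norm (f x) \<le> B"
proof (induction rule: trig_poly.induct)
  case (trig_poly_add f g)
  then obtain B C where "\<forall>x. norm (f x) \<le> B" "\<forall>x. norm (g x) \<le> C" by blast
  then have "\<forall>x. norm (f x + g x) \<le> B + C" by (meson add_mono norm_triangle_le)
  then show ?case by blast
qed (auto simp: norm_mult)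

lemma trig_poly_integrable: "trig_poly A f \<Longrightarrow> integrable tm f"
  using trig_poly_bounded[of A f] trig_poly_measurable[of A f] integrable_tm_bounded by blast

lemma trig_poly_integral_0: "trig_poly A f \<Longrightarrow> A \<subseteq> int_lattice - {0} \<Longrightarrow> (LINT x|tm. f x) = 0"
proof (induction rule: trig_poly.induct)
  case (trig_poly_mono k c)
  then have "k \<in> int_lattice" "k \<noteq> 0" by blast+
  then show ?case by (simp add: integral_ech)
next
  case (trig_poly_add f g)
  then show ?case by (subst Bochner_Integration.integral_add) (auto intro: trig_poly_integrable)
qed simp

lemma trig_poly_ortho:
  assumes "trig_poly int_lattice g" and f: "integrable tm f"
    and 0: "\<And>k. k \<in> int_lattice \<Longrightarrow> (LINT x|tm. f x * ech k x) = 0"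
  shows "integrable tm (\<lambda>x. f x * g x) \<and> (LINT x|tm. f x * g x) = 0"
  using assms(1)
proof (induction rule: trig_poly.induct)
  case (trig_poly_mono k c)
  have "integrable tm (\<lambda>x. f x * ech k x)"
    by (rule Bochner_Integration.integrable_bound[OF f]) (use f in \<open>auto simp: norm_mult\<close>)
  then show ?case using 0[OF trig_poly_mono]
    by (simp add: mult.left_commute[of _ c])
next
  case (trig_poly_add f g)
  then show ?case by (simp add: distrib_left)
qed simp

text \<open>Realizes the torus as a product of two circles, a compact set to which Stone-Weierstrass
  applies. A function of \<open>torus_embed x\<close> is automatically periodic, and real
  polynomials in it are trigonometric.\<close>

definition torus_embed :: "real^2 \<Rightarrow> complex \<times> complex" where
  "torus_embed x = (ech (axis 1 1) x, ech (axis 2 1) x)"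

lemma axis_int_lattice: "axis i 1 \<in> int_lattice"
  by (simp add: int_lattice_def axis_def)

lemma continuous_on_torus_embed: "continuous_on A torus_embed"
  unfolding torus_embed_def by (intro continuous_intros)

lemma measurable_torus_embed [measurable]: "torus_embed \<in> borel_measurable borel"
  by (intro borel_measurable_continuous_onI continuous_on_torus_embed)

lemma torus_embed_in: "torus_embed x \<in> sphere 0 1 \<times> sphere 0 1"
  by (simp add: torus_embed_def)

lemma torus_embed_eq:
  assumes "torus_embed x = torus_embed y" shows "x - y \<in> int_lattice"
proof -
  have "(x - y) $ i \<in> \<int>" for i
  proof -
    have eq: "ech (axis i 1) x = ech (axis i 1) y"
      using assms exhaust_2[of i] by (auto simp: torus_embed_def)
    have "ech (axis i 1) x = ech (axis i 1) (x - y) * ech (axis i 1) y"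
      using ech_add_right[of "axis i 1" "x - y" y] by simp
    then have "ech (axis i 1) (x - y) = 1"
      unfolding eq by (metis mult_cancel_right1 norm_ech norm_zero zero_neq_one)
    then obtain n :: int where "2 * pi * (x - y) $ i = of_int (2 * n) * pi"
      by (auto simp: ech_def cis_conv_exp exp_eq_1 inner_axis' )
    then have "(x - y) $ i = of_int n" by simp
    then show ?thesis by (metis Ints_of_int)
  qed
  then show ?thesis by (simp add: int_lattice_def)
qed

lemma trig_poly_Re_ech:
  "k \<in> int_lattice \<Longrightarrow> trig_poly int_lattice (\<lambda>x. of_real (Re (c * ech k x)))"
proof -
  assume k: "k \<in> int_lattice"
  have "trig_poly int_lattice (\<lambda>x. c / 2 * ech k x + cnj c / 2 * ech (- k) x)"
    using k by (intro trig_poly.intros) auto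
  moreover have "of_real (Re (c * ech k x)) = c / 2 * ech k x + cnj c / 2 * ech (- k) x" for x
  proof -
    have "c / 2 * ech k x + cnj c / 2 * cnj (ech k x) = (c * ech k x + cnj (c * ech k x)) / 2"
      by (simp add: add_divide_distrib)
    then show ?thesis by (simp only: complex_add_cnj cnj_ech) simp
  qed
  ultimately show ?thesis by simp
qed

lemma trig_poly_polynomial:
  assumes "real_polynomial_function p"
  shows "trig_poly int_lattice (\<lambda>x. of_real (p (torus_embed x)))"
  using assms
proof (induction rule: real_polynomial_function.induct)
  case (linear f)
  interpret bounded_linear f by fact
  \<comment> \<open>A real-linear functional of two complex variables is the real part of a
    complex-linear one; its coefficients are read off on the four real basis vectors.\<close>
  have z: "(z, w) = Re z *\<^sub>R (1, 0) + Im z *\<^sub>R (\<i>, 0) + Re w *\<^sub>R (0, 1) + Im w *\<^sub>R (0, \<i>)" for z w :: complex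
    by (simp add: complex_eq_iff)
  have f: "f (z, w) = Re ((f (1, 0) - \<i> * f (\<i>, 0)) * z) + Re ((f (0, 1) - \<i> * f (0, \<i>)) * w)" for z w
    by (subst z, unfold add scaleR) simp
  have "trig_poly int_lattice (\<lambda>x. of_real (Re ((f (1, 0) - \<i> * f (\<i>, 0)) * ech (axis 1 1) x))
      + of_real (Re ((f (0, 1) - \<i> * f (0, \<i>)) * ech (axis 2 1) x)))"
    by (intro trig_poly_add trig_poly_Re_ech axis_int_lattice)
  then show ?case unfolding torus_embed_def by (subst f) simp
next
  case (mult f g)
  then show ?case using trig_poly_mult[of int_lattice _ int_lattice _ int_lattice] by auto
qed (auto intro: trig_poly_const trig_poly_add)

lemma continuous_approx:
  assumes "continuous_on UNIV W" "0 < e"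
  obtains v where "trig_poly int_lattice (\<lambda>x. of_real (v x))" "\<And>x. \<bar>W (torus_embed x) - v x\<bar> < e"
    "v \<in> borel_measurable borel"
proof -
  have "compact (sphere (0::complex) 1 \<times> sphere (0::complex) 1)" by (intro compact_Times) auto
  then obtain g where g: "real_polynomial_function g"
    "\<And>x. x \<in> sphere 0 1 \<times> sphere 0 1 \<Longrightarrow> \<bar>W x - g x\<bar> < e"
    using Stone_Weierstrass_real_polynomial_function[of _ W e]
      continuous_on_subset[OF assms(1) subset_UNIV] assms(2) by metis
  have "(\<lambda>x. Re (complex_of_real (g (torus_embed x)))) \<in> borel_measurable borel"
    using trig_poly_measurable[OF trig_poly_polynomial[OF g(1)]] by measurable
  with that[OF trig_poly_polynomial[OF g(1)]] g(2)[OF torus_embed_in] show ?thesis by simp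
qed

definition bump :: "(complex \<times> complex) set \<Rightarrow> nat \<Rightarrow> complex \<times> complex \<Rightarrow> real" where
  "bump E n z = max 0 (1 - real n * infdist z E)"

lemma continuous_on_bump: "continuous_on A (bump E n)"
  unfolding bump_def by (intro continuous_intros)

lemma bump_bounds: "0 \<le> bump E n z" "bump E n z \<le> 1"
  by (auto simp: bump_def infdist_nonneg)

text \<open>Both \<open>K\<close> and \<open>x\<close> must lie in the cell: the embedding
  identifies lattice translates, so elsewhere the limit would be the indicator of all translates of
  \<open>K\<close>. \<open>K\<close> must be nonempty because \<open>infdist\<close> to the empty
  set is 0 and \<open>bump\<close> would be constantly 1.\<close>

lemma bump_tendsto:
  assumes "compact K" "K \<subseteq> unit_cell" "K \<noteq> {}" "x \<in> unit_cell"
  shows "(\<lambda>n. bump (torus_embed ` K) n (torus_embed x)) \<longlonglongrightarrow> indicator K x"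
proof (cases "x \<in> K")
  case True then show ?thesis by (simp add: bump_def)
next
  case False
  have "torus_embed x \<notin> torus_embed ` K"
  proof
    assume "torus_embed x \<in> torus_embed ` K"
    then obtain y where y: "y \<in> K" "torus_embed x = torus_embed y" by blast
    then have "x = y" using torus_embed_eq cell_unique assms by blast
    then show False using y False by simp
  qed
  moreover have "closed (torus_embed ` K)"
    by (intro compact_imp_closed compact_continuous_image continuous_on_torus_embed assms)
  ultimately have d: "0 < infdist (torus_embed x) (torus_embed ` K)" (is "0 < ?d")
    using assms by (metis image_is_empty infdist_pos_not_in_closed)
  then obtain N :: nat where N: "1 < real N * ?d" using reals_Archimedean3 by blast
  have "\<forall>n\<ge>N. bump (torus_embed ` K) n (torus_embed x) = 0"
  proof (intro allI impI)
    fix n assume "N \<le> n"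
    then have "real N * ?d \<le> real n * ?d" using d by (intro mult_right_mono) auto
    then show "bump (torus_embed ` K) n (torus_embed x) = 0" using N by (simp add: bump_def)
  qed
  then show ?thesis using False
    by (intro tendsto_eventually) (auto simp: eventually_sequentially)
qed

lemma AE_tm_cell: "AE x in tm. x \<in> unit_cell"
  by (simp add: AE_tm_iff)

text \<open>A compact set on which \<open>h\<close> is positive must be null, since the integral of
  \<open>h\<close> over it vanishes; inner regularity passes this on to the whole set where
  \<open>h\<close> is positive.\<close>

lemma integral_zero_compact_imp_nonpos:
  fixes h :: "real^2 \<Rightarrow> real"
  assumes h: "integrable tm h"
    and 0: "\<And>K. compact K \<Longrightarrow> K \<subseteq> unit_cell \<Longrightarrow> (LINT x|tm. h x * indicator K x) = 0"
  shows "AE x in tm. h x \<le> 0"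
proof -
  have [measurable]: "h \<in> borel_measurable borel" using borel_measurable_integrable[OF h] by simp
  define A where "A = {x \<in> unit_cell. 0 < h x}"
  have A: "A \<in> sets borel" unfolding A_def by measurable
  have "emeasure tm K = 0" if K: "K \<subseteq> A" "compact K" for K
  proof -
    have [measurable]: "K \<in> sets borel" using K by (simp add: borel_compact)
    have "(LINT x|tm. h x * indicator K x) = 0" using 0 K by (auto simp: A_def)
    moreover have "integrable tm (\<lambda>x. h x * indicator K x)"
      by (rule Bochner_Integration.integrable_bound[OF h]) (auto simp: indicator_def)
    moreover have "0 \<le> h x * indicator K x" for x
      using K by (auto simp: A_def indicator_def)
    ultimately have "AE x in tm. h x * indicator K x = 0"
      by (subst (asm) integral_nonneg_eq_0_iff_AE) auto
    then have "AE x in tm. x \<notin> K"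
      by eventually_elim (use K in \<open>auto simp: A_def indicator_def\<close>)
    then show ?thesis by (subst (asm) AE_iff_measurable[of K]) auto
  qed
  then have "(SUP K\<in>{K. K \<subseteq> A \<and> compact K}. emeasure tm K) \<le> 0"
    by (intro SUP_least) auto
  then have "emeasure tm A = 0"
    using inner_regular[of tm A] A tm.emeasure_finite by simp
  then have "AE x in tm. x \<notin> A" by (subst AE_iff_measurable[of A]) (use A in auto)
  with AE_tm_cell show ?thesis by eventually_elim (auto simp: A_def not_less)
qed

text \<open>The class of test functions orthogonal to \<open>f\<close> is enlarged step by step:
  characters, trigonometric polynomials, continuous functions by uniform approximation, indicators
  of compact sets by dominated convergence. The last ones detect the signs of the real and imaginary
  parts.\<close>

lemma fourier_uniqueness:
  fixes f :: "real^2 \<Rightarrow> complex"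
  assumes f: "integrable tm f"
    and 0: "\<And>k. k \<in> int_lattice \<Longrightarrow> (LINT x|tm. f x * ech k x) = 0"
  shows "AE x in tm. f x = 0"
proof -
  have [measurable]: "f \<in> borel_measurable borel" using borel_measurable_integrable[OF f] by simp
  have W: "(LINT x|tm. f x * of_real (W (torus_embed x))) = 0"
    if cont: "continuous_on UNIV W" and B: "\<And>z. \<bar>W z\<bar> \<le> 1" for W :: "complex \<times> complex \<Rightarrow> real"
  proof (rule ccontr)
    assume *: "(LINT x|tm. f x * of_real (W (torus_embed x))) \<noteq> 0" (is "?I \<noteq> 0")
    have [measurable]: "W \<in> borel_measurable borel" by (rule borel_measurable_continuous_onI[OF cont])
    define F where "F = (LINT x|tm. norm (f x))"
    have F: "0 \<le> F" by (simp add: F_def)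
    \<comment> \<open>Small enough that the approximation error \<open>e * F\<close> stays below
      \<open>norm ?I\<close>; the \<open>+ 1\<close> covers \<open>F = 0\<close>.\<close>
    define e where "e = norm ?I / (2 * (F + 1))"
    have e: "0 < e" using * F by (simp add: e_def)
    from cont e obtain v where v: "trig_poly int_lattice (\<lambda>x. of_real (v x))"
      "\<And>x. \<bar>W (torus_embed x) - v x\<bar> < e" "v \<in> borel_measurable borel" by (rule continuous_approx) blast
    have [measurable]: "v \<in> borel_measurable borel" by fact
    have i1: "integrable tm (\<lambda>x. f x * of_real (W (torus_embed x)))"
      by (rule Bochner_Integration.integrable_bound[OF f]) (auto simp: norm_mult mult_left_le B)
    have i2: "integrable tm (\<lambda>x. f x * of_real (v x))" "(LINT x|tm. f x * of_real (v x)) = 0"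
      using trig_poly_ortho[OF v(1) f 0] by auto
    have "?I = (LINT x|tm. f x * of_real (W (torus_embed x)) - f x * of_real (v x))"
      using i1 i2 by simp
    then have "norm ?I \<le> (LINT x|tm. norm (f x * of_real (W (torus_embed x)) - f x * of_real (v x)))"
      by simp
    also have "\<dots> \<le> (LINT x|tm. e * norm (f x))"
    proof (rule integral_mono)
      fix x show "norm (f x * of_real (W (torus_embed x)) - f x * of_real (v x)) \<le> e * norm (f x)"
        using v(2)[of x] unfolding right_diff_distrib[symmetric] norm_mult of_real_diff[symmetric] norm_of_real
        by (subst mult.commute) (intro mult_right_mono, auto)
    qed (use i1 i2 f in auto)
    also have "\<dots> = e * F" by (simp add: F_def)
    also have "\<dots> < e * (2 * (F + 1))" using e F by simp
    also have "\<dots> = norm ?I" using F by (simp add: e_def)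
    finally show False by simp
  qed
  have K: "(LINT x|tm. f x * indicator K x) = 0" if K: "compact K" "K \<subseteq> unit_cell" for K
  proof (cases "K = {}")
    case False
    have [measurable]: "K \<in> sets borel" using K by (simp add: borel_compact)
    have [measurable]: "bump E n \<in> borel_measurable borel" for E n
      by (rule borel_measurable_continuous_onI[OF continuous_on_bump])
    have "(\<lambda>n. LINT x|tm. f x * of_real (bump (torus_embed ` K) n (torus_embed x))) \<longlonglongrightarrow> (LINT x|tm. f x * of_real (indicator K x))"
    proof (rule integral_dominated_convergence[where w="\<lambda>x. norm (f x)"])
      show "AE x in tm. (\<lambda>n. f x * of_real (bump (torus_embed ` K) n (torus_embed x))) \<longlonglongrightarrow> f x * of_real (indicator K x)"
        using AE_tm_cell by eventually_elim (intro tendsto_intros bump_tendsto K False)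
    qed (use f in \<open>auto simp: norm_mult mult_left_le bump_bounds\<close>)
    moreover have "(LINT x|tm. f x * of_real (bump (torus_embed ` K) n (torus_embed x))) = 0" for n
      by (rule W) (auto simp: continuous_on_bump bump_bounds)
    ultimately have "(LINT x|tm. f x * of_real (indicator K x)) = 0"
      by (simp add: LIMSEQ_const_iff)
    moreover have "complex_of_real (indicator K x) = indicator K x" for x
      by (simp add: indicator_def)
    ultimately show ?thesis by simp
  qed simp
  have int: "integrable tm (\<lambda>x. f x * indicator K x)" if "compact K" for K
  proof -
    have [measurable]: "K \<in> sets borel" using that by (simp add: borel_compact)
    show ?thesis by (rule Bochner_Integration.integrable_bound[OF f]) (auto simp: indicator_def)
  qed
  have ReIm: "Re (f x * indicator K x) = Re (f x) * indicator K x"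
    "Im (f x * indicator K x) = Im (f x) * indicator K x" for x K
    by (auto simp: indicator_def)
  have K_Re: "(LINT x|tm. Re (f x) * indicator K x) = 0"
    and K_Im: "(LINT x|tm. Im (f x) * indicator K x) = 0"
    if "compact K" "K \<subseteq> unit_cell" for K
    using integral_Re[OF int[OF that(1)]] integral_Im[OF int[OF that(1)]] K[OF that]
    unfolding ReIm by simp_all
  have "AE x in tm. Re (f x) \<le> 0" "AE x in tm. Im (f x) \<le> 0"
    by (rule integral_zero_compact_imp_nonpos; use f K_Re K_Im in simp)+
  moreover have "AE x in tm. - Re (f x) \<le> 0" "AE x in tm. - Im (f x) \<le> 0"
    by (rule integral_zero_compact_imp_nonpos; use f K_Re K_Im in simp)+
  ultimately show ?thesis by eventually_elim (auto simp: complex_eq_iff)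
qed

section \<open>A Szego-type inequality\<close>

lemma norm_integral_sq_le:
  fixes g :: "real^2 \<Rightarrow> complex"
  assumes [measurable]: "g \<in> borel_measurable borel" and B: "\<And>x. norm (g x) \<le> B"
  shows "(norm (LINT x|tm. g x))\<^sup>2 \<le> (LINT x|tm. (norm (g x))\<^sup>2)"
proof -
  define m where "m = (LINT x|tm. norm (g x))"
  have i1: "integrable tm (\<lambda>x. norm (g x))"
    by (rule integrable_tm_bounded[of _ B]) (use B in auto)
  have i2: "integrable tm (\<lambda>x. (norm (g x))\<^sup>2)"
    by (rule integrable_tm_bounded[of _ "B\<^sup>2"]) (use B in \<open>auto intro: power_mono\<close>)
  have "0 \<le> (LINT x|tm. (norm (g x) - m)\<^sup>2)" by simp
  also have "\<dots> = (LINT x|tm. (norm (g x))\<^sup>2 - 2 * m * norm (g x) + m\<^sup>2)"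
    by (simp add: power2_diff algebra_simps)
  also have "\<dots> = (LINT x|tm. (norm (g x))\<^sup>2) - m\<^sup>2"
    using i1 i2 tm.prob_space by (simp add: m_def[symmetric] power2_eq_square)
  finally have "m\<^sup>2 \<le> (LINT x|tm. (norm (g x))\<^sup>2)" by simp
  moreover have "norm (LINT x|tm. g x) \<le> m" unfolding m_def by simp
  ultimately show ?thesis by (meson norm_ge_zero order_trans power_mono)
qed

text \<open>An irrational direction. The sign of \<open>om \<bullet> k\<close> then splits the
  nonzero lattice vectors into two opposite halves with nothing on the dividing line, and orders the
  lattice totally.\<close>

definition nonresonant :: "real^2 \<Rightarrow> bool" where
  "nonresonant om \<longleftrightarrow> (\<forall>k\<in>int_lattice. om \<bullet> k = 0 \<longrightarrow> k = 0)"

text \<open>Frequencies in the negative half are reflected into the positive one by conjugation,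
  which real parts do not notice; non-resonance leaves only the zero frequency for the
  constant.\<close>

lemma trig_poly_Re_decomp:
  assumes om: "nonresonant om" and "trig_poly int_lattice g"
  shows "\<exists>c u. trig_poly {k \<in> int_lattice. 0 < om \<bullet> k} u \<and> (\<forall>x. Re (g x) = c + Re (u x))"
  using assms(2)
proof (induction rule: trig_poly.induct)
  case (trig_poly_mono k c)
  consider "k = 0" | "0 < om \<bullet> k" | "0 < om \<bullet> (- k)"
    using om trig_poly_mono unfolding nonresonant_def by (force simp: inner_minus_right)
  then show ?case
  proof cases
    case 1
    then show ?thesis by (intro exI[of _ "Re c"] exI[of _ "\<lambda>x. 0"]) (auto intro: trig_poly_zero)
  next
    case 2
    then show ?thesis using trig_poly_mono
      by (intro exI[of _ 0] exI[of _ "\<lambda>x. c * ech k x"]) (auto intro: trig_poly.trig_poly_mono)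
  next
    case 3
    then have "trig_poly {k \<in> int_lattice. 0 < om \<bullet> k} (\<lambda>x. cnj c * ech (- k) x)"
      using trig_poly_mono by (intro trig_poly.trig_poly_mono) auto
    moreover have "Re (c * ech k x) = Re (cnj c * ech (- k) x)" for x
      by (simp flip: cnj_ech)
    ultimately show ?thesis
      by (intro exI[of _ 0] exI[of _ "\<lambda>x. cnj c * ech (- k) x"]) auto
  qed
next
  case trig_poly_zero
  then show ?case by (intro exI[of _ 0] exI[of _ "\<lambda>x. 0"]) (auto intro: trig_poly.trig_poly_zero)
next
  case (trig_poly_add f g)
  then obtain c u d w where
    "trig_poly {k \<in> int_lattice. 0 < om \<bullet> k} u" "\<forall>x. Re (f x) = c + Re (u x)"
    "trig_poly {k \<in> int_lattice. 0 < om \<bullet> k} w" "\<forall>x. Re (g x) = d + Re (w x)" by blast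
  then show ?case
    by (intro exI[of _ "c + d"] exI[of _ "\<lambda>x. u x + w x"]) (auto intro: trig_poly.trig_poly_add)
qed

text \<open>A mean value property: in the power series of \<open>exp (u x)\<close> every product
  \<open>F x * u x ^ n\<close> with \<open>n > 0\<close> has its spectrum in the open half-plane and
  hence mean zero, so only the first term of the series contributes.\<close>

lemma integral_mult_exp:
  assumes F: "trig_poly (insert 0 {k \<in> int_lattice. 0 < om \<bullet> k}) F"
    and u: "trig_poly {k \<in> int_lattice. 0 < om \<bullet> k} u"
  shows "(LINT x|tm. F x * exp (u x)) = (LINT x|tm. F x)"
proof -
  let ?P = "{k \<in> int_lattice. 0 < om \<bullet> k}"
  obtain B where B: "\<And>x. norm (F x) \<le> B" using trig_poly_bounded[OF F] by blast
  obtain U where U: "\<And>x. norm (u x) \<le> U" using trig_poly_bounded[OF u] by blast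
  have B0: "0 \<le> B" and U0: "0 \<le> U" using B U norm_ge_zero order_trans by blast+
  have [measurable]: "F \<in> borel_measurable borel" "u \<in> borel_measurable borel"
    by (rule trig_poly_measurable F u)+
  have pw: "trig_poly (if n = 0 then insert 0 ?P else ?P) (\<lambda>x. F x * u x ^ n)" for n
  proof (induction n)
    case (Suc n)
    have "trig_poly ?P (\<lambda>x. F x * u x ^ n * u x)"
      by (rule trig_poly_mult[OF Suc u]) (auto simp: inner_add split: if_splits)
    then show ?case by (simp add: mult_ac)
  qed (simp add: F)
  define t where "t n x = F x * (u x ^ n /\<^sub>R fact n)" for n x
  have nt: "norm (t n x) \<le> B * (U ^ n /\<^sub>R fact n)" for n x
    unfolding t_def norm_mult norm_scaleR norm_power
    by (simp, intro mult_mono divide_right_mono power_mono B U) (auto intro: B0 divide_nonneg_nonneg)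
  have [measurable]: "t n \<in> borel_measurable borel" for n unfolding t_def by measurable
  have it: "integrable tm (t n)" for n
    by (rule integrable_tm_bounded[OF _ nt]) simp
  have sm: "summable (\<lambda>n. B * (U ^ n /\<^sub>R fact n))" by (intro summable_mult summable_exp_generic)
  have "(LINT x|tm. F x * exp (u x)) = (LINT x|tm. (\<Sum>n. t n x))"
    unfolding t_def by (subst suminf_mult[OF summable_exp_generic]) (simp add: exp_def)
  also have "\<dots> = (\<Sum>n. LINT x|tm. t n x)"
  proof (rule integral_suminf[OF it])
    show "AE x in tm. summable (\<lambda>n. norm (t n x))"
      by (intro AE_I2 summable_comparison_test[OF _ sm]) (use nt in auto)
    show "summable (\<lambda>n. LINT x|tm. norm (t n x))"
    proof (rule summable_comparison_test[OF _ sm], intro exI allI impI)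
      fix n
      have "(LINT x|tm. norm (t n x)) \<le> (LINT x|tm. B * (U ^ n /\<^sub>R fact n))"
        by (intro integral_mono integrable_norm it nt) simp
      then show "norm (LINT x|tm. norm (t n x)) \<le> B * (U ^ n /\<^sub>R fact n)"
        using tm.prob_space by simp
    qed
  qed
  also have "\<dots> = (\<Sum>n\<in>{0}. LINT x|tm. t n x)"
  proof (rule suminf_finite)
    fix n :: nat assume "n \<notin> {0}"
    then have "trig_poly ?P (\<lambda>x. F x * u x ^ n)" using pw[of n] by simp
    then have "(LINT x|tm. F x * u x ^ n) = 0" by (rule trig_poly_integral_0) auto
    then show "(LINT x|tm. t n x) = 0" by (simp add: t_def)
  qed simp
  also have "\<dots> = (LINT x|tm. F x)" by (simp add: t_def)
  finally show ?thesis .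
qed

text \<open>Write \<open>v = c + Re u\<close> with the spectrum of \<open>u\<close> in the open
  half-plane, so that \<open>c\<close> is the mean of \<open>v\<close>. Dividing by
  \<open>ech l\<close> puts the least frequency at 0; multiplying by \<open>exp (u / 2)\<close> does
  not alter the mean \<open>a l\<close>, and Jensen's inequality turns this factor into the weight
  \<open>exp (Re u)\<close>.\<close>

lemma szego_trig_poly:
  assumes S: "finite S" "S \<subseteq> int_lattice" "l \<in> S" and om: "nonresonant om"
    and min: "\<And>k. k \<in> S \<Longrightarrow> k \<noteq> l \<Longrightarrow> om \<bullet> l < om \<bullet> k"
    and v: "trig_poly int_lattice (\<lambda>x. of_real (v x))"
  shows "(norm (a l))\<^sup>2 * exp (LINT x|tm. v x) \<le> (LINT x|tm. (norm (tsum S a x))\<^sup>2 * exp (v x))"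
proof -
  let ?P = "{k \<in> int_lattice. 0 < om \<bullet> k}"
  obtain c u where u: "trig_poly ?P u" "\<And>x. v x = c + Re (u x)"
    using trig_poly_Re_decomp[OF om v] by auto
  have u2: "trig_poly ?P (\<lambda>x. (1/2) * u x)" by (rule trig_poly_cmult[OF u(1)])
  define F where "F x = tsum S a x * cnj (ech l x)" for x
  have F: "trig_poly (insert 0 ?P) F" unfolding F_def cnj_ech
  proof (rule trig_poly_mult[OF trig_poly_tsum[OF S(1) subset_refl]])
    show "trig_poly {-l} (\<lambda>x. ech (- l) x)" using trig_poly_mono[of "-l" "{-l}" 1] by simp
    fix k m assume "k \<in> S" "m \<in> {-l}"
    then show "k + m \<in> insert 0 ?P"
      using min[of k] S by (cases "k = l") (auto simp: inner_diff)
  qed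
  have [measurable]: "F \<in> borel_measurable borel" "u \<in> borel_measurable borel"
    by (rule trig_poly_measurable F u)+
  obtain B where B: "\<And>x. norm (F x) \<le> B" using trig_poly_bounded[OF F] by blast
  obtain U where U: "\<And>x. norm (u x) \<le> U" using trig_poly_bounded[OF u(1)] by blast
  have B0: "0 \<le> B" using B norm_ge_zero order_trans by blast
  have "(LINT x|tm. v x) = (LINT x|tm. c + Re (u x))" by (simp add: u(2))
  also have "\<dots> = c + Re (LINT x|tm. u x)"
    using trig_poly_integrable[OF u(1)] tm.prob_space by simp
  also have "(LINT x|tm. u x) = 0" by (rule trig_poly_integral_0[OF u(1)]) auto
  finally have c: "(LINT x|tm. v x) = c" by simp
  have al: "(LINT x|tm. F x) = a l"
    unfolding F_def using integral_tsum_ech[OF S(1,2), of l a] S by auto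
  have "(norm (a l))\<^sup>2 = (norm (LINT x|tm. F x * exp ((1/2) * u x)))\<^sup>2"
    unfolding integral_mult_exp[OF F u2] al ..
  also have "\<dots> \<le> (LINT x|tm. (norm (F x * exp ((1/2) * u x)))\<^sup>2)"
  proof (rule norm_integral_sq_le)
    fix x
    have "Re (u x) \<le> U" using U[of x] complex_Re_le_cmod order_trans by blast
    then show "norm (F x * exp ((1/2) * u x)) \<le> B * exp (U / 2)"
      unfolding norm_mult by (intro mult_mono B) (auto intro: B0)
  qed measurable
  also have "\<dots> = (LINT x|tm. (norm (tsum S a x))\<^sup>2 * exp (Re (u x)))"
    by (intro Bochner_Integration.integral_cong refl)
       (simp add: norm_mult power_mult_distrib F_def flip: exp_double)
  finally have "(norm (a l))\<^sup>2 * exp c \<le> (LINT x|tm. (norm (tsum S a x))\<^sup>2 * exp (Re (u x))) * exp c"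
    by (rule mult_right_mono) simp
  also have "\<dots> = (LINT x|tm. (norm (tsum S a x))\<^sup>2 * exp (v x))"
    unfolding u(2) exp_add by (simp add: mult_ac flip: Bochner_Integration.integral_mult_right_zero)
  finally show ?thesis unfolding c .
qed

lemma szego_continuous:
  assumes S: "finite S" "S \<subseteq> int_lattice" "l \<in> S" and om: "nonresonant om"
    and min: "\<And>k. k \<in> S \<Longrightarrow> k \<noteq> l \<Longrightarrow> om \<bullet> l < om \<bullet> k"
    and W: "continuous_on UNIV W" "\<And>z. \<bar>W z\<bar> \<le> D"
  shows "(norm (a l))\<^sup>2 * exp (LINT x|tm. W (torus_embed x))
    \<le> (LINT x|tm. (norm (tsum S a x))\<^sup>2 * exp (W (torus_embed x)))"
proof -
  have [measurable]: "W \<in> borel_measurable borel" by (rule borel_measurable_continuous_onI[OF W(1)])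
  let ?I = "LINT x|tm. W (torus_embed x)"
  let ?J = "LINT x|tm. (norm (tsum S a x))\<^sup>2 * exp (W (torus_embed x))"
  define A where "A = (\<Sum>k\<in>S. norm (a k))"
  have A: "(norm (tsum S a x))\<^sup>2 \<le> A\<^sup>2" for x
    unfolding A_def by (intro power_mono norm_tsum_le) simp
  \<comment> \<open>Uniform approximation within \<open>e\<close> costs a factor
    \<open>exp e\<close> on each side of the inequality.\<close>
  have e: "(norm (a l))\<^sup>2 * exp ?I \<le> exp (2 * e) * ?J" if e0: "0 < e" for e
  proof -
    obtain v where v: "trig_poly int_lattice (\<lambda>x. of_real (v x))"
      "\<And>x. \<bar>W (torus_embed x) - v x\<bar> < e" "v \<in> borel_measurable borel"
      by (rule continuous_approx[OF W(1) e0]) blast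
    note [measurable] = v(3)
    have vb: "\<bar>v x\<bar> \<le> D + e" for x using v(2)[of x] W(2)[of "torus_embed x"] by linarith
    have vD: "v x \<le> D + e" for x using vb[of x] by linarith
    have WD: "W (torus_embed x) \<le> D" for x using W(2)[of "torus_embed x"] by linarith
    have "?I - e = (LINT x|tm. W (torus_embed x) - e)"
      using integrable_tm_bounded[of "\<lambda>x. W (torus_embed x)" D] W(2) tm.prob_space by simp
    also have "\<dots> \<le> (LINT x|tm. v x)"
    proof (rule integral_mono)
      show "integrable tm (\<lambda>x. W (torus_embed x) - e)"
        using integrable_tm_bounded[of "\<lambda>x. W (torus_embed x)" D] W(2) by simp
      show "integrable tm v" using integrable_tm_bounded[of v "D + e"] vb by simp
      show "W (torus_embed x) - e \<le> v x" for x using v(2)[of x] by linarith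
    qed
    finally have "(norm (a l))\<^sup>2 * exp (?I - e) \<le> (norm (a l))\<^sup>2 * exp (LINT x|tm. v x)"
      by (intro mult_left_mono) auto
    also have "\<dots> \<le> (LINT x|tm. (norm (tsum S a x))\<^sup>2 * exp (v x))"
      by (rule szego_trig_poly[OF S om min v(1)])
    also have "\<dots> \<le> (LINT x|tm. exp e * ((norm (tsum S a x))\<^sup>2 * exp (W (torus_embed x))))"
    proof (rule integral_mono)
      show "integrable tm (\<lambda>x. (norm (tsum S a x))\<^sup>2 * exp (v x))"
        using A vD by (intro integrable_tm_bounded[of _ "A\<^sup>2 * exp (D + e)"])
          (auto simp: norm_mult intro!: mult_mono)
      show "integrable tm (\<lambda>x. exp e * ((norm (tsum S a x))\<^sup>2 * exp (W (torus_embed x))))"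
        using A WD by (intro integrable_mult_right integrable_tm_bounded[of _ "A\<^sup>2 * exp D"])
          (auto simp: norm_mult intro!: mult_mono)
      show "(norm (tsum S a x))\<^sup>2 * exp (v x) \<le> exp e * ((norm (tsum S a x))\<^sup>2 * exp (W (torus_embed x)))" for x
      proof -
        have "exp (v x) \<le> exp (e + W (torus_embed x))" using v(2)[of x] by simp
        then have "(norm (tsum S a x))\<^sup>2 * exp (v x) \<le> (norm (tsum S a x))\<^sup>2 * exp (e + W (torus_embed x))"
          by (intro mult_left_mono) auto
        then show ?thesis by (simp add: exp_add mult_ac)
      qed
    qed
    also have "\<dots> = exp e * ?J" by simp
    finally have "(norm (a l))\<^sup>2 * exp (?I - e) * exp e \<le> exp e * ?J * exp e"
      by (rule mult_right_mono) simp
    moreover have "(norm (a l))\<^sup>2 * exp (?I - e) * exp e = (norm (a l))\<^sup>2 * exp ?I"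
      by (simp add: exp_diff)
    moreover have "exp e * ?J * exp e = exp (2 * e) * ?J"
      unfolding exp_double power2_eq_square by (simp only: mult_ac)
    ultimately show ?thesis by simp
  qed
  have "((\<lambda>e. exp (2 * e) * ?J) \<longlongrightarrow> exp (2 * 0) * ?J) (at_right 0)"
    by (intro tendsto_intros)
  then have "(norm (a l))\<^sup>2 * exp ?I \<le> exp (2 * 0) * ?J"
    by (rule tendsto_lowerbound) (use e eventually_at_right_less[of 0] in \<open>auto elim: eventually_mono\<close>)
  then show ?thesis by simp
qed

lemma szego_compact:
  assumes S: "finite S" "S \<subseteq> int_lattice" "l \<in> S" and om: "nonresonant om"
    and min: "\<And>k. k \<in> S \<Longrightarrow> k \<noteq> l \<Longrightarrow> om \<bullet> l < om \<bullet> k"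
    and K: "compact K" "K \<subseteq> unit_cell" "K \<noteq> {}" and lam: "0 \<le> lam"
  shows "(norm (a l))\<^sup>2 * exp (lam * measure tm K)
    \<le> (LINT x|tm. (norm (tsum S a x))\<^sup>2 * exp (lam * indicator K x))"
proof -
  let ?b = "\<lambda>n x. lam * bump (torus_embed ` K) n (torus_embed x)"
  have [measurable]: "K \<in> sets borel" using K by (simp add: borel_compact)
  have [measurable]: "bump E n \<in> borel_measurable borel" for E n
    by (rule borel_measurable_continuous_onI[OF continuous_on_bump])
  define A where "A = (\<Sum>k\<in>S. norm (a k))"
  have A: "(norm (tsum S a x))\<^sup>2 \<le> A\<^sup>2" for x
    unfolding A_def by (intro power_mono norm_tsum_le) simp
  have bl: "0 \<le> ?b n x" "?b n x \<le> lam" for n x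
    using lam by (auto simp: mult_left_le bump_bounds)
  have *: "AE x in tm. (\<lambda>n. ?b n x) \<longlonglongrightarrow> lam * indicator K x"
    using AE_tm_cell by eventually_elim (intro tendsto_intros bump_tendsto K)
  have "(\<lambda>n. LINT x|tm. ?b n x) \<longlonglongrightarrow> (LINT x|tm. lam * indicator K x)"
  proof (rule integral_dominated_convergence[where w="\<lambda>_. lam"])
    show "AE x in tm. norm (?b n x) \<le> lam" for n using bl by (intro AE_I2) auto
  qed (use * in auto)
  then have 1: "(\<lambda>n. (norm (a l))\<^sup>2 * exp (LINT x|tm. ?b n x)) \<longlonglongrightarrow> (norm (a l))\<^sup>2 * exp (lam * measure tm K)"
    by (intro tendsto_intros) simp
  have 2: "(\<lambda>n. LINT x|tm. (norm (tsum S a x))\<^sup>2 * exp (?b n x))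
      \<longlonglongrightarrow> (LINT x|tm. (norm (tsum S a x))\<^sup>2 * exp (lam * indicator K x))"
  proof (rule integral_dominated_convergence[where w="\<lambda>_. A\<^sup>2 * exp lam"])
    show "AE x in tm. norm ((norm (tsum S a x))\<^sup>2 * exp (?b n x)) \<le> A\<^sup>2 * exp lam" for n
      using A bl by (intro AE_I2) (auto simp: norm_mult intro!: mult_mono)
    show "AE x in tm. (\<lambda>n. (norm (tsum S a x))\<^sup>2 * exp (?b n x)) \<longlonglongrightarrow> (norm (tsum S a x))\<^sup>2 * exp (lam * indicator K x)"
      using * by eventually_elim (intro tendsto_mult[OF tendsto_const tendsto_exp])
  qed auto
  show ?thesis
  proof (rule LIMSEQ_le[OF 1 2], intro exI allI impI)
    fix n
    show "(norm (a l))\<^sup>2 * exp (LINT x|tm. ?b n x) \<le> (LINT x|tm. (norm (tsum S a x))\<^sup>2 * exp (?b n x))"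
      by (rule szego_continuous[OF S om min, where W="\<lambda>z. lam * bump (torus_embed ` K) n z" and D=lam])
         (use lam in \<open>auto intro!: continuous_intros continuous_on_bump simp: abs_mult mult_left_le bump_bounds\<close>)
  qed
qed

section \<open>Coefficients near a corner\<close>

lemma compact_positive_subset:
  assumes "A \<in> sets borel" "emeasure tm A \<noteq> 0"
  obtains K where "K \<subseteq> A" "compact K" "0 < measure tm K"
proof -
  have "\<exists>K. K \<subseteq> A \<and> compact K \<and> emeasure tm K \<noteq> 0"
  proof (rule ccontr)
    assume *: "\<not> ?thesis"
    then have "(SUP K\<in>{K. K \<subseteq> A \<and> compact K}. emeasure tm K) \<le> 0"
      by (intro SUP_least) auto
    then show False using inner_regular[of tm A] assms tm.emeasure_finite by simp
  qed
  then obtain K where K: "K \<subseteq> A" "compact K" "emeasure tm K \<noteq> 0" by blast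
  then have "0 < measure tm K" by (simp add: tm.emeasure_eq_measure zero_less_measure_iff)
  with K show ?thesis using that by blast
qed

section \<open>Bounded weights and their quadratic form\<close>

locale torus_weight =
  fixes g :: "real^2 \<Rightarrow> real" and M :: real
  assumes g_measurable [measurable]: "g \<in> borel_measurable borel"
    and g_nonneg: "\<And>x. 0 \<le> g x" and g_le: "\<And>x. g x \<le> M"
begin

definition energy :: "(real^2) set \<Rightarrow> (real^2 \<Rightarrow> complex) \<Rightarrow> real" where
  "energy S a = (LINT x|tm. g x * (norm (tsum S a x))\<^sup>2)"

lemma M_nonneg: "0 \<le> M"
  using g_nonneg g_le order_trans by blast

lemma integrable_tsum_sq: "integrable tm (\<lambda>x. (norm (tsum S a x))\<^sup>2)"
  by (rule integrable_tm_bounded[of _ "(\<Sum>k\<in>S. norm (a k))\<^sup>2"])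
     (auto intro!: power_mono norm_tsum_le)

lemma integrable_energy: "integrable tm (\<lambda>x. g x * (norm (tsum S a x))\<^sup>2)"
  using g_nonneg g_le M_nonneg
  by (intro integrable_tm_bounded[of _ "M * (\<Sum>k\<in>S. norm (a k))\<^sup>2"])
     (auto simp: norm_mult intro!: mult_mono power_mono norm_tsum_le)

lemma energy_nonneg: "0 \<le> energy S a"
  unfolding energy_def by (intro integral_nonneg_AE AE_I2 mult_nonneg_nonneg g_nonneg) auto

lemma energy_le:
  assumes "finite S" "S \<subseteq> int_lattice"
  shows "energy S a \<le> M * (\<Sum>k\<in>S. (norm (a k))\<^sup>2)"
proof -
  have "energy S a \<le> (LINT x|tm. M * (norm (tsum S a x))\<^sup>2)"
    unfolding energy_def
    by (intro integral_mono integrable_energy integrable_mult_right integrable_tsum_sq mult_right_mono g_le) auto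
  then show ?thesis using parseval[OF assms, of a] by simp
qed

text \<open>The price of deleting the frequencies in \<open>J\<close>: it comes from
  \<open>|u - v|\<^sup>2 \<le> 2 |u|\<^sup>2 + 2 |v|\<^sup>2\<close>, with the deleted part bounded
  through \<open>g \<le> M\<close> and Parseval. It is affordable once the coefficients in
  \<open>J\<close> are under control.\<close>

lemma energy_Diff_le:
  assumes "finite S" "S \<subseteq> int_lattice"
  shows "energy (S - J) a \<le> 2 * energy S a + 2 * M * (\<Sum>k\<in>S \<inter> J. (norm (a k))\<^sup>2)"
proof -
  have *: "tsum (S - J) a x = tsum S a x - tsum (S \<inter> J) a x" for x
  proof -
    have "(S - J) \<inter> (S \<inter> J) = {}" by blast
    then show ?thesis using tsum_union[of "S - J" "S \<inter> J" a x] assms by (simp add: Un_Diff_Int)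
  qed
  have "g x * (norm (tsum (S - J) a x))\<^sup>2
      \<le> 2 * (g x * (norm (tsum S a x))\<^sup>2) + 2 * (g x * (norm (tsum (S \<inter> J) a x))\<^sup>2)" for x
  proof -
    have "(norm (tsum (S - J) a x))\<^sup>2 \<le> (norm (tsum S a x) + norm (tsum (S \<inter> J) a x))\<^sup>2"
      unfolding * by (intro power_mono norm_triangle_ineq4) auto
    also have "\<dots> \<le> 2 * (norm (tsum S a x))\<^sup>2 + 2 * (norm (tsum (S \<inter> J) a x))\<^sup>2"
      using sum_squares_bound[of "norm (tsum S a x)" "norm (tsum (S \<inter> J) a x)"]
      by (simp add: power2_sum)
    finally show ?thesis using mult_left_mono[OF _ g_nonneg[of x]] by (fastforce simp: algebra_simps)
  qed
  then have "energy (S - J) a \<le> (LINT x|tm. 2 * (g x * (norm (tsum S a x))\<^sup>2) + 2 * (g x * (norm (tsum (S \<inter> J) a x))\<^sup>2))"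
    unfolding energy_def by (intro integral_mono Bochner_Integration.integrable_add integrable_mult_right integrable_energy)
  also have "\<dots> = 2 * energy S a + 2 * energy (S \<inter> J) a"
    unfolding energy_def by (subst Bochner_Integration.integral_add) (auto intro: integrable_energy)
  also have "energy (S \<inter> J) a \<le> M * (\<Sum>k\<in>S \<inter> J. (norm (a k))\<^sup>2)"
    using assms by (intro energy_le) auto
  finally show ?thesis by simp
qed

end

locale positive_torus_weight = torus_weight +
  assumes g_pos: "\<not> (AE x in tm. g x = 0)"
begin

lemma positive_on_compact:
  obtains K th where "compact K" "K \<subseteq> unit_cell" "0 < measure tm K" "0 < th" "\<And>x. x \<in> K \<Longrightarrow> th \<le> g x"
proof -
  define A where "A n = {x \<in> unit_cell. 1 / real (Suc n) \<le> g x}" for n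
  have A[measurable]: "A n \<in> sets borel" for n unfolding A_def by measurable
  have "\<exists>n. emeasure tm (A n) \<noteq> 0"
  proof (rule ccontr)
    assume "\<not> (\<exists>n. emeasure tm (A n) \<noteq> 0)"
    then have "AE x in tm. x \<notin> A n" for n by (subst AE_iff_measurable[of "A n"]) auto
    then have "AE x in tm. \<forall>n. x \<notin> A n" by (simp add: AE_all_countable)
    with AE_tm_cell have "AE x in tm. g x = 0"
    proof eventually_elim
      case (elim x)
      show ?case
      proof (rule ccontr)
        assume "g x \<noteq> 0"
        then have "0 < g x" using g_nonneg[of x] by simp
        then obtain n where "1 / real (Suc n) < g x" using nat_approx_posE by blast
        then have "x \<in> A n" using elim(1) by (simp add: A_def less_imp_le)
        then show False using elim(2) by blast
      qed
    qed
    then show False using g_pos by blast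
  qed
  then obtain n where n: "emeasure tm (A n) \<noteq> 0" by blast
  then obtain K where "K \<subseteq> A n" "compact K" "0 < measure tm K"
    using compact_positive_subset[OF A] by blast
  then show ?thesis
    by (intro that[of K "1 / real (Suc n)"]) (auto simp: A_def)
qed

text \<open>The constant depends on neither \<open>S\<close> nor \<open>l\<close>, which makes
  everything built on it uniform. Szego's weight equals 1 off \<open>K\<close>, where it contributes
  at most the full norm; on \<open>K\<close> the bound \<open>th \<le> g x\<close> converts the
  factor \<open>exp lam\<close> into energy.\<close>

lemma minimal_coeff_bound:
  assumes "nonresonant om" "0 < \<epsilon>"
  shows "\<exists>C\<ge>0. \<forall>S l a. finite S \<and> S \<subseteq> int_lattice \<and> l \<in> S \<and> (\<forall>k\<in>S. k \<noteq> l \<longrightarrow> om \<bullet> l < om \<bullet> k) \<longrightarrow>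
    (norm (a l))\<^sup>2 \<le> \<epsilon> * (\<Sum>k\<in>S. (norm (a k))\<^sup>2) + C * energy S a"
proof -
  obtain K th where K: "compact K" "K \<subseteq> unit_cell" "0 < measure tm K" "0 < th" "\<And>x. x \<in> K \<Longrightarrow> th \<le> g x"
    by (rule positive_on_compact) blast
  \<comment> \<open>By \<open>1 + x \<le> exp x\<close> this makes
    \<open>exp (lam * measure tm K)\<close> at least \<open>1 / \<epsilon>\<close>; dividing by it
    leaves only the fraction \<epsilon> of the norm.\<close>
  define lam where "lam = (1 / \<epsilon>) / measure tm K"
  have lam: "0 \<le> lam" using K assms by (simp add: lam_def)
  have "1 / \<epsilon> \<le> exp (1 / \<epsilon>)" using exp_ge_add_one_self[of "1 / \<epsilon>"] by linarith
  then have big: "1 / \<epsilon> \<le> exp (lam * measure tm K)" using K by (simp add: lam_def)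
  define C where "C = \<epsilon> * (exp lam / th)"
  show ?thesis
  proof (intro exI[of _ C] conjI allI impI; (elim conjE)?)
    show "0 \<le> C" using assms K by (simp add: C_def)
    fix S :: "(real^2) set" and l :: "real^2" and a :: "real^2 \<Rightarrow> complex"
    assume S: "finite S" "S \<subseteq> int_lattice" "l \<in> S" "\<forall>k\<in>S. k \<noteq> l \<longrightarrow> om \<bullet> l < om \<bullet> k"
    have [measurable]: "K \<in> sets borel" using K by (simp add: borel_compact)
    let ?f = "\<lambda>x. (norm (tsum S a x))\<^sup>2"
    have "(norm (a l))\<^sup>2 * (1 / \<epsilon>) \<le> (norm (a l))\<^sup>2 * exp (lam * measure tm K)"
      by (intro mult_left_mono big) auto
    also have "\<dots> \<le> (LINT x|tm. ?f x * exp (lam * indicator K x))"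
      by (rule szego_compact) (use S assms K lam in auto)
    also have "\<dots> \<le> (LINT x|tm. ?f x + (exp lam / th) * (g x * ?f x))"
    proof (rule integral_mono)
      show "integrable tm (\<lambda>x. ?f x + (exp lam / th) * (g x * ?f x))"
        by (intro Bochner_Integration.integrable_add integrable_mult_right integrable_tsum_sq integrable_energy)
      show "integrable tm (\<lambda>x. ?f x * exp (lam * indicator K x))"
        by (rule Bochner_Integration.integrable_bound[OF integrable_mult_left[OF integrable_tsum_sq[of S a], of "exp lam"]])
           (use lam in \<open>auto simp: norm_mult indicator_def mult_left_le
              intro!: AE_I2 mult_left_mono mult_right_mono order_trans[OF eq_refl[OF mult_1_right[symmetric]] mult_left_mono]\<close>)
      fix x
      show "?f x * exp (lam * indicator K x) \<le> ?f x + (exp lam / th) * (g x * ?f x)"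
      proof (cases "x \<in> K")
        case True
        have "exp lam * ?f x \<le> exp lam * (g x / th) * ?f x"
          using K(5)[OF True] K(4) by (intro mult_right_mono) (auto simp: field_simps)
        then have "?f x * exp lam \<le> (exp lam / th) * (g x * ?f x)" by (simp add: mult_ac)
        then show ?thesis using True by (simp add: add_increasing)
      next
        case False
        then show ?thesis using K(4) g_nonneg[of x] by simp
      qed
    qed
    also have "\<dots> = (\<Sum>k\<in>S. (norm (a k))\<^sup>2) + (exp lam / th) * energy S a"
      unfolding energy_def parseval[OF S(1,2), symmetric]
      by (subst Bochner_Integration.integral_add)
         (intro integrable_tsum_sq integrable_mult_right integrable_energy
            Bochner_Integration.integral_mult_right_zero[THEN arg_cong] refl | simp)+
    finally show "(norm (a l))\<^sup>2 \<le> \<epsilon> * (\<Sum>k\<in>S. (norm (a k))\<^sup>2) + C * energy S a"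
      using assms(2) by (simp add: C_def field_simps)
  qed
qed

text \<open>Induction that takes the largest element \<open>l\<close> off the initial segment
  \<open>J\<close> of \<open>X\<close>. Once the smaller elements are deleted from \<open>S\<close>,
  \<open>l\<close> is the least frequency left and the bound for a minimal coefficient applies; the
  deletion is paid for by the induction hypothesis with a smaller \<epsilon>.\<close>

lemma lower_set_bound:
  assumes om: "nonresonant om" and X: "X \<subseteq> int_lattice"
    and J: "finite J" "J \<subseteq> X" "\<And>k l. k \<in> J \<Longrightarrow> l \<in> X - J \<Longrightarrow> om \<bullet> k < om \<bullet> l"
  shows "\<forall>\<epsilon>>0. \<exists>C\<ge>0. \<forall>S a. finite S \<and> S \<subseteq> X \<longrightarrow>
    (\<Sum>k\<in>S \<inter> J. (norm (a k))\<^sup>2) \<le> \<epsilon> * (\<Sum>k\<in>S. (norm (a k))\<^sup>2) + C * energy S a"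
  using J
proof (induction "card J" arbitrary: J)
  case 0
  then have "J = {}" by simp
  then show ?case
    by (intro allI impI exI[of _ 0]) (auto intro!: mult_nonneg_nonneg sum_nonneg)
next
  case (Suc n)
  have "J \<noteq> {}" using Suc.hyps by auto
  then have "Max ((\<lambda>k. om \<bullet> k) ` J) \<in> (\<lambda>k. om \<bullet> k) ` J"
    using Suc.prems(1) by (intro Max_in) auto
  then obtain l where l: "l \<in> J" "Max ((\<lambda>k. om \<bullet> k) ` J) = om \<bullet> l" by blast
  have l_max: "om \<bullet> k \<le> om \<bullet> l" if "k \<in> J" for k
    unfolding l(2)[symmetric] using Suc.prems(1) that by (intro Max_ge) auto
  have strict: "om \<bullet> k < om \<bullet> l" if "k \<in> J" "k \<noteq> l" for k
  proof -
    have "l - k \<in> int_lattice" using that l(1) Suc.prems(2) X by (intro int_lattice_diff) blast+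
    moreover have "om \<bullet> (l - k) \<noteq> 0" using calculation that om unfolding nonresonant_def by auto
    ultimately show ?thesis using l_max[OF that(1)] by (simp add: inner_diff)
  qed
  let ?J = "J - {l}"
  have IH: "\<forall>\<epsilon>>0. \<exists>C\<ge>0. \<forall>S a. finite S \<and> S \<subseteq> X \<longrightarrow>
    (\<Sum>k\<in>S \<inter> ?J. (norm (a k))\<^sup>2) \<le> \<epsilon> * (\<Sum>k\<in>S. (norm (a k))\<^sup>2) + C * energy S a"
  proof (rule Suc.hyps(1))
    show "n = card ?J" using Suc.hyps(2) Suc.prems(1) l(1) by simp
    fix k m assume "k \<in> ?J" "m \<in> X - ?J"
    then show "om \<bullet> k < om \<bullet> m" using strict Suc.prems(3) by (cases "m = l") auto
  qed (use Suc.prems in auto)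
  show ?case
  proof (intro allI impI)
    fix \<epsilon> :: real assume \<epsilon>: "0 < \<epsilon>"
    then obtain C1 where C1: "0 \<le> C1" "\<And>S l a. finite S \<Longrightarrow> S \<subseteq> int_lattice \<Longrightarrow> l \<in> S \<Longrightarrow> (\<forall>k\<in>S. k \<noteq> l \<longrightarrow> om \<bullet> l < om \<bullet> k) \<Longrightarrow>
      (norm (a l))\<^sup>2 \<le> (\<epsilon>/2) * (\<Sum>k\<in>S. (norm (a k))\<^sup>2) + C1 * energy S a"
      using minimal_coeff_bound[OF om, of "\<epsilon>/2"] by auto
    \<comment> \<open>The total factor in front of \<open>P\<close>: \<open>2 * M * C1\<close> from
      the deletion of \<open>?J\<close>, and 1 from the coefficients in \<open>?J\<close>
      themselves. The induction hypothesis is therefore used with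
      \<open>\<epsilon> / (2 * D)\<close>.\<close>
    define D where "D = 2 * M * C1 + 1"
    have D: "1 \<le> D" using C1 M_nonneg by (simp add: D_def)
    then have "0 < \<epsilon>/(2*D)" using \<epsilon> by simp
    then obtain C2 where C2: "0 \<le> C2" "\<And>S a. finite S \<and> S \<subseteq> X \<Longrightarrow>
      (\<Sum>k\<in>S \<inter> ?J. (norm (a k))\<^sup>2) \<le> (\<epsilon>/(2*D)) * (\<Sum>k\<in>S. (norm (a k))\<^sup>2) + C2 * energy S a"
      using IH by blast
    show "\<exists>C\<ge>0. \<forall>S a. finite S \<and> S \<subseteq> X \<longrightarrow>
      (\<Sum>k\<in>S \<inter> J. (norm (a k))\<^sup>2) \<le> \<epsilon> * (\<Sum>k\<in>S. (norm (a k))\<^sup>2) + C * energy S a"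
    proof (intro exI[of _ "2 * C1 + D * C2"] conjI allI impI; (elim conjE)?)
      show "0 \<le> 2 * C1 + D * C2" using C1 C2 D by simp
      fix S and a :: "real^2 \<Rightarrow> complex" assume S: "finite S" "S \<subseteq> X"
      define N where "N = (\<Sum>k\<in>S. (norm (a k))\<^sup>2)"
      define P where "P = (\<Sum>k\<in>S \<inter> ?J. (norm (a k))\<^sup>2)"
      define E where "E = energy S a"
      have P: "P \<le> (\<epsilon>/(2*D)) * N + C2 * E" unfolding P_def N_def E_def using C2(2) S by blast
      have P0: "0 \<le> P" unfolding P_def by (intro sum_nonneg) auto
      have E0: "0 \<le> E" unfolding E_def by (rule energy_nonneg)
      have N0: "0 \<le> N" unfolding N_def by (intro sum_nonneg) auto
      have "(\<Sum>k\<in>S \<inter> J. (norm (a k))\<^sup>2) \<le> (\<epsilon>/2) * N + C1 * (2 * E + 2 * M * P) + P"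
      proof (cases "l \<in> S")
        case True
        have "(norm (a l))\<^sup>2 \<le> (\<epsilon>/2) * (\<Sum>k\<in>S - ?J. (norm (a k))\<^sup>2) + C1 * energy (S - ?J) a"
        proof (rule C1)
          show "\<forall>k\<in>S - ?J. k \<noteq> l \<longrightarrow> om \<bullet> l < om \<bullet> k" using S Suc.prems(3) l(1) by blast
        qed (use S X True in auto)
        also have "\<dots> \<le> (\<epsilon>/2) * N + C1 * (2 * E + 2 * M * P)"
        proof (intro add_mono mult_left_mono)
          show "(\<Sum>k\<in>S - ?J. (norm (a k))\<^sup>2) \<le> N" unfolding N_def
            by (rule sum_mono2) (use S in auto)
          show "energy (S - ?J) a \<le> 2 * E + 2 * M * P" unfolding E_def P_def
            by (rule energy_Diff_le) (use S X in auto)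
        qed (use \<epsilon> C1 in auto)
        moreover have "(\<Sum>k\<in>S \<inter> J. (norm (a k))\<^sup>2) = (norm (a l))\<^sup>2 + P"
        proof -
          have "S \<inter> J = insert l (S \<inter> ?J)" using True l by auto
          then show ?thesis unfolding P_def using S by simp
        qed
        ultimately show ?thesis by linarith
      next
        case False
        then have "S \<inter> J = S \<inter> ?J" by auto
        then have "(\<Sum>k\<in>S \<inter> J. (norm (a k))\<^sup>2) = P" by (simp add: P_def)
        moreover have "0 \<le> (\<epsilon>/2) * N + C1 * (2 * E + 2 * M * P)"
          using \<epsilon> N0 C1 E0 M_nonneg P0 by (intro add_nonneg_nonneg mult_nonneg_nonneg) auto
        ultimately show ?thesis by linarith
      qed
      also have "\<dots> = (\<epsilon>/2) * N + 2 * C1 * E + D * P" by (simp add: D_def algebra_simps)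
      also have "\<dots> \<le> (\<epsilon>/2) * N + 2 * C1 * E + D * ((\<epsilon>/(2*D)) * N + C2 * E)"
        using P D by (intro add_left_mono mult_left_mono) auto
      also have "\<dots> = \<epsilon> * N + (2 * C1 + D * C2) * E" using D by (simp add: field_simps)
      finally show "(\<Sum>k\<in>S \<inter> J. (norm (a k))\<^sup>2) \<le> \<epsilon> * (\<Sum>k\<in>S. (norm (a k))\<^sup>2) + (2 * C1 + D * C2) * energy S a"
        unfolding N_def E_def .
    qed
  qed
qed

text \<open>The character \<open>ech (- l)\<close> moves the spectrum by \<open>- l\<close> without
  changing the modulus, so a constant found for the fixed set \<open>X\<close> serves every
  \<open>l\<close>.\<close>

lemma corner_bound:
  assumes om: "nonresonant om" and X: "X \<subseteq> int_lattice" and fin: "finite {k \<in> X. om \<bullet> k \<le> T}"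
    and \<epsilon>: "0 < \<epsilon>"
  shows "\<exists>C\<ge>0. \<forall>S a l. finite S \<and> S \<subseteq> int_lattice \<and> l \<in> int_lattice \<and> (\<forall>k\<in>S. k - l \<in> X) \<longrightarrow>
    (\<Sum>k | k \<in> S \<and> om \<bullet> (k - l) \<le> T. (norm (a k))\<^sup>2)
      \<le> \<epsilon> * (\<Sum>k\<in>S. (norm (a k))\<^sup>2) + C * energy S a"
proof -
  let ?J = "{k \<in> X. om \<bullet> k \<le> T}"
  obtain C where C: "0 \<le> C" "\<And>S a. finite S \<and> S \<subseteq> X \<Longrightarrow>
    (\<Sum>k\<in>S \<inter> ?J. (norm (a k))\<^sup>2) \<le> \<epsilon> * (\<Sum>k\<in>S. (norm (a k))\<^sup>2) + C * energy S a"
  proof -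
    have "\<forall>\<epsilon>>0. \<exists>C\<ge>0. \<forall>S a. finite S \<and> S \<subseteq> X \<longrightarrow>
      (\<Sum>k\<in>S \<inter> ?J. (norm (a k))\<^sup>2) \<le> \<epsilon> * (\<Sum>k\<in>S. (norm (a k))\<^sup>2) + C * energy S a"
      by (rule lower_set_bound[OF om X fin]) auto
    then show thesis using \<epsilon> that by blast
  qed
  show ?thesis
  proof (intro exI[of _ C] conjI allI impI C(1); elim conjE)
    fix S :: "(real^2) set" and a :: "real^2 \<Rightarrow> complex" and l :: "real^2"
    assume S: "finite S" "S \<subseteq> int_lattice" "l \<in> int_lattice" "\<forall>k\<in>S. k - l \<in> X"
    let ?S = "(\<lambda>k. k - l) ` S" and ?a = "\<lambda>k. a (k + l)"
    have "tsum ?S ?a x = ech (- l) x * tsum S a x" for x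
    proof -
      have "ech (k - l) x = ech (- l) x * ech k x" for k
        using ech_add[of k "- l" x] by (simp add: mult.commute)
      then show ?thesis unfolding tsum_def sum_distrib_left
        by (subst sum.reindex) (auto simp: inj_on_def mult_ac intro!: sum.cong)
    qed
    then have e: "energy ?S ?a = energy S a" by (simp add: energy_def norm_mult)
    have n: "(\<Sum>k\<in>?S. (norm (?a k))\<^sup>2) = (\<Sum>k\<in>S. (norm (a k))\<^sup>2)"
      by (subst sum.reindex) (auto simp: inj_on_def)
    have "?S \<inter> ?J = (\<lambda>k. k - l) ` {k \<in> S. om \<bullet> (k - l) \<le> T}" using S(4) by auto
    then have "(\<Sum>k\<in>?S \<inter> ?J. (norm (?a k))\<^sup>2) = (\<Sum>k | k \<in> S \<and> om \<bullet> (k - l) \<le> T. (norm (a k))\<^sup>2)"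
      by (simp, subst sum.reindex) (auto simp: inj_on_def)
    moreover have "finite ?S \<and> ?S \<subseteq> X" using S by auto
    ultimately show "(\<Sum>k | k \<in> S \<and> om \<bullet> (k - l) \<le> T. (norm (a k))\<^sup>2)
      \<le> \<epsilon> * (\<Sum>k\<in>S. (norm (a k))\<^sup>2) + C * energy S a"
      using C(2)[of ?S ?a] unfolding e n by simp
  qed
qed

end

section \<open>A Remez inequality\<close>

text \<open>Lebesgue measure on \<open>{0..L}\<close>, written as a density so that its space is the
  whole line: integrands need only be Borel on the line, exactly as for \<open>tm\<close>.\<close>

definition seg :: "real \<Rightarrow> real measure" where
  "seg L = density lborel (\<lambda>t. ennreal (indicator {0..L} t))"

lemma sets_seg [measurable_cong, simp]: "sets (seg L) = sets borel"
  and space_seg [simp]: "space (seg L) = UNIV"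
  by (simp_all add: seg_def)

lemma emeasure_seg: "A \<in> sets borel \<Longrightarrow> emeasure (seg L) A = emeasure lborel (A \<inter> {0..L})"
  by (simp add: seg_def emeasure_density ennreal_indicator flip: indicator_inter_arith)
     (metis inf_commute nn_integral_indicator sets.Int sets_lborel borel_closed closed_atLeastAtMost)

lemma measure_seg: "A \<in> sets borel \<Longrightarrow> measure (seg L) A = measure lborel (A \<inter> {0..L})"
  by (simp add: measure_def emeasure_seg)

lemma measure_seg_UNIV [simp]: "0 \<le> L \<Longrightarrow> measure (seg L) UNIV = L"
  by (simp add: measure_seg)

interpretation seg: finite_measure "seg L"
  by (rule finite_measureI) (simp add: emeasure_seg emeasure_lborel_Icc_eq)

lemma AE_seg: "AE t in seg L. t \<in> {0..L}"
  unfolding seg_def by (subst AE_density) (auto simp: indicator_def)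

lemma integrable_seg_bounded:
  fixes f :: "real \<Rightarrow> 'b::{banach, second_countable_topology}"
  assumes "f \<in> borel_measurable borel" "\<And>x. x \<in> {0..L} \<Longrightarrow> norm (f x) \<le> B"
  shows "integrable (seg L) f"
  using AE_seg[of L] by (intro seg.integrable_const_bound[of _ B]) (use assms in \<open>auto elim: eventually_mono\<close>)

text \<open>Greedy choice. Each point is taken within \<open>h\<close> of the infimum of what is
  left, and everything below that point plus \<open>h\<close> is discarded; the discarded part lies
  in an interval of length \<open>2 * h\<close>, whence the factor 2.\<close>

lemma separated_points:
  fixes E :: "real set"
  assumes "E \<in> sets borel" "E \<subseteq> {0..L}" "0 < h" "2 * h * real n < measure lborel E"
  shows "\<exists>\<tau>. (\<forall>i\<le>n. \<tau> i \<in> E) \<and> (\<forall>i j. i \<le> j \<longrightarrow> j \<le> n \<longrightarrow> h * (real j - real i) \<le> \<tau> j - \<tau> i)"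
  using assms
proof (induction n arbitrary: E)
  case 0
  then have "E \<noteq> {}" by auto
  then obtain t where "t \<in> E" by blast
  then show ?case by (intro exI[of _ "\<lambda>_. t"]) auto
next
  case (Suc n)
  have bd: "bdd_below E" using Suc.prems(2) by (meson atLeastAtMost_iff bdd_belowI subsetD)
  have "2 * h * real (Suc n) \<ge> 0" using Suc.prems by simp
  then have ne: "E \<noteq> {}" using Suc.prems(4) by auto
  define m where "m = Inf E"
  obtain t where t: "t \<in> E" "t < m + h"
    using cInf_lessD[OF ne, of "m + h"] Suc.prems(3) unfolding m_def by auto
  have m: "m \<le> x" if "x \<in> E" for x unfolding m_def by (rule cInf_lower[OF that bd])
  let ?E = "E \<inter> {t + h..}"
  have [measurable]: "E \<in> sets borel" by fact
  have finE: "emeasure lborel A < \<infinity>" if "A \<subseteq> {0..L}" "A \<in> sets borel" for A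
    by (rule le_less_trans[OF emeasure_mono[OF that(1)]]) (auto simp: emeasure_lborel_Icc_eq)
  have "measure lborel E \<le> measure lborel (?E \<union> {m..m + 2 * h})"
  proof (rule measure_mono_fmeasurable)
    show "E \<subseteq> ?E \<union> {m..m + 2 * h}" using m t Suc.prems(3) by auto
    have "?E \<in> fmeasurable lborel"
      using finE[of ?E] Suc.prems(2) by (intro fmeasurableI) auto
    then show "?E \<union> {m..m + 2 * h} \<in> fmeasurable lborel"
      by (intro fmeasurable.Un) (auto intro!: fmeasurableI simp: emeasure_lborel_Icc_eq)
  qed auto
  also have "\<dots> \<le> measure lborel ?E + measure lborel {m..m + 2 * h}"
    by (rule measure_Un_le) auto
  also have "measure lborel {m..m + 2 * h} = 2 * h" using Suc.prems(3) by simp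
  finally have "2 * h * real n < measure lborel ?E"
    using Suc.prems(4) by (simp add: algebra_simps)
  then obtain \<tau> where \<tau>: "\<forall>i\<le>n. \<tau> i \<in> ?E"
    "\<forall>i j. i \<le> j \<longrightarrow> j \<le> n \<longrightarrow> h * (real j - real i) \<le> \<tau> j - \<tau> i"
    using Suc.IH[of ?E] Suc.prems by (auto simp: le_infI1)
  have d: "h * (real j - real i) \<le> case_nat t \<tau> j - case_nat t \<tau> i" if ij: "i \<le> j" "j \<le> Suc n" for i j
  proof (cases i)
    case 0
    show ?thesis
    proof (cases j)
      case (Suc j')
      have "h * (real j' - real 0) \<le> \<tau> j' - \<tau> 0" using \<tau>(2) ij Suc by blast
      moreover have "t + h \<le> \<tau> 0" using \<tau>(1) by auto
      ultimately show ?thesis using 0 Suc by (simp add: algebra_simps)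
    qed (use 0 in simp)
  next
    case (Suc i')
    then obtain j' where j: "j = Suc j'" using ij by (cases j) auto
    then show ?thesis using \<tau>(2) ij Suc by simp
  qed
  have "\<forall>i\<le>Suc n. case_nat t \<tau> i \<in> E" using \<tau>(1) t(1) by (auto split: nat.split)
  then show ?case using d by blast
qed

text \<open>Denominators of the Lagrange basis at equally spaced nodes. Their reciprocals sum to
  \<open>2 ^ d / fact d\<close> by the binomial theorem, which keeps the Remez constant exponential
  in \<open>d\<close>.\<close>

lemma prod_abs_diff_nat:
  assumes "i \<le> d"
  shows "(\<Prod>j\<in>{..d} - {i}. \<bar>real i - real j\<bar>) = fact i * fact (d - i)"
proof -
  have un: "{..d} - {i} = {..<i} \<union> {Suc i..d}" using assms by auto
  have "(\<Prod>j\<in>{..d} - {i}. \<bar>real i - real j\<bar>)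
      = (\<Prod>j\<in>{..<i}. \<bar>real i - real j\<bar>) * (\<Prod>j\<in>{Suc i..d}. \<bar>real i - real j\<bar>)"
    unfolding un by (rule prod.union_disjoint) auto
  also have "(\<Prod>j\<in>{..<i}. \<bar>real i - real j\<bar>) = fact i"
    unfolding fact_prod_rev of_nat_prod by (rule prod.cong) (auto simp: of_nat_diff)
  also have "(\<Prod>j\<in>{Suc i..d}. \<bar>real i - real j\<bar>) = (\<Prod>k\<in>{1..d - i}. real k)"
    by (rule prod.reindex_bij_witness[of _ "\<lambda>k. k + i" "\<lambda>j. j - i"]) auto
  also have "\<dots> = fact (d - i)" unfolding fact_prod by simp
  finally show ?thesis by simp
qed

lemma lagrange_interpolation:
  fixes b :: "nat \<Rightarrow> complex" and x :: "nat \<Rightarrow> complex"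
  assumes inj: "inj_on x {..d}"
  defines "p \<equiv> \<lambda>z. \<Sum>k\<le>d. b k * z ^ k"
  shows "p z = (\<Sum>i\<le>d. p (x i) * (\<Prod>j\<in>{..d} - {i}. (z - x j) / (x i - x j)))"
proof -
  define P where "P = (\<Sum>k\<le>d. monom (b k) k)"
  define q where "q i = (\<Prod>j\<in>{..d} - {i}. smult (1 / (x i - x j)) [:- x j, 1:])" for i
  define Q where "Q = (\<Sum>i\<le>d. smult (p (x i)) (q i))"
  have P: "poly P z = p z" for z by (simp add: P_def p_def poly_sum poly_monom)
  have q: "poly (q i) z = (\<Prod>j\<in>{..d} - {i}. (z - x j) / (x i - x j))" for i z
    unfolding q_def poly_prod by (intro prod.cong) (auto simp: diff_divide_distrib)
  have Q: "poly Q z = (\<Sum>i\<le>d. p (x i) * (\<Prod>j\<in>{..d} - {i}. (z - x j) / (x i - x j)))" for z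
    by (simp add: Q_def poly_sum q)
  have degP: "degree P \<le> d"
    unfolding P_def by (intro degree_sum_le) (auto intro: order_trans[OF degree_monom_le])
  have "degree (q i) \<le> d" if "i \<le> d" for i
  proof -
    have "degree (q i) \<le> (\<Sum>j\<in>{..d} - {i}. degree (smult (1 / (x i - x j)) [:- x j, 1:]))"
      unfolding q_def by (rule order_trans[OF degree_prod_sum_le]) (simp_all add: o_def)
    also have "\<dots> \<le> (\<Sum>j\<in>{..d} - {i}. 1)"
      by (intro sum_mono order_trans[OF degree_smult_le]) simp
    also have "\<dots> \<le> d" using that by simp
    finally show ?thesis .
  qed
  then have degQ: "degree Q \<le> d"
    unfolding Q_def by (intro degree_sum_le) (auto intro: order_trans[OF degree_smult_le])
  have "P = Q"
  proof (rule poly_eqI_degree[of "x ` {..d}"])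
    fix y assume "y \<in> x ` {..d}"
    then obtain m where m: "m \<le> d" "y = x m" by auto
    have "poly Q y = (\<Sum>i\<le>d. if i = m then p (x m) else 0)"
      unfolding Q
    proof (rule sum.cong[OF refl])
      fix i assume i: "i \<in> {..d}"
      show "p (x i) * (\<Prod>j\<in>{..d} - {i}. (y - x j) / (x i - x j)) = (if i = m then p (x m) else 0)"
      proof (cases "i = m")
        case True
        have "(\<Prod>j\<in>{..d} - {i}. (y - x j) / (x i - x j)) = 1"
          using True m inj by (intro prod.neutral) (auto simp: inj_on_def)
        then show ?thesis using True by simp
      next
        case False
        then show ?thesis using m by (auto intro!: prod_zero bexI[of _ m])
      qed
    qed
    also have "\<dots> = p (x m)" using m by simp
    finally show "poly P y = poly Q y" using P m by simp
  qed (use degP degQ inj in \<open>auto simp: card_image\<close>)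
  then show ?thesis using P Q by metis
qed

lemma power_div_fact_le_exp:
  fixes x :: real assumes "0 \<le> x" shows "x ^ n / fact n \<le> exp x"
proof -
  have "(\<Sum>k\<in>{n}. x ^ k /\<^sub>R fact k) \<le> (\<Sum>k. x ^ k /\<^sub>R fact k)"
    by (rule sum_le_suminf) (use assms in \<open>auto intro: summable_exp\<close>)
  then show ?thesis by (simp add: exp_def divide_inverse_commute)
qed

text \<open>A Chebyshev argument gives the set \<open>E\<close> where
  \<open>(norm (p t))\<^sup>2 \<le> \<beta>\<close> measure at least \<open>c / (2 * M)\<close>.
  Interpolation at \<open>d + 1\<close> points of \<open>E\<close> with gaps at least
  \<open>h\<close> bounds \<open>p\<close> on all of \<open>{0..L}\<close>; the Lagrange factors are
  dominated by those of equally spaced nodes.\<close>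

lemma remez_pointwise:
  fixes b :: "nat \<Rightarrow> complex" and w :: "real \<Rightarrow> real" and d :: nat
  assumes L: "0 < L" and c: "0 < c" and [measurable]: "w \<in> borel_measurable borel"
    and w: "\<And>t. 0 \<le> w t" "\<And>t. w t \<le> M" and wc: "c \<le> (LINT t|seg L. w t)"
  defines "p \<equiv> \<lambda>t::real. \<Sum>k\<le>d. b k * of_real t ^ k"
  assumes \<beta>: "0 < \<beta>" "(LINT t|seg L. w t * (norm (p t))\<^sup>2) \<le> \<beta> * c / 2"
    and t: "t \<in> {0..L}"
  shows "(norm (p t))\<^sup>2 \<le> \<beta> * ((16 * L * M / c) ^ d * exp (real (Suc d)))\<^sup>2"
proof -
  have [measurable]: "p \<in> borel_measurable borel" unfolding p_def by measurable
  have M0: "0 \<le> M" using w(1)[of 0] w(2)[of 0] by linarith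
  have "c \<le> (LINT t|seg L. w t)" by fact
  also have "\<dots> \<le> (LINT t|seg L. M)"
    by (intro integral_mono integrable_seg_bounded[of _ _ M]) (use w M0 in auto)
  finally have "c \<le> L * M" using L by simp
  then have "0 < L * M" using c by linarith
  then have M: "0 < M" using L by (simp add: zero_less_mult_iff)
  define E where "E = {t \<in> {0..L}. (norm (p t))\<^sup>2 \<le> \<beta>}"
  have [measurable]: "E \<in> sets borel" unfolding E_def by measurable
  have EL: "E \<subseteq> {0..L}" by (auto simp: E_def)
  \<comment> \<open>Then \<open>2 * h * d\<close> stays below \<open>c / (4 * M)\<close>, hence
    below the measure of \<open>E\<close>, as the choice of \<open>d + 1\<close> separated points
    requires.\<close>
  define h where "h = c / (8 * M * real (Suc d))"
  have h: "0 < h" using c M by (simp add: h_def)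
  have pb: "\<exists>B. \<forall>t\<in>{0..L}. norm (p t) \<le> B"
  proof (intro exI[of _ "\<Sum>k\<le>d. norm (b k) * L ^ k"] ballI)
    fix t assume "t \<in> {0..L}"
    then show "norm (p t) \<le> (\<Sum>k\<le>d. norm (b k) * L ^ k)"
      unfolding p_def by (intro order_trans[OF norm_sum] sum_mono)
        (auto simp: norm_mult norm_power intro!: mult_left_mono power_mono)
  qed
  then obtain B where B: "\<And>t. t \<in> {0..L} \<Longrightarrow> norm (p t) \<le> B" by blast
  have "\<beta> * (LINT t|seg L. w t) \<le> (LINT t|seg L. \<beta> * (M * indicator E t) + w t * (norm (p t))\<^sup>2)"
    unfolding Bochner_Integration.integral_mult_right_zero[symmetric]
  proof (rule integral_mono_AE)
    show "integrable (seg L) (\<lambda>t. \<beta> * w t)"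
      by (intro integrable_seg_bounded[of _ _ "\<beta> * M"]) (use w \<beta> in auto)
    show "integrable (seg L) (\<lambda>t. \<beta> * (M * indicator E t) + w t * (norm (p t))\<^sup>2)"
    proof (rule Bochner_Integration.integrable_add)
      show "integrable (seg L) (\<lambda>t. \<beta> * (M * indicator E t))"
        by (intro integrable_seg_bounded[of _ _ "\<beta> * M"]) (use M \<beta> in \<open>auto simp: indicator_def\<close>)
      show "integrable (seg L) (\<lambda>t. w t * (norm (p t))\<^sup>2)"
        by (intro integrable_seg_bounded[of _ _ "M * B\<^sup>2"])
           (use w B in \<open>auto simp: norm_mult intro!: mult_mono power_mono order_trans[OF w(1) w(2)]\<close>)
    qed
    show "AE t in seg L. \<beta> * w t \<le> \<beta> * (M * indicator E t) + w t * (norm (p t))\<^sup>2"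
      using AE_seg
    proof eventually_elim
      case (elim t)
      show ?case
      proof (cases "t \<in> E")
        case True
        have "\<beta> * w t \<le> \<beta> * M" using w \<beta> by simp
        moreover have "0 \<le> w t * (norm (p t))\<^sup>2" using w by simp
        ultimately show ?thesis using True by simp
      next
        case False
        then have "\<beta> \<le> (norm (p t))\<^sup>2" using elim by (simp add: E_def)
        then have "w t * \<beta> \<le> w t * (norm (p t))\<^sup>2" using w by (intro mult_left_mono)
        then show ?thesis using False by (simp add: mult.commute)
      qed
    qed
  qed
  also have "\<dots> = \<beta> * (M * measure (seg L) E) + (LINT t|seg L. w t * (norm (p t))\<^sup>2)"
  proof (subst Bochner_Integration.integral_add)
    show "integrable (seg L) (\<lambda>t. \<beta> * (M * indicator E t))"
      by (intro integrable_seg_bounded[of _ _ "\<beta> * M"]) (use M \<beta> in \<open>auto simp: indicator_def\<close>)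
    show "integrable (seg L) (\<lambda>t. w t * (norm (p t))\<^sup>2)"
      by (intro integrable_seg_bounded[of _ _ "M * B\<^sup>2"])
         (use w B in \<open>auto simp: norm_mult intro!: mult_mono power_mono order_trans[OF w(1) w(2)]\<close>)
  qed simp
  also have "\<dots> \<le> \<beta> * (M * measure (seg L) E) + \<beta> * c / 2" using \<beta>(2) by simp
  finally have "\<beta> * c \<le> \<beta> * (M * measure (seg L) E) + \<beta> * c / 2"
    using mult_left_mono[OF wc, of \<beta>] \<beta>(1) by linarith
  then have "\<beta> * (c / 2) \<le> \<beta> * (M * measure (seg L) E)" by (simp add: field_simps)
  then have "c / 2 \<le> M * measure (seg L) E" using \<beta>(1) by (simp only: mult_le_cancel_left_pos)
  moreover have "measure (seg L) E = measure lborel E"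
    by (subst measure_seg) (auto simp: E_def intro: arg_cong[where f="measure lborel"])
  ultimately have mE: "c / 2 \<le> M * measure lborel E" by simp
  have "M * (2 * h * real d) = c / 4 * (real d / real (Suc d))" using M by (simp add: h_def del: of_nat_Suc)
  also have "\<dots> \<le> c / 4 * 1" using c by (intro mult_left_mono) auto
  also have "\<dots> < c / 2" using c by simp
  also have "\<dots> \<le> M * measure lborel E" by fact
  finally have "2 * h * real d < measure lborel E" using M by (simp only: mult_less_cancel_left_pos)
  then obtain \<tau> where \<tau>: "\<And>i. i \<le> d \<Longrightarrow> \<tau> i \<in> E"
    "\<And>i j. i \<le> j \<Longrightarrow> j \<le> d \<Longrightarrow> h * (real j - real i) \<le> \<tau> j - \<tau> i"
    using separated_points[OF \<open>E \<in> sets borel\<close> EL h, of d] by blast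
  have sep: "h * \<bar>real i - real j\<bar> \<le> \<bar>\<tau> i - \<tau> j\<bar>" if "i \<le> d" "j \<le> d" for i j
    using \<tau>(2)[of i j] \<tau>(2)[of j i] that by (cases "i \<le> j") (auto simp: abs_if)
  have inj: "inj_on (\<lambda>i. complex_of_real (\<tau> i)) {..d}"
  proof (rule inj_onI)
    fix i j assume "i \<in> {..d}" "j \<in> {..d}" "complex_of_real (\<tau> i) = complex_of_real (\<tau> j)"
    then have "h * \<bar>real i - real j\<bar> \<le> 0" using sep[of i j] by simp
    then show "i = j" using h by (simp add: mult_le_0_iff)
  qed
  have "p t = (\<Sum>i\<le>d. p (\<tau> i) * (\<Prod>j\<in>{..d} - {i}. (of_real t - of_real (\<tau> j)) / (of_real (\<tau> i) - of_real (\<tau> j))))"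
    unfolding p_def by (rule lagrange_interpolation[OF inj])
  also have "norm \<dots> \<le> (\<Sum>i\<le>d. sqrt \<beta> * ((L / h) ^ d / (fact i * fact (d - i))))"
  proof (intro order_trans[OF norm_sum] sum_mono)
    fix i assume "i \<in> {..d}"
    then have i: "i \<le> d" by simp
    have "norm (p (\<tau> i)) \<le> sqrt \<beta>" using \<tau>(1)[OF i] by (intro real_le_rsqrt) (auto simp: E_def)
    moreover have "norm (\<Prod>j\<in>{..d} - {i}. (of_real t - of_real (\<tau> j)) / (of_real (\<tau> i) - complex_of_real (\<tau> j)))
        \<le> (\<Prod>j\<in>{..d} - {i}. (L / h) / \<bar>real i - real j\<bar>)"
      unfolding prod_norm[symmetric]
    proof (rule prod_mono)
      fix j assume j: "j \<in> {..d} - {i}"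
      then have "\<tau> j \<in> {0..L}" using \<tau>(1) by (auto simp: E_def)
      then have "\<bar>t - \<tau> j\<bar> \<le> L" using t by auto
      moreover have "0 < h * \<bar>real i - real j\<bar>" using h j by simp
      ultimately have "\<bar>t - \<tau> j\<bar> / \<bar>\<tau> i - \<tau> j\<bar> \<le> L / (h * \<bar>real i - real j\<bar>)"
        using sep[of i j] i j L by (intro frac_le) auto
      then show "0 \<le> norm ((of_real t - of_real (\<tau> j)) / (of_real (\<tau> i) - complex_of_real (\<tau> j))) \<and>
        norm ((of_real t - of_real (\<tau> j)) / (of_real (\<tau> i) - complex_of_real (\<tau> j))) \<le> (L / h) / \<bar>real i - real j\<bar>"
        unfolding norm_divide of_real_diff[symmetric] norm_of_real by simp
    qed
    moreover have "(\<Prod>j\<in>{..d} - {i}. (L / h) / \<bar>real i - real j\<bar>) = (L / h) ^ d / (fact i * fact (d - i))"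
      unfolding prod_dividef prod_abs_diff_nat[OF i] using i by (simp add: power_divide)
    ultimately show "norm (p (\<tau> i) * (\<Prod>j\<in>{..d} - {i}. (of_real t - of_real (\<tau> j)) / (of_real (\<tau> i) - of_real (\<tau> j))))
        \<le> sqrt \<beta> * ((L / h) ^ d / (fact i * fact (d - i)))"
      unfolding norm_mult using \<beta>(1) by (intro mult_mono) auto
  qed
  also have "\<dots> = sqrt \<beta> * (L / h) ^ d * ((\<Sum>i\<le>d. real (d choose i)) / fact d)"
    unfolding sum_divide_distrib sum_distrib_left
    by (intro sum.cong refl) (simp add: binomial_fact)
  also have "(\<Sum>i\<le>d. real (d choose i)) = 2 ^ d"
    unfolding of_nat_sum[symmetric] choose_row_sum by simp
  \<comment> \<open>Since \<open>2 * L / h\<close> equals \<open>16 * L * M / c * (d + 1)\<close>,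
    the factor \<open>(d + 1) ^ d\<close> appears; division by \<open>fact d\<close> reduces it to
    an exponential.\<close>
  also have "sqrt \<beta> * (L / h) ^ d * (2 ^ d / fact d) = sqrt \<beta> * ((16 * L * M / c) ^ d * (real (Suc d) ^ d / fact d))"
  proof -
    have "(L / h) ^ d * 2 ^ d = (16 * L * M / c) ^ d * real (Suc d) ^ d"
      unfolding power_mult_distrib[symmetric] h_def by (rule arg_cong[where f="\<lambda>x. x ^ d"]) simp
    then show ?thesis by simp
  qed
  also have "\<dots> \<le> sqrt \<beta> * ((16 * L * M / c) ^ d * exp (real (Suc d)))"
    using \<beta>(1) L M c by (intro mult_left_mono power_div_fact_le_exp) auto
  finally have "norm (p t) \<le> sqrt \<beta> * ((16 * L * M / c) ^ d * exp (real (Suc d)))" .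
  then have "(norm (p t))\<^sup>2 \<le> (sqrt \<beta> * ((16 * L * M / c) ^ d * exp (real (Suc d))))\<^sup>2"
    by (intro power_mono) auto
  then show ?thesis using \<beta>(1) by (simp only: power_mult_distrib real_sqrt_pow2 less_imp_le)
qed

lemma remez_integral:
  fixes b :: "nat \<Rightarrow> complex" and w :: "real \<Rightarrow> real" and d :: nat
  assumes L: "0 < L" and c: "0 < c" and [measurable]: "w \<in> borel_measurable borel"
    and w: "\<And>t. 0 \<le> w t" "\<And>t. w t \<le> M" and wc: "c \<le> (LINT t|seg L. w t)"
  shows "(LINT t|seg L. (norm (\<Sum>k\<le>d. b k * of_real t ^ k))\<^sup>2)
    \<le> L * (2 / c) * ((16 * L * M / c) ^ d * exp (real (Suc d)))\<^sup>2
        * (LINT t|seg L. w t * (norm (\<Sum>k\<le>d. b k * of_real t ^ k))\<^sup>2)"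
proof -
  let ?p = "\<lambda>t::real. \<Sum>k\<le>d. b k * of_real t ^ k"
  let ?Q = "LINT t|seg L. w t * (norm (?p t))\<^sup>2"
  let ?K = "((16 * L * M / c) ^ d * exp (real (Suc d)))\<^sup>2"
  have Q0: "0 \<le> ?Q" by (intro integral_nonneg_AE AE_I2 mult_nonneg_nonneg w) auto
  have *: "(LINT t|seg L. (norm (?p t))\<^sup>2) \<le> L * (\<beta> * ?K)" if "0 < \<beta>" "?Q \<le> \<beta> * c / 2" for \<beta>
  proof -
    have pw: "t \<in> {0..L} \<Longrightarrow> (norm (?p t))\<^sup>2 \<le> \<beta> * ?K" for t
      by (rule remez_pointwise) (use assms that in auto)
    have "(LINT t|seg L. (norm (?p t))\<^sup>2) \<le> (LINT t|seg L. \<beta> * ?K)"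
    proof (rule integral_mono_AE)
      show "integrable (seg L) (\<lambda>t. (norm (?p t))\<^sup>2)"
        by (rule integrable_seg_bounded[of _ _ "\<beta> * ?K"]) (use pw in auto)
      show "AE t in seg L. (norm (?p t))\<^sup>2 \<le> \<beta> * ?K"
        using AE_seg by eventually_elim (rule pw)
    qed simp
    then show ?thesis using L by simp
  qed
  \<comment> \<open>The weighted integral may be 0 while the pointwise bound needs a positive
    \<beta>; hence \<open>\<beta> = 2 / c * ?Q + e\<close>, and \<open>e\<close> tends to 0.\<close>
  have "((\<lambda>e. L * ((2 / c * ?Q + e) * ?K)) \<longlongrightarrow> L * ((2 / c * ?Q + 0) * ?K)) (at_right 0)"
    by (intro tendsto_intros)
  then have "(LINT t|seg L. (norm (?p t))\<^sup>2) \<le> L * ((2 / c * ?Q + 0) * ?K)"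
  proof (rule tendsto_lowerbound)
    show "\<forall>\<^sub>F e in at_right 0. (LINT t|seg L. (norm (?p t))\<^sup>2) \<le> L * ((2 / c * ?Q + e) * ?K)"
      using eventually_at_right_less[of 0]
    proof eventually_elim
      case (elim e)
      have "0 \<le> 2 / c * ?Q" using c Q0 by simp
      then have "0 < 2 / c * ?Q + e" using elim by linarith
      moreover have "?Q \<le> (2 / c * ?Q + e) * c / 2" using c elim by (simp add: field_simps)
      ultimately show ?case by (rule *)
    qed
  qed simp
  then show ?thesis by (simp only: add_0_right mult_ac)
qed

section \<open>Frequencies in one strip\<close>

text \<open>Fubini for integrands that are bounded only for \<open>y\<close> in a set
  \<open>A\<close> of full measure. Polynomials in the segment parameter are of this kind: unbounded
  on the line that carries \<open>seg L\<close>, but bounded on \<open>{0..L}\<close>.\<close>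

lemma integrable_pair_bounded:
  fixes f :: "'a::euclidean_space \<Rightarrow> 'c::euclidean_space \<Rightarrow> 'b::{banach, second_countable_topology}"
  assumes fin: "finite_measure M1" "finite_measure M2"
    and [measurable_cong]: "sets M1 = sets borel" "sets M2 = sets borel"
    and f [measurable]: "case_prod f \<in> borel_measurable (borel \<Otimes>\<^sub>M borel)"
    and A [measurable]: "A \<in> sets borel" "AE y in M2. y \<in> A"
    and bd: "\<And>x y. y \<in> A \<Longrightarrow> norm (f x y) \<le> B"
  shows "integrable (M1 \<Otimes>\<^sub>M M2) (case_prod f)"
    and "integrable M1 (\<lambda>x. LINT y|M2. f x y)"
    and "integrable M2 (\<lambda>y. LINT x|M1. f x y)"
    and "(LINT y|M2. LINT x|M1. f x y) = (LINT x|M1. LINT y|M2. f x y)"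
proof -
  interpret M1: finite_measure M1 by fact
  interpret M2: finite_measure M2 by fact
  interpret pair_sigma_finite M1 M2 ..
  interpret P: finite_measure "M1 \<Otimes>\<^sub>M M2" by (intro finite_measure_pair_measure fin)
  have sp: "space M1 = UNIV" "space M2 = UNIV" 
    using sets_eq_imp_space_eq[OF assms(3)] sets_eq_imp_space_eq[OF assms(4)] by simp_all
  show *: "integrable (M1 \<Otimes>\<^sub>M M2) (case_prod f)"
  proof (rule P.integrable_const_bound[of _ B])
    have "AE z in M1 \<Otimes>\<^sub>M M2. snd z \<in> A"
    proof (rule AE_pair_measure)
      show "{z \<in> space (M1 \<Otimes>\<^sub>M M2). snd z \<in> A} \<in> sets (M1 \<Otimes>\<^sub>M M2)" by measurable
    qed (use A in simp)
    then show "AE z in M1 \<Otimes>\<^sub>M M2. norm (case_prod f z) \<le> B"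
      by eventually_elim (auto simp: bd split: prod.split)
  qed measurable
  show "integrable M1 (\<lambda>x. LINT y|M2. f x y)" using integrable_fst'[OF *] by simp
  show "integrable M2 (\<lambda>y. LINT x|M1. f x y)" using integrable_snd[OF *] by simp
  show "(LINT y|M2. LINT x|M1. f x y) = (LINT x|M1. LINT y|M2. f x y)" by (rule Fubini_integral[OF *])
qed

lemmas integrable_tm_seg =
  integrable_pair_bounded[OF tm.finite_measure_axioms seg.finite_measure_axioms sets_tm sets_seg _ _ AE_seg, simplified]

lemma tsum_shift: "tsum S a (x + t *\<^sub>R v) = tsum S (\<lambda>k. a k * cis (2 * pi * (t * (k \<bullet> v)))) x"
  by (simp add: tsum_def ech_add_right ech_scaleR_right mult_ac)

lemma norm_add_sq_le: "(norm (x + y :: complex))\<^sup>2 \<le> 2 * (norm x)\<^sup>2 + 2 * (norm y)\<^sup>2"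
proof -
  have "(norm (x + y))\<^sup>2 \<le> (norm x + norm y)\<^sup>2" by (intro power_mono norm_triangle_ineq) auto
  also have "\<dots> \<le> 2 * (norm x)\<^sup>2 + 2 * (norm y)\<^sup>2"
    using sum_squares_bound[of "norm x" "norm y"] by (simp add: power2_sum)
  finally show ?thesis .
qed

lemma tsum_add: "tsum S a x + tsum S b x = tsum S (\<lambda>k. a k + b k) x"
  by (simp add: tsum_def sum.distrib distrib_right)

text \<open>Along \<open>x + t \<nu>\<close> the sum is, up to the phase of \<open>lam\<close>, a
  combination of the \<open>q k t\<close>, whose Taylor polynomials \<open>p k t\<close> of degree
  \<open>d\<close> err by at most \<rho> on \<open>{0..L}\<close>. Remez applies to the polynomial
  part for almost every \<open>x\<close>. The remainder enters the constants only through its norm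
  in \<open>x\<close> for fixed \<open>t\<close>, where Parseval applies, so the number of
  frequencies plays no part in them.\<close>

lemma strip_bound_degree:
  fixes d :: nat and a :: "real^2 \<Rightarrow> complex"
  assumes "torus_weight g M" and per: "lattice_periodic g"
    and L: "0 < L" and c: "0 < c"
    and fib: "AE x in tm. c \<le> (LINT t|seg L. g (x + t *\<^sub>R \<nu>))"
    and S: "finite S" "S \<subseteq> int_lattice" and strip: "\<And>k. k \<in> S \<Longrightarrow> \<bar>k \<bullet> \<nu> - lam\<bar> \<le> 1"
  defines "K \<equiv> L * (2 / c) * ((16 * L * M / c) ^ d * exp (real (Suc d)))\<^sup>2"
    and "\<rho> \<equiv> (2 * pi * L) ^ Suc d / fact (Suc d)"
    and "N \<equiv> (\<Sum>k\<in>S. (norm (a k))\<^sup>2)"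
  shows "N \<le> 4 * K * (LINT x|tm. g x * (norm (tsum S a x))\<^sup>2) + (4 * K * M + 2) * \<rho>\<^sup>2 * N"
proof -
  interpret torus_weight g M by fact
  define q where "q k t = cis (2 * pi * (t * (k \<bullet> \<nu> - lam)))" for k and t :: real
  define p where "p k t = (\<Sum>j\<le>d. (\<i> * of_real (2 * pi * (t * (k \<bullet> \<nu> - lam)))) ^ j / fact j)" for k and t :: real
  define r where "r k t = q k t - p k t" for k t
  let ?G = "\<lambda>x t. tsum S (\<lambda>k. a k * q k t) x"
  let ?P = "\<lambda>x t. tsum S (\<lambda>k. a k * p k t) x"
  let ?R = "\<lambda>x t. tsum S (\<lambda>k. a k * r k t) x"
  let ?f = "tsum S a"
  have [measurable]: "q k \<in> borel_measurable borel" "p k \<in> borel_measurable borel" "r k \<in> borel_measurable borel" for k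
    unfolding r_def q_def p_def cis_conv_exp by measurable
  have GPR: "?G x t = ?P x t + ?R x t" for x t
    unfolding tsum_add by (simp add: r_def algebra_simps)
  have PGR: "?P x t = ?G x t + - ?R x t" for x t using GPR[of t x] by simp
  have nG: "norm (?G x t) = norm (?f (x + t *\<^sub>R \<nu>))" for x t
  proof -
    have "?f (x + t *\<^sub>R \<nu>) = cis (2 * pi * (t * lam)) * ?G x t"
      unfolding tsum_shift unfolding tsum_def sum_distrib_left
      by (intro sum.cong refl) (simp add: q_def cis_mult algebra_simps)
    then show ?thesis by (simp add: norm_mult)
  qed
  have nr: "norm (r k t) \<le> \<rho>" if "k \<in> S" "t \<in> {0..L}" for k t
  proof -
    have "norm (r k t) \<le> \<bar>2 * pi * (t * (k \<bullet> \<nu> - lam))\<bar> ^ Suc d / fact (Suc d)"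
      using iexp_approx1[of "2 * pi * (t * (k \<bullet> \<nu> - lam))" d]
      unfolding r_def q_def p_def cis_conv_exp by simp
    also have "\<dots> \<le> (2 * pi * L) ^ Suc d / fact (Suc d)"
    proof (intro divide_right_mono power_mono)
      have "\<bar>t\<bar> * \<bar>k \<bullet> \<nu> - lam\<bar> \<le> L * 1" using that strip[of k] L by (intro mult_mono) auto
      then show "\<bar>2 * pi * (t * (k \<bullet> \<nu> - lam))\<bar> \<le> 2 * pi * L" by (simp add: abs_mult)
    qed auto
    finally show ?thesis unfolding \<rho>_def .
  qed
  have \<rho>0: "0 \<le> \<rho>" using L by (simp add: \<rho>_def)
  have N0: "0 \<le> N" unfolding N_def by (intro sum_nonneg) auto
  have K0: "0 \<le> K" unfolding K_def using L c by simp
  have np: "norm (p k t) \<le> 1 + \<rho>" if "k \<in> S" "t \<in> {0..L}" for k t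
  proof -
    have "p k t = q k t - r k t" by (simp add: r_def)
    then have "norm (p k t) \<le> norm (q k t) + norm (r k t)" using norm_triangle_ineq4 by metis
    then show ?thesis using nr[OF that] by (simp add: q_def)
  qed
  define A where "A = (\<Sum>k\<in>S. norm (a k)) * (1 + \<rho>)"
  have bd: "norm (tsum S (\<lambda>k. a k * u k) x) \<le> A" if "\<And>k. k \<in> S \<Longrightarrow> norm (u k) \<le> 1 + \<rho>" for u x
    unfolding A_def sum_distrib_right
    by (rule order_trans[OF norm_tsum_le]) (auto simp: norm_mult intro!: sum_mono mult_left_mono that)
  have bP: "norm (?P x t) \<le> A" if "t \<in> {0..L}" for x t by (intro bd np that)
  have bR: "norm (?R x t) \<le> A" if "t \<in> {0..L}" for x t
    by (intro bd order_trans[OF nr[OF _ that]]) auto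
  have bG: "norm (?G x t) \<le> A" if "t \<in> {0..L}" for x t by (intro bd) (auto simp: q_def \<rho>0)
  have A2: "(norm (?P x t))\<^sup>2 \<le> A\<^sup>2" "(norm (?R x t))\<^sup>2 \<le> A\<^sup>2" "(norm (?G x t))\<^sup>2 \<le> A\<^sup>2"
    if "t \<in> {0..L}" for x t
    using bP[OF that] bR[OF that] bG[OF that] by (auto intro: power_mono)
  have mP[measurable]: "(\<lambda>z. ?P (fst z) (snd z)) \<in> borel_measurable (borel \<Otimes>\<^sub>M borel)"
    "(\<lambda>z. ?G (fst z) (snd z)) \<in> borel_measurable (borel \<Otimes>\<^sub>M borel)"
    "(\<lambda>z. ?R (fst z) (snd z)) \<in> borel_measurable (borel \<Otimes>\<^sub>M borel)"
    unfolding tsum_def by measurable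
  have mg[measurable]: "(\<lambda>z. g (fst z + snd z *\<^sub>R \<nu>)) \<in> borel_measurable (borel \<Otimes>\<^sub>M borel)"
    by measurable
  note F1 = integrable_tm_seg[of "\<lambda>x t. (norm (?P x t))\<^sup>2" L "A\<^sup>2"]
  have PP: "integrable (seg L) (\<lambda>t. LINT x|tm. (norm (?P x t))\<^sup>2)"
    "integrable tm (\<lambda>x. LINT t|seg L. (norm (?P x t))\<^sup>2)"
    "(LINT t|seg L. LINT x|tm. (norm (?P x t))\<^sup>2) = (LINT x|tm. LINT t|seg L. (norm (?P x t))\<^sup>2)"
    by (rule F1; use A2 in \<open>simp add: split_beta'\<close>)+
  have gP: "norm (g (x + t *\<^sub>R \<nu>) * (norm (?P x t))\<^sup>2) \<le> M * A\<^sup>2" if "t \<in> {0..L}" for x t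
    using A2(1)[OF that, of x] g_nonneg[of "x + t *\<^sub>R \<nu>"] g_le[of "x + t *\<^sub>R \<nu>"] M_nonneg
    by (simp add: norm_mult mult_mono)
  note F2 = integrable_tm_seg[of "\<lambda>x t. g (x + t *\<^sub>R \<nu>) * (norm (?P x t))\<^sup>2" L "M * A\<^sup>2"]
  have GP: "integrable (seg L) (\<lambda>t. LINT x|tm. g (x + t *\<^sub>R \<nu>) * (norm (?P x t))\<^sup>2)"
    "integrable tm (\<lambda>x. LINT t|seg L. g (x + t *\<^sub>R \<nu>) * (norm (?P x t))\<^sup>2)"
    "(LINT t|seg L. LINT x|tm. g (x + t *\<^sub>R \<nu>) * (norm (?P x t))\<^sup>2)
      = (LINT x|tm. LINT t|seg L. g (x + t *\<^sub>R \<nu>) * (norm (?P x t))\<^sup>2)"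
    by (rule F2; use gP in \<open>simp add: split_beta'\<close>)+
  have RN: "(LINT x|tm. (norm (?R x t))\<^sup>2) \<le> \<rho>\<^sup>2 * N" if "t \<in> {0..L}" for t
  proof -
    have "(LINT x|tm. (norm (?R x t))\<^sup>2) = (\<Sum>k\<in>S. (norm (a k))\<^sup>2 * (norm (r k t))\<^sup>2)"
      by (subst parseval[OF S]) (simp add: norm_mult power_mult_distrib)
    also have "\<dots> \<le> (\<Sum>k\<in>S. (norm (a k))\<^sup>2 * \<rho>\<^sup>2)"
      by (intro sum_mono mult_left_mono power_mono nr that) auto
    finally show ?thesis by (simp add: N_def sum_distrib_left mult.commute)
  qed
  have iP: "integrable tm (\<lambda>x. (norm (?P x t))\<^sup>2)" and iR: "integrable tm (\<lambda>x. (norm (?R x t))\<^sup>2)" for t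
    by (rule integrable_tsum_sq)+
  let ?E = "LINT x|tm. g x * (norm (?f x))\<^sup>2"
  have lower: "N \<le> 2 * (LINT x|tm. (norm (?P x t))\<^sup>2) + 2 * (\<rho>\<^sup>2 * N)" if "t \<in> {0..L}" for t
  proof -
    have "N = (LINT x|tm. (norm (?G x t))\<^sup>2)"
      by (subst parseval[OF S]) (simp add: norm_mult power_mult_distrib N_def q_def)
    also have "\<dots> \<le> (LINT x|tm. 2 * (norm (?P x t))\<^sup>2 + 2 * (norm (?R x t))\<^sup>2)"
      by (intro integral_mono integrable_tsum_sq Bochner_Integration.integrable_add integrable_mult_right)
         (simp only: GPR norm_add_sq_le)
    also have "\<dots> = 2 * (LINT x|tm. (norm (?P x t))\<^sup>2) + 2 * (LINT x|tm. (norm (?R x t))\<^sup>2)"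
      using iP[of t] iR[of t] by simp
    finally show ?thesis using RN[OF that] by linarith
  qed
  have upper: "(LINT x|tm. g (x + t *\<^sub>R \<nu>) * (norm (?P x t))\<^sup>2) \<le> 2 * ?E + 2 * (M * (\<rho>\<^sup>2 * N))"
    if t: "t \<in> {0..L}" for t
  proof -
    have ig: "integrable tm (\<lambda>x. g (x + t *\<^sub>R \<nu>) * (norm (tsum S u x))\<^sup>2)" for u
      by (rule Bochner_Integration.integrable_bound[OF integrable_mult_right[OF integrable_tsum_sq[of S u], of M]])
         (auto intro!: AE_I2 mult_right_mono simp: abs_mult g_nonneg g_le M_nonneg)
    have "(LINT x|tm. g (x + t *\<^sub>R \<nu>) * (norm (?P x t))\<^sup>2)
        \<le> (LINT x|tm. 2 * (g (x + t *\<^sub>R \<nu>) * (norm (?G x t))\<^sup>2) + 2 * (M * (norm (?R x t))\<^sup>2))"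
    proof (rule integral_mono)
      fix x
      have "(norm (?P x t))\<^sup>2 \<le> 2 * (norm (?G x t))\<^sup>2 + 2 * (norm (?R x t))\<^sup>2"
        unfolding PGR[of t x] using norm_add_sq_le[of "?G x t" "- ?R x t"] by simp
      then have "g (x + t *\<^sub>R \<nu>) * (norm (?P x t))\<^sup>2
          \<le> g (x + t *\<^sub>R \<nu>) * (2 * (norm (?G x t))\<^sup>2 + 2 * (norm (?R x t))\<^sup>2)"
        by (intro mult_left_mono g_nonneg)
      also have "\<dots> \<le> 2 * (g (x + t *\<^sub>R \<nu>) * (norm (?G x t))\<^sup>2) + 2 * (M * (norm (?R x t))\<^sup>2)"
        using mult_right_mono[OF g_le[of "x + t *\<^sub>R \<nu>"], of "(norm (?R x t))\<^sup>2"] by (simp add: algebra_simps)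
      finally show "g (x + t *\<^sub>R \<nu>) * (norm (?P x t))\<^sup>2
          \<le> 2 * (g (x + t *\<^sub>R \<nu>) * (norm (?G x t))\<^sup>2) + 2 * (M * (norm (?R x t))\<^sup>2)" .
    qed (intro Bochner_Integration.integrable_add integrable_mult_right ig integrable_tsum_sq)+
    also have "\<dots> = 2 * (LINT x|tm. g (x + t *\<^sub>R \<nu>) * (norm (?G x t))\<^sup>2) + 2 * (M * (LINT x|tm. (norm (?R x t))\<^sup>2))"
      using ig[of "\<lambda>k. a k * q k t"] iR[of t] by simp
    \<comment> \<open>\<open>norm (?G x t)\<close> is the modulus of the sum at the translated
      point, so weight and sum are translated together and the shift can be undone.\<close>
    also have "(LINT x|tm. g (x + t *\<^sub>R \<nu>) * (norm (?G x t))\<^sup>2) = ?E"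
      unfolding nG
      by (rule integral_tm_shift[of "\<lambda>x. g x * (norm (?f x))\<^sup>2"])
         (use per lattice_periodic_tsum[OF S(2), of a] in \<open>auto simp: lattice_periodic_def\<close>)
    finally show ?thesis using mult_left_mono[OF RN[OF t] M_nonneg] by linarith
  qed
  have "L * N = (LINT t|seg L. N)" using L by simp
  also have "\<dots> \<le> (LINT t|seg L. 2 * (LINT x|tm. (norm (?P x t))\<^sup>2) + 2 * (\<rho>\<^sup>2 * N))"
  proof (rule integral_mono_AE)
    show "AE t in seg L. N \<le> 2 * (LINT x|tm. (norm (?P x t))\<^sup>2) + 2 * (\<rho>\<^sup>2 * N)"
      using AE_seg by eventually_elim (rule lower)
  qed (use PP(1) in simp_all)
  also have "\<dots> = 2 * (LINT x|tm. LINT t|seg L. (norm (?P x t))\<^sup>2) + L * (2 * (\<rho>\<^sup>2 * N))"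
    using PP(1) L by (simp add: PP(3))
  also have "(LINT x|tm. LINT t|seg L. (norm (?P x t))\<^sup>2)
      \<le> (LINT x|tm. K * (LINT t|seg L. g (x + t *\<^sub>R \<nu>) * (norm (?P x t))\<^sup>2))"
  proof (rule integral_mono_AE)
    show "AE x in tm. (LINT t|seg L. (norm (?P x t))\<^sup>2) \<le> K * (LINT t|seg L. g (x + t *\<^sub>R \<nu>) * (norm (?P x t))\<^sup>2)"
      using fib
    proof eventually_elim
      case (elim x)
      \<comment> \<open>Exchanging the sums exhibits a polynomial in \<open>t\<close> of degree
        \<open>d\<close> whose coefficients depend on \<open>x\<close>, the form that Remez
        needs.\<close>
      have Px: "?P x t = (\<Sum>j\<le>d. (\<Sum>k\<in>S. a k * ech k x * ((\<i> * of_real (2 * pi * (k \<bullet> \<nu> - lam))) ^ j / fact j)) * of_real t ^ j)" for t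
        unfolding tsum_def p_def sum_distrib_left sum_distrib_right
        by (subst sum.swap) (intro sum.cong refl, simp add: power_mult_distrib mult_ac)
      show ?case unfolding Px K_def
        by (rule remez_integral) (use L c elim g_nonneg g_le in auto)
    qed
  qed (intro PP GP integrable_mult_right)+
  also have "\<dots> = K * (LINT t|seg L. LINT x|tm. g (x + t *\<^sub>R \<nu>) * (norm (?P x t))\<^sup>2)"
    by (simp add: GP(3))
  also have "(LINT t|seg L. LINT x|tm. g (x + t *\<^sub>R \<nu>) * (norm (?P x t))\<^sup>2)
      \<le> (LINT t|seg L. 2 * ?E + 2 * (M * (\<rho>\<^sup>2 * N)))"
  proof (rule integral_mono_AE)
    show "AE t in seg L. (LINT x|tm. g (x + t *\<^sub>R \<nu>) * (norm (?P x t))\<^sup>2) \<le> 2 * ?E + 2 * (M * (\<rho>\<^sup>2 * N))"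
      using AE_seg by eventually_elim (rule upper)
  qed (use GP(1) in simp_all)
  also have "\<dots> = L * (2 * ?E + 2 * (M * (\<rho>\<^sup>2 * N)))" using L by simp
  finally have "L * N \<le> 2 * (K * (L * (2 * ?E + 2 * (M * (\<rho>\<^sup>2 * N))))) + L * (2 * (\<rho>\<^sup>2 * N))"
    using K0 by (simp add: mult_left_mono)
  also have "\<dots> = L * (4 * K * ?E + (4 * K * M + 2) * \<rho>\<^sup>2 * N)" by (simp add: algebra_simps)
  finally show ?thesis using L by (simp only: mult_le_cancel_left_pos)
qed

text \<open>The Remez constant grows geometrically in \<open>d\<close> while \<rho> decays
  factorially, so some \<open>d\<close> makes the error at most half of the left-hand side. This
  \<open>d\<close>, and with it \<kappa>, depends on \<open>L\<close>, \<open>c\<close> and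
  \<open>M\<close> alone, which permits a change of weight later.\<close>

lemma strip_bound:
  assumes L: "0 < L" and c: "0 < c" and M: "0 \<le> M"
  shows "\<exists>\<kappa>>0. \<forall>g \<nu> lam S a. torus_weight g M \<and> lattice_periodic g
    \<and> (AE x in tm. c \<le> (LINT t|seg L. g (x + t *\<^sub>R \<nu>)))
    \<and> finite S \<and> S \<subseteq> int_lattice \<and> (\<forall>k\<in>S. \<bar>k \<bullet> \<nu> - lam\<bar> \<le> 1) \<longrightarrow>
    \<kappa> * (\<Sum>k\<in>S. (norm (a k))\<^sup>2) \<le> (LINT x|tm. g x * (norm (tsum S a x))\<^sup>2)"
proof -
  define K where "K d = L * (2 / c) * ((16 * L * M / c) ^ d * exp (real (Suc d)))\<^sup>2" for d
  define \<rho> where "\<rho> d = (2 * pi * L) ^ Suc d / fact (Suc d)" for d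
  have lim0: "(\<lambda>n. x ^ n / fact n) \<longlonglongrightarrow> 0" for x :: real
    using summable_LIMSEQ_zero[OF summable_exp[of x]] by (simp add: divide_inverse_commute)
  have rho: "\<rho> \<longlonglongrightarrow> 0"
    unfolding \<rho>_def by (rule LIMSEQ_Suc[OF lim0])
  \<comment> \<open>The base that collects all geometric factors of the Remez constant and of
    \<rho>. The \<open>+ 1\<close> makes the first factor at least 1, so that its exponent
    \<open>d\<close> can be raised to \<open>Suc d\<close>.\<close>
  define y where "y = (16 * L * M / c + 1) * exp 1 * (2 * pi * L)"
  have y: "(\<lambda>d. y ^ Suc d / fact (Suc d)) \<longlonglongrightarrow> 0" by (rule LIMSEQ_Suc[OF lim0])
  have "(\<lambda>d. L * (2 / c) * (y ^ Suc d / fact (Suc d))\<^sup>2) \<longlonglongrightarrow> L * (2 / c) * 0\<^sup>2"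
    by (intro tendsto_intros y)
  moreover have "norm (K d * (\<rho> d)\<^sup>2) \<le> L * (2 / c) * (y ^ Suc d / fact (Suc d))\<^sup>2" for d
  proof -
    have "(16 * L * M / c) ^ d * exp (real (Suc d)) \<le> (16 * L * M / c + 1) ^ Suc d * exp 1 ^ Suc d"
    proof (rule mult_mono)
      have "(16 * L * M / c) ^ d \<le> (16 * L * M / c + 1) ^ d" using L M c by (intro power_mono) auto
      also have "\<dots> \<le> (16 * L * M / c + 1) ^ Suc d" using L M c by (intro power_increasing) auto
      finally show "(16 * L * M / c) ^ d \<le> (16 * L * M / c + 1) ^ Suc d" .
      show "exp (real (Suc d)) \<le> exp 1 ^ Suc d" by (simp add: exp_of_nat_mult[symmetric] del: power_Suc of_nat_Suc)
    qed (use L M c in auto)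
    then have "(16 * L * M / c) ^ d * exp (real (Suc d)) * \<rho> d \<le> (16 * L * M / c + 1) ^ Suc d * exp 1 ^ Suc d * \<rho> d"
      using L by (intro mult_right_mono) (auto simp: \<rho>_def)
    also have "\<dots> = y ^ Suc d / fact (Suc d)"
      by (simp add: y_def \<rho>_def power_mult_distrib del: power_Suc)
    finally have *: "(16 * L * M / c) ^ d * exp (real (Suc d)) * \<rho> d \<le> y ^ Suc d / fact (Suc d)" .
    have "0 \<le> (16 * L * M / c) ^ d * exp (real (Suc d)) * \<rho> d"
      using L M c by (auto simp: \<rho>_def)
    then have "((16 * L * M / c) ^ d * exp (real (Suc d)) * \<rho> d)\<^sup>2 \<le> (y ^ Suc d / fact (Suc d))\<^sup>2"
      using * by (intro power_mono)
    then have "L * (2 / c) * ((16 * L * M / c) ^ d * exp (real (Suc d)) * \<rho> d)\<^sup>2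
        \<le> L * (2 / c) * (y ^ Suc d / fact (Suc d))\<^sup>2"
      using L c by (intro mult_left_mono) auto
    moreover have "K d * (\<rho> d)\<^sup>2 = L * (2 / c) * ((16 * L * M / c) ^ d * exp (real (Suc d)) * \<rho> d)\<^sup>2"
      by (simp add: K_def power_mult_distrib)
    moreover have "0 \<le> K d * (\<rho> d)\<^sup>2" using L c by (simp add: K_def)
    ultimately show ?thesis by simp
  qed
  ultimately have Krho: "(\<lambda>d. K d * (\<rho> d)\<^sup>2) \<longlonglongrightarrow> 0"
    by (intro Lim_null_comparison[of "\<lambda>d. K d * (\<rho> d)\<^sup>2"]) (auto intro: always_eventually)
  have "(\<lambda>d. 4 * M * (K d * (\<rho> d)\<^sup>2) + 2 * (\<rho> d)\<^sup>2) \<longlonglongrightarrow> 4 * M * 0 + 2 * 0\<^sup>2"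
    by (intro tendsto_intros Krho rho)
  then have "\<forall>\<^sub>F d in sequentially. 4 * M * (K d * (\<rho> d)\<^sup>2) + 2 * (\<rho> d)\<^sup>2 < 1 / 2"
    by (rule order_tendstoD) simp
  then obtain d where d: "4 * M * (K d * (\<rho> d)\<^sup>2) + 2 * (\<rho> d)\<^sup>2 < 1 / 2"
    by (auto simp: eventually_sequentially)
  have K0: "0 \<le> K d" using L c by (simp add: K_def)
  show ?thesis
  \<comment> \<open>The summand 1 is there because \<open>K d\<close> can vanish, namely for
    \<open>M = 0\<close> and \<open>d > 0\<close>.\<close>
  proof (intro exI[of _ "1 / (8 * (K d + 1))"] conjI allI impI; (elim conjE)?)
    show "0 < 1 / (8 * (K d + 1))" using K0 by simp
    fix g \<nu> lam S and a :: "real^2 \<Rightarrow> complex"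
    assume *: "torus_weight g M" "lattice_periodic g" "AE x in tm. c \<le> (LINT t|seg L. g (x + t *\<^sub>R \<nu>))"
      "finite S" "S \<subseteq> int_lattice" "\<forall>k\<in>S. \<bar>k \<bullet> \<nu> - lam\<bar> \<le> 1"
    let ?E = "LINT x|tm. g x * (norm (tsum S a x))\<^sup>2"
    define N where "N = (\<Sum>k\<in>S. (norm (a k))\<^sup>2)"
    have N0: "0 \<le> N" unfolding N_def by (intro sum_nonneg) auto
    have E0: "0 \<le> ?E"
      using torus_weight.energy_nonneg[OF *(1)] unfolding torus_weight.energy_def[OF *(1)] .
    have "N \<le> 4 * K d * ?E + (4 * K d * M + 2) * (\<rho> d)\<^sup>2 * N"
      unfolding K_def \<rho>_def N_def by (rule strip_bound_degree) (use * L c in auto)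
    also have "(4 * K d * M + 2) * (\<rho> d)\<^sup>2 * N \<le> 1 / 2 * N"
      using d N0 by (intro mult_right_mono) (auto simp: algebra_simps)
    finally have "N \<le> 8 * K d * ?E" by simp
    also have "\<dots> \<le> 8 * (K d + 1) * ?E" using E0 by (intro mult_right_mono) auto
    finally show "1 / (8 * (K d + 1)) * (\<Sum>k\<in>S. (norm (a k))\<^sup>2) \<le> ?E"
      unfolding N_def[symmetric] using K0 by (simp add: field_simps)
  qed
qed

section \<open>Frequencies in two parallel strips\<close>

text \<open>A weak form of Jordan's inequality. Up to \<open>pi / 3\<close> the derivative is at
  least \<open>1 / 2\<close>; beyond, \<open>sin x\<close> is at least \<open>4 / 5\<close>, which
  exceeds \<open>pi / 4\<close>.\<close>

lemma sin_ge_half: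
  assumes "0 \<le> x" "x \<le> pi / 2" shows "x / 2 \<le> sin x"
proof (cases "x \<le> pi / 3")
  case True
  show ?thesis
  proof (cases "x = 0")
    case False
    then have "0 < x" using assms by simp
    then obtain z where z: "0 < z" "z < x" "sin x - sin 0 = (x - 0) * cos z"
      using MVT2[of 0 x sin cos] by (auto intro: DERIV_sin)
    have "1 / 2 \<le> cos z"
      using cos_monotone_0_pi_le[of z "pi / 3"] z True pi_gt_zero by (simp add: cos_60)
    then have "x * (1 / 2) \<le> x * cos z" using assms by (intro mult_left_mono)
    then show ?thesis using z by simp
  qed simp
next
  case False
  have "sin (pi / 3) \<le> sin x"
    using False assms by (intro sin_monotone_2pi_le) auto
  moreover have "8 / 5 \<le> sqrt 3" by (rule real_le_rsqrt) (simp add: power2_eq_square)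
  moreover have "pi \<le> 16 / 5" by (rule order_trans[OF pi_approx(2)]) simp
  ultimately show ?thesis using assms by (simp add: sin_60)
qed

lemma norm_cis_diff: "norm (cis x - cis y) = 2 * \<bar>sin ((x - y) / 2)\<bar>"
proof -
  have "(norm (cis x - cis y))\<^sup>2 = 2 - 2 * cos (x - y)"
    unfolding cmod_power2 by (simp add: power2_diff cos_diff algebra_simps)
  also have "\<dots> = (2 * \<bar>sin ((x - y) / 2)\<bar>)\<^sup>2"
  proof -
    have "cos (2 * ((x - y) / 2)) = 1 - 2 * (sin ((x - y) / 2))\<^sup>2" by (rule cos_double_sin)
    moreover have "2 * ((x - y) / 2) = x - y" by simp
    ultimately have "cos (x - y) = 1 - 2 * (sin ((x - y) / 2))\<^sup>2" by (simp only:)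
    then show ?thesis by (simp add: power_mult_distrib)
  qed
  finally show ?thesis by (metis abs_ge_zero mult_nonneg_nonneg norm_ge_zero power2_eq_imp_eq zero_le_numeral)
qed

lemma norm_cis_minus_1_le: "norm (cis x - 1) \<le> \<bar>x\<bar>"
proof -
  have "norm (cis x - 1) = 2 * \<bar>sin (x / 2)\<bar>" using norm_cis_diff[of x 0] by simp
  also have "\<dots> \<le> 2 * \<bar>x / 2\<bar>" using abs_sin_x_le_abs_x[of "x / 2"] by linarith
  finally show ?thesis by simp
qed

text \<open>The three intervals are the \<eta>-neighbourhood of \<open>v\<close> modulo 1. The
  reason is that \<open>\<bar>sin (pi * y)\<bar>\<close> dominates the distance from
  \<open>y\<close> to the nearest integer, while the chord between the two points is twice such a
  sine.\<close>

lemma cis_near: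
  assumes "u \<in> {0..1}" "v \<in> {0..1}" and le: "norm (cis (2 * pi * u) - cis (2 * pi * v)) \<le> 2 * \<eta>"
  shows "u \<in> {v - \<eta>..v + \<eta>} \<union> {v + 1 - \<eta>..v + 1 + \<eta>} \<union> {v - 1 - \<eta>..v - 1 + \<eta>}"
proof -
  have le': "\<bar>sin (pi * (u - v))\<bar> \<le> \<eta>"
  proof -
    have "(2 * pi * u - 2 * pi * v) / 2 = pi * (u - v)" by (simp add: field_simps)
    then show ?thesis using le unfolding norm_cis_diff by simp
  qed
  have key: "y \<le> \<bar>sin (pi * y)\<bar>" if "0 \<le> y" "y \<le> 1/2" for y
  proof -
    have "pi * y \<le> pi * (1/2)" using that by (intro mult_left_mono) auto
    then have "pi * y / 2 \<le> sin (pi * y)" using that by (intro sin_ge_half) auto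
    moreover have "2 * y \<le> pi * y" using that pi_ge_two by (intro mult_right_mono) auto
    ultimately show ?thesis by linarith
  qed
  have key2: "1 - y \<le> \<bar>sin (pi * y)\<bar>" if "1/2 \<le> y" "y \<le> 1" for y
    using key[of "1 - y"] that by (simp add: right_diff_distrib)
  have "sin (pi * \<bar>u - v\<bar>) = sin (pi * (u - v)) \<or> sin (pi * \<bar>u - v\<bar>) = - sin (pi * (u - v))"
    by (cases "0 \<le> u - v") (auto simp: abs_if sin_minus[symmetric] algebra_simps)
  then have le2: "\<bar>sin (pi * \<bar>u - v\<bar>)\<bar> \<le> \<eta>" using le' by auto
  have "0 \<le> \<eta>" using le' by linarith
  have d1: "\<bar>u - v\<bar> \<le> 1" using assms by auto
  then have "\<bar>u - v\<bar> \<le> \<eta> \<or> 1 - \<bar>u - v\<bar> \<le> \<eta>"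
    using key[of "\<bar>u - v\<bar>"] key2[of "\<bar>u - v\<bar>"] le2 by (cases "\<bar>u - v\<bar> \<le> 1/2") auto
  then show ?thesis using d1 \<open>0 \<le> \<eta>\<close> by (auto simp: abs_if split: if_splits)
qed

text \<open>Relative to \<open>|A|\<^sup>2 + |B|\<^sup>2\<close> the modulus can be small only for
  phases in a short set \<open>X\<close>, because two such phases are close modulo 1. Off
  \<open>X\<close> the bound holds pointwise; on \<open>X\<close> at most
  \<open>6 * \<eta> * M\<close> of the integral of \<open>q\<close> is lost.\<close>

lemma two_phase_lower_bound:
  fixes q :: "real \<Rightarrow> real"
  assumes [measurable]: "q \<in> borel_measurable borel" and q: "\<And>u. 0 \<le> q u" "\<And>u. q u \<le> M"
    and \<eta>: "0 < \<eta>"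
  shows "\<eta>\<^sup>2 / 2 * ((LINT u|seg 1. q u) - 6 * \<eta> * M) * ((norm A)\<^sup>2 + (norm B)\<^sup>2)
    \<le> (LINT u|seg 1. q u * (norm (A + cis (2 * pi * u) * B))\<^sup>2)"
proof -
  define V where "V = (norm A)\<^sup>2 + (norm B)\<^sup>2"
  define F where "F u = A + cis (2 * pi * u) * B" for u :: real
  have [measurable]: "F \<in> borel_measurable borel" unfolding F_def cis_conv_exp by measurable
  have M: "0 \<le> M" using q order_trans by blast
  have V0: "0 \<le> V" by (simp add: V_def)
  define X where "X = {u \<in> {0..1}. (norm (F u))\<^sup>2 < \<eta>\<^sup>2 / 2 * V}"
  have [measurable]: "X \<in> sets borel" unfolding X_def by measurable
  have X: "measure (seg 1) X \<le> 6 * \<eta>"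
  proof (cases "X = {}")
    case False
    then obtain v where v: "v \<in> X" by blast
    have V: "0 < V" using v V0 unfolding X_def by (cases "V = 0") auto
    have "u \<in> {v - \<eta>..v + \<eta>} \<union> {v + 1 - \<eta>..v + 1 + \<eta>} \<union> {v - 1 - \<eta>..v - 1 + \<eta>}" if u: "u \<in> X" for u
    proof (rule cis_near)
      let ?e = "cis (2 * pi * u)" and ?e' = "cis (2 * pi * v)"
      have 1: "(norm (F u))\<^sup>2 < \<eta>\<^sup>2 / 2 * V" "(norm (F v))\<^sup>2 < \<eta>\<^sup>2 / 2 * V" using u v by (auto simp: X_def)
      \<comment> \<open>Eliminating \<open>A\<close> from \<open>F u\<close> and \<open>F v\<close>
        bounds \<open>B\<close>, and below, eliminating \<open>B\<close> bounds \<open>A\<close>;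
        together they bound \<open>V\<close> times the squared distance of the two phases.\<close>
      have "B * (?e - ?e') = F u + - F v" by (simp add: F_def algebra_simps)
      then have "(norm B)\<^sup>2 * (norm (?e - ?e'))\<^sup>2 = (norm (F u + - F v))\<^sup>2"
        by (simp only: power_mult_distrib[symmetric] norm_mult[symmetric])
      also have "\<dots> \<le> 2 * (norm (F u))\<^sup>2 + 2 * (norm (F v))\<^sup>2"
        using norm_add_sq_le[of "F u" "- F v"] by simp
      finally have B: "(norm B)\<^sup>2 * (norm (?e - ?e'))\<^sup>2 \<le> 2 * \<eta>\<^sup>2 * V" using 1 by linarith
      have "A * (?e - ?e') = ?e * F v + - (?e' * F u)" by (simp add: F_def algebra_simps)
      then have "(norm A)\<^sup>2 * (norm (?e - ?e'))\<^sup>2 = (norm (?e * F v + - (?e' * F u)))\<^sup>2"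
        by (simp only: power_mult_distrib[symmetric] norm_mult[symmetric])
      also have "\<dots> \<le> 2 * (norm (F v))\<^sup>2 + 2 * (norm (F u))\<^sup>2"
        using norm_add_sq_le[of "?e * F v" "- (?e' * F u)"] by (simp add: norm_mult)
      finally have "(norm A)\<^sup>2 * (norm (?e - ?e'))\<^sup>2 \<le> 2 * \<eta>\<^sup>2 * V" using 1 by linarith
      with B have "V * (norm (?e - ?e'))\<^sup>2 \<le> 4 * (\<eta>\<^sup>2 * V)"
        by (subst V_def) (simp add: distrib_right)
      then have "V * (norm (?e - ?e'))\<^sup>2 \<le> V * (2 * \<eta>)\<^sup>2"
        by (simp add: power_mult_distrib mult_ac)
      then have "(norm (?e - ?e'))\<^sup>2 \<le> (2 * \<eta>)\<^sup>2" using V by (simp only: mult_le_cancel_left_pos)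
      then show "norm (?e - ?e') \<le> 2 * \<eta>" 
        by (rule power2_le_imp_le) (use \<eta> in simp)
    qed (use u v in \<open>auto simp: X_def\<close>)
    then have sub: "X \<inter> {0..1} \<subseteq> {v - \<eta>..v + \<eta>} \<union> {v + 1 - \<eta>..v + 1 + \<eta>} \<union> {v - 1 - \<eta>..v - 1 + \<eta>}" by blast
    have "measure (seg 1) X = measure lborel (X \<inter> {0..1})" by (rule measure_seg) simp
    also have "\<dots> \<le> measure lborel ({v - \<eta>..v + \<eta>} \<union> {v + 1 - \<eta>..v + 1 + \<eta>} \<union> {v - 1 - \<eta>..v - 1 + \<eta>})"
    proof (rule measure_mono_fmeasurable[OF sub])
      have "{x..y} \<in> fmeasurable lborel" for x y :: real
        by (auto intro!: fmeasurableI simp: emeasure_lborel_Icc_eq)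
      then show "{v - \<eta>..v + \<eta>} \<union> {v + 1 - \<eta>..v + 1 + \<eta>} \<union> {v - 1 - \<eta>..v - 1 + \<eta>} \<in> fmeasurable lborel"
        by (intro fmeasurable.Un)
    qed simp
    also have "\<dots> \<le> 2 * \<eta> + 2 * \<eta> + 2 * \<eta>"
      by (intro order_trans[OF measure_Un_le] add_mono) (use \<eta> in auto)
    finally show ?thesis by simp
  qed (use \<eta> in simp)
  have iq: "integrable (seg 1) q" by (rule integrable_seg_bounded[of _ _ M]) (use q in auto)
  have iX: "integrable (seg 1) (\<lambda>u. M * indicator X u)"
    by (rule integrable_seg_bounded[of _ _ M]) (use M in \<open>auto simp: indicator_def\<close>)
  have "(LINT u|seg 1. q u) - 6 * \<eta> * M \<le> (LINT u|seg 1. q u) - M * measure (seg 1) X"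
    using mult_left_mono[OF X M] by (simp add: mult_ac)
  also have "\<dots> = (LINT u|seg 1. q u - M * indicator X u)"
    by (subst Bochner_Integration.integral_diff[OF iq iX]) simp
  finally have "\<eta>\<^sup>2 / 2 * V * ((LINT u|seg 1. q u) - 6 * \<eta> * M)
      \<le> \<eta>\<^sup>2 / 2 * V * (LINT u|seg 1. q u - M * indicator X u)"
    using V0 by (intro mult_left_mono) auto
  also have "\<dots> = (LINT u|seg 1. \<eta>\<^sup>2 / 2 * V * (q u - M * indicator X u))" by simp
  also have "\<dots> \<le> (LINT u|seg 1. q u * (norm (F u))\<^sup>2)"
  proof (rule integral_mono_AE)
    show "integrable (seg 1) (\<lambda>u. \<eta>\<^sup>2 / 2 * V * (q u - M * indicator X u))"
      using iq iX by simp
    have bF: "norm (F u) \<le> norm A + norm B" for u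
      unfolding F_def by (rule order_trans[OF norm_triangle_ineq]) (simp add: norm_mult)
    show "integrable (seg 1) (\<lambda>u. q u * (norm (F u))\<^sup>2)"
      by (rule integrable_seg_bounded[of _ _ "M * (norm A + norm B)\<^sup>2"])
         (use q M bF in \<open>auto simp: norm_mult intro!: mult_mono power_mono\<close>)
    show "AE u in seg 1. \<eta>\<^sup>2 / 2 * V * (q u - M * indicator X u) \<le> q u * (norm (F u))\<^sup>2"
      using AE_seg
    proof eventually_elim
      case (elim u)
      show ?case
      proof (cases "u \<in> X")
        case True
        have "\<eta>\<^sup>2 / 2 * V * (q u - M) \<le> 0"
          using q(2)[of u] V0 by (intro mult_nonneg_nonpos) auto
        then show ?thesis using True q(1)[of u] by (simp add: order_trans)
      next
        case False
        then have "\<eta>\<^sup>2 / 2 * V \<le> (norm (F u))\<^sup>2" using elim by (auto simp: X_def not_less)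
        then show ?thesis using False q(1)[of u] mult_left_mono by (fastforce simp: mult.commute)
      qed
    qed
  qed
  finally show ?thesis by (simp add: V_def F_def mult_ac)
qed

lemmas integrable_seg_seg =
  integrable_pair_bounded[OF seg.finite_measure_axioms seg.finite_measure_axioms sets_seg sets_seg _ _ AE_seg, simplified]

text \<open>\<open>m\<close> averages the weight over one period along \<nu>. Fibre integrals of
  \<open>m\<close> inherit the bound \<open>c\<close>, and \<eta> is chosen so that subtracting
  \<open>6 * \<eta> * M\<close> over the length \<open>L\<close> costs exactly \<open>c / 2\<close>.
  Truncation at 0 makes \<open>w\<close> a weight again without harming the two-phase bound.\<close>

lemma averaged_weight:
  fixes om :: real
  assumes "torus_weight g M" and per: "lattice_periodic g"
    and L: "0 < L" and c: "0 < c" and M: "0 < M"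
    and fib: "AE x in tm. c \<le> (LINT t|seg L. g (x + t *\<^sub>R \<nu>))"
  defines "\<eta> \<equiv> c / (12 * M * L)"
  defines "m \<equiv> \<lambda>x. LINT u|seg 1. g (x + (u / om) *\<^sub>R \<nu>)"
  defines "w \<equiv> \<lambda>x. \<eta>\<^sup>2 / 2 * max 0 (m x - 6 * \<eta> * M)"
  shows "torus_weight w (\<eta>\<^sup>2 / 2 * M)" and "lattice_periodic w"
    and "AE x in tm. \<eta>\<^sup>2 / 2 * (c / 2) \<le> (LINT t|seg L. w (x + t *\<^sub>R \<nu>))"
    and "\<And>A B x. w x * ((norm A)\<^sup>2 + (norm B)\<^sup>2)
      \<le> (LINT u|seg 1. g (x + (u / om) *\<^sub>R \<nu>) * (norm (A + cis (2 * pi * u) * B))\<^sup>2)"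
proof -
  interpret torus_weight g M by fact
  have \<eta>: "0 < \<eta>" using c M L by (simp add: \<eta>_def)
  have mm[measurable]: "m \<in> borel_measurable borel"
    unfolding m_def by (intro seg.borel_measurable_lebesgue_integral) measurable
  have mb: "0 \<le> m x" "m x \<le> M" for x
  proof -
    show "0 \<le> m x" unfolding m_def by (intro integral_nonneg_AE AE_I2 g_nonneg)
    have "m x \<le> (LINT u|seg 1. M)" unfolding m_def
      by (intro integral_mono integrable_seg_bounded[of _ _ M]) (use g_nonneg g_le M in auto)
    then show "m x \<le> M" by simp
  qed
  show "torus_weight w (\<eta>\<^sup>2 / 2 * M)"
  proof
    show "w \<in> borel_measurable borel" unfolding w_def by measurable
    fix x
    show "0 \<le> w x" by (simp add: w_def)
    have "m x - 6 * \<eta> * M \<le> M"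
    proof -
      have "0 \<le> 6 * \<eta> * M" using \<eta> M by simp
      then show ?thesis using mb[of x] M by linarith
    qed
    then have "max 0 (m x - 6 * \<eta> * M) \<le> M" using M by simp
    then show "w x \<le> \<eta>\<^sup>2 / 2 * M" unfolding w_def by (intro mult_left_mono) auto
  qed
  show "lattice_periodic w"
  proof (rule lattice_periodicI)
    fix x k :: "real^2" assume k: "k \<in> int_lattice"
    have "g (x + k + (u / om) *\<^sub>R \<nu>) = g (x + (u / om) *\<^sub>R \<nu>)" for u
    proof -
      have "g (x + (u / om) *\<^sub>R \<nu> + k) = g (x + (u / om) *\<^sub>R \<nu>)"
        using per k unfolding lattice_periodic_def by blast
      then show ?thesis by (simp add: add_ac)
    qed
    then show "w (x + k) = w x" by (simp add: w_def m_def)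
  qed
  show "w x * ((norm A)\<^sup>2 + (norm B)\<^sup>2)
      \<le> (LINT u|seg 1. g (x + (u / om) *\<^sub>R \<nu>) * (norm (A + cis (2 * pi * u) * B))\<^sup>2)" (is "_ \<le> ?I") for A B x
  proof -
    have "\<eta>\<^sup>2 / 2 * (m x - 6 * \<eta> * M) * ((norm A)\<^sup>2 + (norm B)\<^sup>2) \<le> ?I"
      unfolding m_def by (rule two_phase_lower_bound) (use g_nonneg g_le \<eta> in auto)
    moreover have "0 \<le> ?I" by (intro integral_nonneg_AE AE_I2 mult_nonneg_nonneg g_nonneg) auto
    ultimately show ?thesis unfolding w_def by (auto simp: max_def)
  qed
  interpret ps: pair_sigma_finite tm "seg 1" ..
  define \<Phi> where "\<Phi> x = (LINT t|seg L. g (x + t *\<^sub>R \<nu>))" for x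
  have [measurable]: "\<Phi> \<in> borel_measurable borel"
    unfolding \<Phi>_def by (intro seg.borel_measurable_lebesgue_integral) measurable
  have perPhi: "lattice_periodic (\<lambda>x. c \<le> \<Phi> x)"
  proof (rule lattice_periodicI)
    fix x k :: "real^2" assume k: "k \<in> int_lattice"
    have "g (x + k + t *\<^sub>R \<nu>) = g (x + t *\<^sub>R \<nu>)" for t
    proof -
      have "g (x + t *\<^sub>R \<nu> + k) = g (x + t *\<^sub>R \<nu>)"
        using per k unfolding lattice_periodic_def by blast
      then show ?thesis by (simp add: add_ac)
    qed
    then show "(c \<le> \<Phi> (x + k)) = (c \<le> \<Phi> x)" by (simp add: \<Phi>_def)
  qed
  \<comment> \<open>The fibre bound holds almost everywhere for each fixed shift \<open>u\<close>;
    Fubini for null sets then gives it, for almost every \<open>x\<close>, at almost all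
    shifts.\<close>
  have "AE x in tm. AE u in seg 1. c \<le> \<Phi> (x + (u / om) *\<^sub>R \<nu>)"
  proof (subst ps.AE_commute)
    show "{z \<in> space (tm \<Otimes>\<^sub>M seg 1). c \<le> \<Phi> (fst z + (snd z / om) *\<^sub>R \<nu>)} \<in> sets (tm \<Otimes>\<^sub>M seg 1)"
      by measurable
    show "AE u in seg 1. AE x in tm. c \<le> \<Phi> (x + (u / om) *\<^sub>R \<nu>)"
    proof (rule AE_I2)
      fix u
      show "AE x in tm. c \<le> \<Phi> (x + (u / om) *\<^sub>R \<nu>)"
        by (rule AE_tm_shift[OF _ _ perPhi]) (use fib in \<open>simp_all add: \<Phi>_def[symmetric]\<close>)
    qed
  qed
  then show "AE x in tm. \<eta>\<^sup>2 / 2 * (c / 2) \<le> (LINT t|seg L. w (x + t *\<^sub>R \<nu>))"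
  proof eventually_elim
    case (elim x)
    note F = integrable_seg_seg[of "\<lambda>t u. g (x + t *\<^sub>R \<nu> + (u / om) *\<^sub>R \<nu>)" 1 M L]
    have F1: "integrable (seg L) (\<lambda>t. m (x + t *\<^sub>R \<nu>))" unfolding m_def
      by (rule F) (use g_nonneg g_le in \<open>auto simp: split_beta'\<close>)
    have F2: "integrable (seg 1) (\<lambda>u. LINT t|seg L. g (x + t *\<^sub>R \<nu> + (u / om) *\<^sub>R \<nu>))"
      by (rule F) (use g_nonneg g_le in \<open>auto simp: split_beta'\<close>)
    have F3: "(LINT u|seg 1. LINT t|seg L. g (x + t *\<^sub>R \<nu> + (u / om) *\<^sub>R \<nu>)) = (LINT t|seg L. m (x + t *\<^sub>R \<nu>))"
      unfolding m_def by (rule F) (use g_nonneg g_le in \<open>auto simp: split_beta'\<close>)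
    have eq: "(LINT t|seg L. g (x + t *\<^sub>R \<nu> + (u / om) *\<^sub>R \<nu>)) = \<Phi> (x + (u / om) *\<^sub>R \<nu>)" for u
      unfolding \<Phi>_def by (simp add: add_ac)
    have "c = (LINT u|seg 1. c)" by simp
    also have "\<dots> \<le> (LINT u|seg 1. \<Phi> (x + (u / om) *\<^sub>R \<nu>))"
      by (rule integral_mono_AE) (use elim F2 in \<open>simp_all add: eq\<close>)
    also have "\<dots> = (LINT t|seg L. m (x + t *\<^sub>R \<nu>))" using F3 by (simp add: eq)
    finally have "c / 2 \<le> (LINT t|seg L. m (x + t *\<^sub>R \<nu>)) - L * (6 * \<eta> * M)"
      using c M L by (simp add: \<eta>_def field_simps)
    also have "\<dots> = (LINT t|seg L. m (x + t *\<^sub>R \<nu>) - 6 * \<eta> * M)" using F1 L by simp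
    finally have "\<eta>\<^sup>2 / 2 * (c / 2) \<le> \<eta>\<^sup>2 / 2 * (LINT t|seg L. m (x + t *\<^sub>R \<nu>) - 6 * \<eta> * M)"
      by (intro mult_left_mono) auto
    also have "\<dots> = (LINT t|seg L. \<eta>\<^sup>2 / 2 * (m (x + t *\<^sub>R \<nu>) - 6 * \<eta> * M))" by simp
    also have "\<dots> \<le> (LINT t|seg L. w (x + t *\<^sub>R \<nu>))"
    proof (rule integral_mono)
      show "integrable (seg L) (\<lambda>t. \<eta>\<^sup>2 / 2 * (m (x + t *\<^sub>R \<nu>) - 6 * \<eta> * M))" using F1 by simp
      show "integrable (seg L) (\<lambda>t. w (x + t *\<^sub>R \<nu>))"
      proof (rule integrable_seg_bounded[of _ _ "\<eta>\<^sup>2 / 2 * M"])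
        show "(\<lambda>t. w (x + t *\<^sub>R \<nu>)) \<in> borel_measurable borel" unfolding w_def by measurable
        fix t
        show "norm (w (x + t *\<^sub>R \<nu>)) \<le> \<eta>\<^sup>2 / 2 * M"
          using torus_weight.g_nonneg[OF \<open>torus_weight w (\<eta>\<^sup>2 / 2 * M)\<close>]
            torus_weight.g_le[OF \<open>torus_weight w (\<eta>\<^sup>2 / 2 * M)\<close>] by simp
      qed
      show "\<eta>\<^sup>2 / 2 * (m (x + t *\<^sub>R \<nu>) - 6 * \<eta> * M) \<le> w (x + t *\<^sub>R \<nu>)" for t
        unfolding w_def by (intro mult_left_mono) auto
    qed
    finally show ?case .
  qed
qed

text \<open>Moving by \<open>u / om\<close> along \<nu> rotates the second strip against the first
  by \<open>cis (2 * pi * u)\<close>, up to errors due to the width of the strips. Averaging over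
  \<open>u\<close> decouples the strips, and each is then estimated with the averaged weight
  \<open>w\<close>.\<close>

lemma double_strip_bound:
  assumes L: "0 < L" and c: "0 < c" and M: "0 < M"
  shows "\<exists>\<kappa>>0. \<exists>W>0. \<forall>g \<nu> lam1 lam2 S1 S2 a. torus_weight g M \<and> lattice_periodic g
    \<and> (AE x in tm. c \<le> (LINT t|seg L. g (x + t *\<^sub>R \<nu>)))
    \<and> finite S1 \<and> S1 \<subseteq> int_lattice \<and> (\<forall>k\<in>S1. \<bar>k \<bullet> \<nu> - lam1\<bar> \<le> 1)
    \<and> finite S2 \<and> S2 \<subseteq> int_lattice \<and> (\<forall>k\<in>S2. \<bar>k \<bullet> \<nu> - lam2\<bar> \<le> 1)
    \<and> S1 \<inter> S2 = {} \<and> W \<le> \<bar>lam2 - lam1\<bar> \<longrightarrow>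
    \<kappa> * (\<Sum>k\<in>S1 \<union> S2. (norm (a k))\<^sup>2) \<le> (LINT x|tm. g x * (norm (tsum (S1 \<union> S2) a x))\<^sup>2)"
proof -
  define \<eta> where "\<eta> = c / (12 * M * L)"
  have \<eta>: "0 < \<eta>" using c M L by (simp add: \<eta>_def)
  have "0 < \<eta>\<^sup>2 / 2 * (c / 2)" "0 \<le> \<eta>\<^sup>2 / 2 * M" using \<eta> c M by auto
  from strip_bound[OF L this] obtain \<kappa> where \<kappa>: "0 < \<kappa>"
    "\<And>g \<nu> lam S a. torus_weight g (\<eta>\<^sup>2 / 2 * M) \<and> lattice_periodic g
    \<and> (AE x in tm. \<eta>\<^sup>2 / 2 * (c / 2) \<le> (LINT t|seg L. g (x + t *\<^sub>R \<nu>)))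
    \<and> finite S \<and> S \<subseteq> int_lattice \<and> (\<forall>k\<in>S. \<bar>k \<bullet> \<nu> - lam\<bar> \<le> 1) \<Longrightarrow>
    \<kappa> * (\<Sum>k\<in>S. (norm (a k))\<^sup>2) \<le> (LINT x|tm. g x * (norm (tsum S a x))\<^sup>2)" by blast
  \<comment> \<open>The value for which \<open>M * (2 * pi / W)\<^sup>2\<close> equals
    \<open>\<kappa> / 4\<close>, so that the phase error can be absorbed.\<close>
  define W where "W = 2 * pi * sqrt (4 * M / \<kappa>)"
  have W: "0 < W" using M \<kappa> by (simp add: W_def)
  show ?thesis
  proof (rule exI[of _ "\<kappa> / 4"], rule conjI, use \<kappa> in simp, rule exI[of _ W], intro conjI allI impI W, elim conjE)
    fix g \<nu> lam1 lam2 S1 S2 and a :: "real^2 \<Rightarrow> complex"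
    assume g: "torus_weight g M" and per: "lattice_periodic g"
      and fib: "AE x in tm. c \<le> (LINT t|seg L. g (x + t *\<^sub>R \<nu>))"
      and S1: "finite S1" "S1 \<subseteq> int_lattice" "\<forall>k\<in>S1. \<bar>k \<bullet> \<nu> - lam1\<bar> \<le> 1"
      and S2: "finite S2" "S2 \<subseteq> int_lattice" "\<forall>k\<in>S2. \<bar>k \<bullet> \<nu> - lam2\<bar> \<le> 1"
      and dis: "S1 \<inter> S2 = {}" and Wle: "W \<le> \<bar>lam2 - lam1\<bar>"
    interpret torus_weight g M by fact
    define om where "om = lam2 - lam1"
    have om: "W \<le> \<bar>om\<bar>" "om \<noteq> 0" using Wle W by (auto simp: om_def)
    let ?S = "S1 \<union> S2"
    have S: "finite ?S" "?S \<subseteq> int_lattice" using S1 S2 by auto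
    define N where "N = (\<Sum>k\<in>?S. (norm (a k))\<^sup>2)"
    have N0: "0 \<le> N" unfolding N_def by (intro sum_nonneg) auto
    have Nsplit: "N = (\<Sum>k\<in>S1. (norm (a k))\<^sup>2) + (\<Sum>k\<in>S2. (norm (a k))\<^sup>2)"
      unfolding N_def by (rule sum.union_disjoint) (use S1 S2 dis in auto)
    define m where "m = (\<lambda>x. LINT u|seg 1. g (x + (u / om) *\<^sub>R \<nu>))"
    define w where "w = (\<lambda>x. \<eta>\<^sup>2 / 2 * max 0 (m x - 6 * \<eta> * M))"
    have w: "torus_weight w (\<eta>\<^sup>2 / 2 * M)" "lattice_periodic w"
      "AE x in tm. \<eta>\<^sup>2 / 2 * (c / 2) \<le> (LINT t|seg L. w (x + t *\<^sub>R \<nu>))"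
      unfolding w_def m_def \<eta>_def by (rule averaged_weight[OF g per L c M fib])+
    have w4: "w x * ((norm A)\<^sup>2 + (norm B)\<^sup>2)
      \<le> (LINT u|seg 1. g (x + (u / om) *\<^sub>R \<nu>) * (norm (A + cis (2 * pi * u) * B))\<^sup>2)" for A B x
      unfolding w_def m_def \<eta>_def by (rule averaged_weight(4)[OF g per L c M fib])
    interpret w: torus_weight w "\<eta>\<^sup>2 / 2 * M" by (rule w(1))
    \<comment> \<open>\<open>q\<close> carries the exact phases with that of \<open>lam1\<close>
      removed; \<open>p\<close> freezes them to 1 on the first strip and to
      \<open>cis (2 * pi * u)\<close> on the second. On \<open>{0..1}\<close> they differ by at most
      \<open>2 * pi / \<bar>om\<bar>\<close>.\<close>
    define q where "q k u = (if k \<in> S1 then cis (2 * pi * (u / om * (k \<bullet> \<nu> - lam1)))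
      else cis (2 * pi * u) * cis (2 * pi * (u / om * (k \<bullet> \<nu> - lam2))))" for k and u :: real
    define p where "p k u = (if k \<in> S1 then 1 else cis (2 * pi * u))" for k :: "real^2" and u :: real
    define r where "r k u = p k u - q k u" for k u
    let ?H = "\<lambda>x u. tsum ?S (\<lambda>k. a k * p k u) x"
    let ?G = "\<lambda>x u. tsum ?S (\<lambda>k. a k * q k u) x"
    let ?R = "\<lambda>x u. tsum ?S (\<lambda>k. a k * r k u) x"
    let ?f = "tsum ?S a"
    let ?E = "LINT x|tm. g x * (norm (?f x))\<^sup>2"
    have [measurable]: "q k \<in> borel_measurable borel" "p k \<in> borel_measurable borel" for k
      unfolding q_def p_def cis_conv_exp by measurable
    have HGR: "?H x u = ?G x u + ?R x u" for x u
      unfolding tsum_add by (simp add: r_def algebra_simps)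
    have H: "?H x u = tsum S1 a x + cis (2 * pi * u) * tsum S2 a x" for x u
    proof -
      have "?H x u = tsum S1 (\<lambda>k. a k * p k u) x + tsum S2 (\<lambda>k. a k * p k u) x"
        by (rule tsum_union) (use S1 S2 dis in auto)
      also have "tsum S1 (\<lambda>k. a k * p k u) x = tsum S1 a x"
        unfolding tsum_def by (rule sum.cong) (auto simp: p_def)
      also have "tsum S2 (\<lambda>k. a k * p k u) x = cis (2 * pi * u) * tsum S2 a x"
        unfolding tsum_def sum_distrib_left by (rule sum.cong) (use dis in \<open>auto simp: p_def\<close>)
      finally show ?thesis .
    qed
    have nG: "norm (?G x u) = norm (?f (x + (u / om) *\<^sub>R \<nu>))" for x u
    proof -
      have "?f (x + (u / om) *\<^sub>R \<nu>) = cis (2 * pi * (u / om * lam1)) * ?G x u"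
        unfolding tsum_shift unfolding tsum_def sum_distrib_left
      proof (intro sum.cong refl)
        fix k
        have "2 * pi * (u / om * (k \<bullet> \<nu>)) = 2 * pi * (u / om * lam1) + (2 * pi * u + 2 * pi * (u / om * (k \<bullet> \<nu> - lam2)))"
        proof -
          define s where "s = u / om"
          have "u = s * (lam2 - lam1)" using om(2) by (simp add: s_def om_def)
          then have "s * (k \<bullet> \<nu>) = s * lam1 + (u + s * (k \<bullet> \<nu> - lam2))" by (simp add: algebra_simps)
          then show ?thesis unfolding s_def[symmetric] by (simp only: distrib_left)
        qed
        then have "cis (2 * pi * (u / om * (k \<bullet> \<nu>))) = cis (2 * pi * (u / om * lam1)) * q k u"
          unfolding q_def by (auto simp: cis_mult algebra_simps)
        then show "a k * cis (2 * pi * (u / om * (k \<bullet> \<nu>))) * ech k x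
            = cis (2 * pi * (u / om * lam1)) * (a k * q k u * ech k x)" by simp
      qed
      then show ?thesis by (simp add: norm_mult)
    qed
    have nr: "norm (r k u) \<le> 2 * pi / \<bar>om\<bar>" if ku: "k \<in> ?S" "u \<in> {0..1}" for k u
    proof -
      obtain lam where lam: "\<bar>k \<bullet> \<nu> - lam\<bar> \<le> 1" "norm (r k u) = norm (cis (2 * pi * (u / om * (k \<bullet> \<nu> - lam))) - 1)"
      proof (cases "k \<in> S1")
        case True
        then show ?thesis using S1 by (intro that[of lam1]) (auto simp: r_def p_def q_def norm_minus_commute)
      next
        case False
        have "r k u = cis (2 * pi * u) * (1 - cis (2 * pi * (u / om * (k \<bullet> \<nu> - lam2))))"
          using False by (simp add: r_def p_def q_def algebra_simps)
        then have "norm (r k u) = norm (cis (2 * pi * (u / om * (k \<bullet> \<nu> - lam2))) - 1)"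
          by (simp add: norm_mult norm_minus_commute)
        then show ?thesis using S2 ku False by (intro that[of lam2]) auto
      qed
      have "\<bar>u\<bar> * \<bar>k \<bullet> \<nu> - lam\<bar> \<le> 1 * 1" using lam ku by (intro mult_mono) auto
      then have "\<bar>2 * pi * (u / om * (k \<bullet> \<nu> - lam))\<bar> \<le> 2 * pi / \<bar>om\<bar>"
        using om by (simp add: abs_mult divide_right_mono)
      then show ?thesis unfolding lam(2) by (rule order_trans[OF norm_cis_minus_1_le])
    qed
    have RN: "(LINT x|tm. (norm (?R x u))\<^sup>2) \<le> (2 * pi / \<bar>om\<bar>)\<^sup>2 * N" if "u \<in> {0..1}" for u
    proof -
      have "(LINT x|tm. (norm (?R x u))\<^sup>2) = (\<Sum>k\<in>?S. (norm (a k))\<^sup>2 * (norm (r k u))\<^sup>2)"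
        by (subst parseval[OF S]) (simp add: norm_mult power_mult_distrib)
      also have "\<dots> \<le> (\<Sum>k\<in>?S. (norm (a k))\<^sup>2 * (2 * pi / \<bar>om\<bar>)\<^sup>2)"
        by (intro sum_mono mult_left_mono power_mono nr that) auto
      finally show ?thesis unfolding N_def sum_distrib_right[symmetric] by (simp only: mult.commute)
    qed
    have small: "M * ((2 * pi / \<bar>om\<bar>)\<^sup>2 * N) \<le> \<kappa> / 4 * N"
    proof -
      have "W\<^sup>2 \<le> om\<^sup>2" using om(1) W by (metis abs_le_square_iff abs_of_pos)
      then have "(2 * pi)\<^sup>2 * (4 * M / \<kappa>) \<le> om\<^sup>2" using M \<kappa> by (simp add: W_def power_mult_distrib)
      then have "M * (2 * pi)\<^sup>2 \<le> \<kappa> / 4 * om\<^sup>2" using \<kappa> by (simp add: field_simps)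
      then have "M * (2 * pi / \<bar>om\<bar>)\<^sup>2 \<le> \<kappa> / 4"
        using om(2) by (simp add: power_divide divide_le_eq)
      from mult_right_mono[OF this N0] show ?thesis by (simp only: mult.assoc)
    qed
    have upper: "(LINT x|tm. g (x + (u / om) *\<^sub>R \<nu>) * (norm (?H x u))\<^sup>2) \<le> 2 * ?E + 2 * (\<kappa> / 4 * N)"
      if u: "u \<in> {0..1}" for u
    proof -
      let ?g = "\<lambda>x. g (x + (u / om) *\<^sub>R \<nu>)"
      have ig: "integrable tm (\<lambda>x. ?g x * (norm (tsum ?S v x))\<^sup>2)" for v
        by (rule Bochner_Integration.integrable_bound[OF integrable_mult_right[OF integrable_tsum_sq[of ?S v], of M]])
           (auto intro!: AE_I2 mult_right_mono simp: abs_mult g_nonneg g_le M_nonneg)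
      have "(LINT x|tm. ?g x * (norm (?H x u))\<^sup>2)
          \<le> (LINT x|tm. 2 * (?g x * (norm (?G x u))\<^sup>2) + 2 * (M * (norm (?R x u))\<^sup>2))"
      proof (rule integral_mono)
        fix x
        have "(norm (?H x u))\<^sup>2 \<le> 2 * (norm (?G x u))\<^sup>2 + 2 * (norm (?R x u))\<^sup>2"
          unfolding HGR by (rule norm_add_sq_le)
        then have "?g x * (norm (?H x u))\<^sup>2
            \<le> ?g x * (2 * (norm (?G x u))\<^sup>2 + 2 * (norm (?R x u))\<^sup>2)"
          by (intro mult_left_mono g_nonneg)
        also have "\<dots> \<le> 2 * (?g x * (norm (?G x u))\<^sup>2) + 2 * (M * (norm (?R x u))\<^sup>2)"
          using mult_right_mono[OF g_le[of "x + (u / om) *\<^sub>R \<nu>"], of "(norm (?R x u))\<^sup>2"] by (simp add: algebra_simps)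
        finally show "?g x * (norm (?H x u))\<^sup>2 \<le> 2 * (?g x * (norm (?G x u))\<^sup>2) + 2 * (M * (norm (?R x u))\<^sup>2)" .
      qed (intro Bochner_Integration.integrable_add integrable_mult_right ig integrable_tsum_sq)+
      also have "\<dots> = 2 * (LINT x|tm. ?g x * (norm (?G x u))\<^sup>2) + 2 * (M * (LINT x|tm. (norm (?R x u))\<^sup>2))"
        using ig[of "\<lambda>k. a k * q k u"] integrable_tsum_sq[of ?S "\<lambda>k. a k * r k u"] by simp
      also have "(LINT x|tm. ?g x * (norm (?G x u))\<^sup>2) = ?E"
        unfolding nG
        by (rule integral_tm_shift[of "\<lambda>x. g x * (norm (?f x))\<^sup>2"])
           (use per lattice_periodic_tsum[OF S(2), of a] in \<open>auto simp: lattice_periodic_def\<close>)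
      finally show ?thesis using mult_left_mono[OF RN[OF u] M_nonneg] small by linarith
    qed
    define A where "A = (\<Sum>k\<in>?S. norm (a k))"
    have bH: "(norm (?H x u))\<^sup>2 \<le> A\<^sup>2" for x u
      unfolding A_def by (intro power_mono order_trans[OF norm_tsum_le] sum_mono) (auto simp: norm_mult p_def)
    have gH: "norm (g (x + (u / om) *\<^sub>R \<nu>) * (norm (?H x u))\<^sup>2) \<le> M * A\<^sup>2" for x u
      using bH[where x=x and u=u] g_nonneg[of "x + (u / om) *\<^sub>R \<nu>"] g_le[of "x + (u / om) *\<^sub>R \<nu>"] M_nonneg
      by (simp add: norm_mult mult_mono)
    have [measurable]: "(\<lambda>z. ?H (fst z) (snd z)) \<in> borel_measurable (borel \<Otimes>\<^sub>M borel)"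
      unfolding tsum_def by measurable
    note F = integrable_tm_seg[of "\<lambda>x u. g (x + (u / om) *\<^sub>R \<nu>) * (norm (?H x u))\<^sup>2" 1 "M * A\<^sup>2"]
    have F: "integrable (seg 1) (\<lambda>u. LINT x|tm. g (x + (u / om) *\<^sub>R \<nu>) * (norm (?H x u))\<^sup>2)"
      "integrable tm (\<lambda>x. LINT u|seg 1. g (x + (u / om) *\<^sub>R \<nu>) * (norm (?H x u))\<^sup>2)"
      "(LINT u|seg 1. LINT x|tm. g (x + (u / om) *\<^sub>R \<nu>) * (norm (?H x u))\<^sup>2)
        = (LINT x|tm. LINT u|seg 1. g (x + (u / om) *\<^sub>R \<nu>) * (norm (?H x u))\<^sup>2)"
      by (rule F; use gH in \<open>simp add: split_beta'\<close>)+
    have "\<kappa> * N \<le> w.energy S1 a + w.energy S2 a"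
      unfolding Nsplit distrib_left w.energy_def
      by (intro add_mono \<kappa>(2)) (use w S1 S2 in blast)+
    also have "\<dots> = (LINT x|tm. w x * ((norm (tsum S1 a x))\<^sup>2 + (norm (tsum S2 a x))\<^sup>2))"
      unfolding w.energy_def distrib_left
      by (rule Bochner_Integration.integral_add[symmetric]) (rule w.integrable_energy)+
    also have "\<dots> \<le> (LINT x|tm. LINT u|seg 1. g (x + (u / om) *\<^sub>R \<nu>) * (norm (?H x u))\<^sup>2)"
    proof (rule integral_mono)
      show "integrable tm (\<lambda>x. w x * ((norm (tsum S1 a x))\<^sup>2 + (norm (tsum S2 a x))\<^sup>2))"
        unfolding distrib_left by (intro Bochner_Integration.integrable_add w.integrable_energy)
    qed (use F(2) in \<open>auto simp: H intro: w4\<close>)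
    also have "\<dots> = (LINT u|seg 1. LINT x|tm. g (x + (u / om) *\<^sub>R \<nu>) * (norm (?H x u))\<^sup>2)"
      by (rule F(3)[symmetric])
    also have "\<dots> \<le> (LINT u|seg 1. 2 * ?E + 2 * (\<kappa> / 4 * N))"
    proof (rule integral_mono_AE)
      show "AE u in seg 1. (LINT x|tm. g (x + (u / om) *\<^sub>R \<nu>) * (norm (?H x u))\<^sup>2) \<le> 2 * ?E + 2 * (\<kappa> / 4 * N)"
        using AE_seg by eventually_elim (rule upper)
    qed (use F(1) in simp_all)
    also have "\<dots> = 2 * ?E + 2 * (\<kappa> / 4 * N)" by simp
    finally have "\<kappa> * N \<le> 2 * ?E + 2 * (\<kappa> / 4 * N)" .
    moreover have "\<kappa> / 4 * N = \<kappa> * N / 4" by simp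
    ultimately show "\<kappa> / 4 * (\<Sum>k\<in>?S. (norm (a k))\<^sup>2) \<le> ?E"
      unfolding N_def[symmetric] by linarith
  qed
qed

section \<open>Interaction of transversal sides\<close>

definition independent_dirs :: "real^2 \<Rightarrow> real^2 \<Rightarrow> bool" where
  "independent_dirs \<mu> \<mu>' \<longleftrightarrow> (\<forall>w. w \<bullet> \<mu> = 0 \<longrightarrow> w \<bullet> \<mu>' = 0 \<longrightarrow> w = 0)"

lemma independent_dirs_bound:
  assumes "independent_dirs \<mu> \<mu>'"
  obtains D where "0 < D" "\<And>w. norm w \<le> D * (\<bar>w \<bullet> \<mu>\<bar> + \<bar>w \<bullet> \<mu>'\<bar>)"
proof -
  define f :: "real^2 \<Rightarrow> real \<times> real" where "f w = (w \<bullet> \<mu>, w \<bullet> \<mu>')" for w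
  have lin: "linear f"
    by (rule linearI) (auto simp: f_def inner_add_left)
  have "inj f" unfolding linear_injective_0[OF lin]
    using assms by (auto simp: independent_dirs_def f_def zero_prod_def)
  then obtain B where B: "0 < B" "\<And>x. B * norm x \<le> norm (f x)"
    using linear_inj_bounded_below_pos[OF lin] by blast
  show ?thesis
  proof (rule that[of "1 / B"])
    fix w
    have "B * norm w \<le> norm (f w)" by (rule B)
    also have "\<dots> \<le> \<bar>w \<bullet> \<mu>\<bar> + \<bar>w \<bullet> \<mu>'\<bar>" by (simp add: f_def norm_Pair sqrt_sum_squares_le_sum_abs)
    finally show "norm w \<le> 1 / B * (\<bar>w \<bullet> \<mu>\<bar> + \<bar>w \<bullet> \<mu>'\<bar>)" using B(1) by (simp add: field_simps)
  qed (use B in simp)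
qed

lemma inner_neg_combination: "- (\<mu> + s *\<^sub>R \<mu>') \<bullet> w = - (w \<bullet> \<mu>) - s * (w \<bullet> \<mu>')"
  unfolding inner_minus_left inner_add_left inner_scaleR_left by (simp add: inner_commute)

text \<open>Each nonzero lattice vector rules out at most one \<open>s\<close>, so only countably
  many values are excluded. A positive \<open>s\<close> keeps the direction inside the cone spanned
  by \<open>- \<mu>\<close> and \<open>- \<mu>'\<close>, which later makes sublevel sets
  bounded.\<close>

lemma nonresonant_combination:
  assumes "independent_dirs \<mu> \<mu>'"
  obtains s where "0 < s" "nonresonant (- (\<mu> + s *\<^sub>R \<mu>'))"
proof -
  let ?Z = "\<lambda>k. {s. k \<bullet> \<mu> + s * (k \<bullet> \<mu>') = 0}"
  have "countable (\<Union>k\<in>int_lattice - {0}. ?Z k)"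
  proof (rule countable_UN)
    fix k assume k: "k \<in> int_lattice - {0}"
    show "countable (?Z k)"
    proof (cases "k \<bullet> \<mu>' = 0")
      case True
      then have "?Z k = {}" using assms k by (auto simp: independent_dirs_def)
      then show ?thesis by simp
    next
      case False
      then have "?Z k \<subseteq> {- (k \<bullet> \<mu>) / (k \<bullet> \<mu>')}" by (auto simp: field_simps)
      then show ?thesis by (rule countable_subset) simp
    qed
  qed (simp add: countable_int_lattice)
  moreover have "uncountable {0<..<1::real}" by (simp add: uncountable_open_interval)
  ultimately have "\<not> {0<..<1} \<subseteq> (\<Union>k\<in>int_lattice - {0}. ?Z k)"
    using countable_subset by blast
  then obtain s where s: "s \<in> {0<..<1}" "s \<notin> (\<Union>k\<in>int_lattice - {0}. ?Z k)" by blast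
  show ?thesis
  proof (rule that[of s])
    show "0 < s" using s by simp
    show "nonresonant (- (\<mu> + s *\<^sub>R \<mu>'))"
      unfolding nonresonant_def
    proof (intro ballI impI)
      fix k assume k: "k \<in> int_lattice" "- (\<mu> + s *\<^sub>R \<mu>') \<bullet> k = 0"
      then have "s \<in> ?Z k" unfolding inner_neg_combination by simp
      then show "k = 0" using s(2) k by blast
    qed
  qed
qed

lemma card_le_of_differences:
  assumes "A \<subseteq> int_lattice" "\<And>x y. x \<in> A \<Longrightarrow> y \<in> A \<Longrightarrow> norm (x - y) \<le> r"
  shows "finite A \<and> card A \<le> card (int_lattice \<inter> cball 0 r)"
proof (cases "A = {}")
  case False
  then obtain x where x: "x \<in> A" by blast
  have fin: "finite (int_lattice \<inter> cball 0 r)" by (rule finite_int_lattice_bounded) auto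
  have sub: "(\<lambda>y. y - x) ` A \<subseteq> int_lattice \<inter> cball 0 r" using assms x by auto
  have inj: "inj_on (\<lambda>y. y - x) A" by (auto simp: inj_on_def)
  show ?thesis
    using card_mono[OF fin sub] finite_subset[OF sub fin] card_image[OF inj] finite_image_iff[OF inj] by simp
qed simp

section \<open>Fourier coefficients of the weight and interaction terms\<close>

context torus_weight
begin

text \<open>With this sign \<open>ghat k\<close> is the Fourier coefficient of \<open>g\<close> at
  \<open>- k\<close>; the interaction of the frequencies \<open>k\<close> and \<open>l\<close> then
  carries the factor \<open>ghat (k - l)\<close>.\<close>

definition ghat :: "real^2 \<Rightarrow> complex" where
  "ghat k = (LINT x|tm. complex_of_real (g x) * ech k x)"

definition cross :: "(real^2) set \<Rightarrow> (real^2) set \<Rightarrow> (real^2 \<Rightarrow> complex) \<Rightarrow> complex" where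
  "cross S T a = (LINT x|tm. complex_of_real (g x) * (tsum S a x * cnj (tsum T a x)))"

text \<open>\<open>S\<close> and \<open>T\<close> are frequencies near two side lines and
  \<open>U\<close> is the whole spectrum, which the one-sided conditions confine to a translated
  cone with its apex near the intersection of the lines. The bound is in terms of \<open>U\<close>
  because only the energy of the whole function is available.\<close>

definition cross_control :: "real \<Rightarrow> real \<Rightarrow> real^2 \<Rightarrow> real^2 \<Rightarrow> bool" where
  "cross_control \<epsilon> C \<mu> \<mu>' \<longleftrightarrow> (\<forall>U S T a b b'. finite U \<and> U \<subseteq> int_lattice \<and> S \<subseteq> U \<and> T \<subseteq> U
      \<and> (\<forall>k\<in>U. k \<bullet> \<mu> \<le> b + 1) \<and> (\<forall>k\<in>U. k \<bullet> \<mu>' \<le> b' + 1)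
      \<and> (\<forall>k\<in>S. \<bar>k \<bullet> \<mu> - b\<bar> \<le> 1) \<and> (\<forall>k\<in>T. \<bar>k \<bullet> \<mu>' - b'\<bar> \<le> 1) \<longrightarrow>
    norm (cross S T a) \<le> \<epsilon> * (\<Sum>k\<in>U. (norm (a k))\<^sup>2) + C * energy U a)"

lemma cross_control_mono:
  assumes "cross_control \<epsilon> C \<mu> \<mu>'" "C \<le> D"
  shows "cross_control \<epsilon> D \<mu> \<mu>'"
  unfolding cross_control_def
proof (intro allI impI)
  fix U S T a b b'
  assume "finite U \<and> U \<subseteq> int_lattice \<and> S \<subseteq> U \<and> T \<subseteq> U
      \<and> (\<forall>k\<in>U. k \<bullet> \<mu> \<le> b + 1) \<and> (\<forall>k\<in>U. k \<bullet> \<mu>' \<le> b' + 1)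
      \<and> (\<forall>k\<in>S. \<bar>k \<bullet> \<mu> - b\<bar> \<le> 1) \<and> (\<forall>k\<in>T. \<bar>k \<bullet> \<mu>' - b'\<bar> \<le> 1)"
  from assms(1)[unfolded cross_control_def, rule_format, OF this]
  show "norm (cross S T a) \<le> \<epsilon> * (\<Sum>k\<in>U. (norm (a k))\<^sup>2) + D * energy U a" for a
    using mult_right_mono[OF assms(2) energy_nonneg[of U a]] by (meson add_left_mono order_trans)
qed

lemma norm_g: "norm (complex_of_real (g x)) \<le> M"
  using g_nonneg[of x] g_le[of x] by simp

lemma cross_eq:
  assumes "finite S" "finite T"
  shows "cross S T a = (\<Sum>(k, l)\<in>S \<times> T. a k * cnj (a l) * ghat (k - l))"
  unfolding cross_def ghat_def
  by (subst integral_tsum_cnj[OF _ norm_g assms]) (simp_all add: sum.cartesian_product)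

lemma norm_ghat_le: "norm (ghat k) \<le> M"
proof -
  have "norm (ghat k) \<le> (LINT x|tm. norm (complex_of_real (g x) * ech k x))"
    unfolding ghat_def by simp
  also have "\<dots> \<le> (LINT x|tm. M)"
  proof (rule integral_mono)
    show "integrable tm (\<lambda>x. norm (complex_of_real (g x) * ech k x))"
      by (intro integrable_norm integrable_tm_bounded[of _ M]) (use norm_g in \<open>auto simp: norm_mult\<close>)
  qed (use norm_g in \<open>auto simp: norm_mult\<close>)
  finally show ?thesis using tm.prob_space by simp
qed

lemma bessel:
  assumes "finite F" "F \<subseteq> int_lattice"
  shows "(\<Sum>k\<in>F. (norm (ghat k))\<^sup>2) \<le> M\<^sup>2"
proof -
  define b where "b k = cnj (ghat k)" for k
  have gh: "(LINT x|tm. complex_of_real (g x) * ech (- k) x) = b k" for k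
  proof -
    have "b k = (LINT x|tm. cnj (complex_of_real (g x) * ech k x))"
      unfolding b_def ghat_def by (rule Bochner_Integration.integral_cnj[symmetric])
    then show ?thesis by (simp add: cnj_ech)
  qed
  let ?P = "tsum F b"
  have i0: "integrable tm (\<lambda>x. (g x)\<^sup>2)"
    by (rule integrable_tm_bounded[of _ "M\<^sup>2"]) (auto intro: power_mono g_nonneg g_le)
  have i1: "integrable tm (\<lambda>x. complex_of_real (g x) * cnj (?P x))"
    using integrable_tsum_cnj[of "\<lambda>x. complex_of_real (g x)" M "{0}" "\<lambda>_. 1" F b] norm_g by (simp add: tsum_def)
  have "(LINT x|tm. complex_of_real (g x) * cnj (?P x)) = (\<Sum>k\<in>F. cnj (b k) * b k)"
    using integral_tsum_cnj[of "\<lambda>x. complex_of_real (g x)" M "{0}" F "\<lambda>_. 1" b] norm_g assms(1)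
    by (simp add: tsum_def gh)
  also have "\<dots> = complex_of_real (\<Sum>k\<in>F. (norm (b k))\<^sup>2)"
    by (simp add: mult.commute flip: complex_norm_square)
  finally have "Re (LINT x|tm. complex_of_real (g x) * cnj (?P x)) = (\<Sum>k\<in>F. (norm (b k))\<^sup>2)"
    by (simp only: Re_complex_of_real)
  then have r: "(LINT x|tm. g x * Re (?P x)) = (\<Sum>k\<in>F. (norm (b k))\<^sup>2)"
    using integral_Re[OF i1] by simp
  have i2: "integrable tm (\<lambda>x. g x * Re (?P x))" using integrable_Re[OF i1] by simp
  have "0 \<le> (LINT x|tm. (norm (complex_of_real (g x) - ?P x))\<^sup>2)" by simp
  also have "\<dots> = (LINT x|tm. (g x)\<^sup>2 - 2 * (g x * Re (?P x)) + (norm (?P x))\<^sup>2)"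
    unfolding cmod_power2 by (intro Bochner_Integration.integral_cong refl) (simp add: power2_diff algebra_simps)
  also have "\<dots> = (LINT x|tm. (g x)\<^sup>2) - 2 * (\<Sum>k\<in>F. (norm (b k))\<^sup>2) + (\<Sum>k\<in>F. (norm (b k))\<^sup>2)"
    using i0 i2 integrable_tsum_sq[of F b] by (simp add: r parseval[OF assms])
  finally have "(\<Sum>k\<in>F. (norm (b k))\<^sup>2) \<le> (LINT x|tm. (g x)\<^sup>2)" by simp
  also have "\<dots> \<le> (LINT x|tm. M\<^sup>2)"
    by (intro integral_mono i0 power_mono g_le g_nonneg) simp
  finally show ?thesis using tm.prob_space by (simp add: b_def)
qed

text \<open>A finite set whose partial sum comes within \<epsilon> of the supremum leaves at most
  \<epsilon> for any set disjoint from it.\<close>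

lemma bessel_tail:
  assumes "0 < \<epsilon>"
  obtains J where "finite J" "J \<subseteq> int_lattice"
    "\<And>F. finite F \<Longrightarrow> F \<subseteq> int_lattice - J \<Longrightarrow> (\<Sum>k\<in>F. (norm (ghat k))\<^sup>2) \<le> \<epsilon>"
proof -
  let ?s = "\<lambda>F. \<Sum>k\<in>F. (norm (ghat k))\<^sup>2"
  let ?A = "{F. finite F \<and> F \<subseteq> int_lattice}"
  have bdd: "bdd_above (?s ` ?A)" by (rule bdd_aboveI[of _ "M\<^sup>2"]) (use bessel in auto)
  have ne: "?s ` ?A \<noteq> {}" by blast
  obtain J where J: "J \<in> ?A" "Sup (?s ` ?A) - \<epsilon> < ?s J"
    using less_cSupD[OF ne, of "Sup (?s ` ?A) - \<epsilon>"] assms by auto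
  show ?thesis
  proof (rule that)
    fix F assume F: "finite F" "F \<subseteq> int_lattice - J"
    have "?s (J \<union> F) \<le> Sup (?s ` ?A)" using J F by (intro cSup_upper bdd) auto
    moreover have "?s (J \<union> F) = ?s J + ?s F" using J F by (intro sum.union_disjoint) auto
    ultimately show "?s F \<le> \<epsilon>" using J(2) by linarith
  qed (use J in auto)
qed

end

section \<open>Interaction of two transversal sides\<close>

context positive_torus_weight
begin

text \<open>In the cone \<open>X\<close> both \<open>w \<bullet> \<mu>\<close> and
  \<open>w \<bullet> \<mu>'\<close> are bounded above, and a bound on \<open>om \<bullet> w\<close>
  bounds a positive combination of them from below. So the sublevel set is bounded, hence finite, as
  the corner estimate requires.\<close>

lemma near_bound:
  assumes ind: "independent_dirs \<mu> \<mu>'" and \<epsilon>: "0 < \<epsilon>"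
  shows "\<exists>C\<ge>0. \<forall>U a l. finite U \<and> U \<subseteq> int_lattice \<and> l \<in> int_lattice
      \<and> (\<forall>k\<in>U. (k - l) \<bullet> \<mu> \<le> B \<and> (k - l) \<bullet> \<mu>' \<le> B) \<longrightarrow>
    (\<Sum>k | k \<in> U \<and> norm (k - l) \<le> r. (norm (a k))\<^sup>2) \<le> \<epsilon> * (\<Sum>k\<in>U. (norm (a k))\<^sup>2) + C * energy U a"
proof -
  obtain D where D: "0 < D" "\<And>w. norm w \<le> D * (\<bar>w \<bullet> \<mu>\<bar> + \<bar>w \<bullet> \<mu>'\<bar>)"
    using independent_dirs_bound[OF ind] by blast
  obtain s where s: "0 < s" "nonresonant (- (\<mu> + s *\<^sub>R \<mu>'))"
    using nonresonant_combination[OF ind] by blast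
  define om where "om = - (\<mu> + s *\<^sub>R \<mu>')"
  \<comment> \<open>By Cauchy-Schwarz the ball of radius \<open>r\<close> lies in the sublevel set
    of this height.\<close>
  define T where "T = norm om * r"
  define X where "X = {w \<in> int_lattice. w \<bullet> \<mu> \<le> B \<and> w \<bullet> \<mu>' \<le> B}"
  have "bounded {w \<in> X. om \<bullet> w \<le> T}"
    unfolding bounded_iff
  proof (intro exI ballI)
    fix w assume "w \<in> {w \<in> X. om \<bullet> w \<le> T}"
    then have w: "w \<bullet> \<mu> \<le> B" "w \<bullet> \<mu>' \<le> B" "- (w \<bullet> \<mu>) - s * (w \<bullet> \<mu>') \<le> T"
      unfolding X_def om_def inner_neg_combination by auto
    have sB: "s * (w \<bullet> \<mu>') \<le> s * B" using w(2) s(1) by simp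
    have 1: "\<bar>w \<bullet> \<mu>\<bar> \<le> \<bar>B\<bar> + \<bar>T\<bar> + \<bar>s * B\<bar>" using w sB by linarith
    have "s * \<bar>w \<bullet> \<mu>'\<bar> = \<bar>s * (w \<bullet> \<mu>')\<bar>" using s(1) by (simp add: abs_mult)
    also have "\<dots> \<le> \<bar>B\<bar> + \<bar>T\<bar> + \<bar>s * B\<bar>" using w sB by linarith
    finally have "\<bar>w \<bullet> \<mu>'\<bar> \<le> (\<bar>B\<bar> + \<bar>T\<bar> + \<bar>s * B\<bar>) / s" using s(1) by (simp add: field_simps)
    then have "D * (\<bar>w \<bullet> \<mu>\<bar> + \<bar>w \<bullet> \<mu>'\<bar>) \<le> D * ((\<bar>B\<bar> + \<bar>T\<bar> + \<bar>s * B\<bar>) + (\<bar>B\<bar> + \<bar>T\<bar> + \<bar>s * B\<bar>) / s)"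
      using 1 D(1) by (intro mult_left_mono add_mono) auto
    then show "norm w \<le> D * ((\<bar>B\<bar> + \<bar>T\<bar> + \<bar>s * B\<bar>) + (\<bar>B\<bar> + \<bar>T\<bar> + \<bar>s * B\<bar>) / s)"
      using D(2)[of w] by linarith
  qed
  then have fin: "finite {w \<in> X. om \<bullet> w \<le> T}"
    by (intro finite_int_lattice_bounded) (auto simp: X_def)
  have X: "X \<subseteq> int_lattice" by (auto simp: X_def)
  obtain C where C: "0 \<le> C" "\<And>S a l. finite S \<and> S \<subseteq> int_lattice \<and> l \<in> int_lattice \<and> (\<forall>k\<in>S. k - l \<in> X) \<Longrightarrow>
    (\<Sum>k | k \<in> S \<and> om \<bullet> (k - l) \<le> T. (norm (a k))\<^sup>2)
      \<le> \<epsilon> * (\<Sum>k\<in>S. (norm (a k))\<^sup>2) + C * energy S a"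
    using corner_bound[OF s(2)[folded om_def] X fin \<epsilon>] by blast
  show ?thesis
  proof (intro exI[of _ C] conjI allI impI C(1))
    fix U and a :: "real^2 \<Rightarrow> complex" and l
    assume U: "finite U \<and> U \<subseteq> int_lattice \<and> l \<in> int_lattice
      \<and> (\<forall>k\<in>U. (k - l) \<bullet> \<mu> \<le> B \<and> (k - l) \<bullet> \<mu>' \<le> B)"
    have "(\<Sum>k | k \<in> U \<and> norm (k - l) \<le> r. (norm (a k))\<^sup>2) \<le> (\<Sum>k | k \<in> U \<and> om \<bullet> (k - l) \<le> T. (norm (a k))\<^sup>2)"
    proof (rule sum_mono2)
      show "{k \<in> U. norm (k - l) \<le> r} \<subseteq> {k \<in> U. om \<bullet> (k - l) \<le> T}"
      proof safe
        fix k assume "norm (k - l) \<le> r"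
        then show "om \<bullet> (k - l) \<le> T" unfolding T_def
          by (intro order_trans[OF norm_cauchy_schwarz] mult_left_mono) auto
      qed
    qed (use U in auto)
    also have "\<dots> \<le> \<epsilon> * (\<Sum>k\<in>U. (norm (a k))\<^sup>2) + C * energy U a"
      by (rule C(2)) (use U in \<open>auto simp: X_def\<close>)
    finally show "(\<Sum>k | k \<in> U \<and> norm (k - l) \<le> r. (norm (a k))\<^sup>2)
      \<le> \<epsilon> * (\<Sum>k\<in>U. (norm (a k))\<^sup>2) + C * energy U a" .
  qed
qed

text \<open>All of \<open>X\<close> is an initial segment of itself, so the error with
  \<open>\<epsilon> = 1 / 2\<close> can be absorbed. Any irrational direction will do; here one is
  built from the coordinate axes.\<close>

lemma finite_spectrum_bound:
  assumes "finite X" "X \<subseteq> int_lattice"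
  shows "\<exists>C\<ge>0. \<forall>S a. finite S \<and> S \<subseteq> X \<longrightarrow> (\<Sum>k\<in>S. (norm (a k))\<^sup>2) \<le> C * energy S a"
proof -
  have "independent_dirs (axis 1 1) (axis 2 1)"
    by (auto simp: independent_dirs_def inner_axis vec_eq_iff forall_2)
  then obtain om where om: "nonresonant om" using nonresonant_combination by metis
  have "\<forall>\<epsilon>>0. \<exists>C\<ge>0. \<forall>S a. finite S \<and> S \<subseteq> X \<longrightarrow>
    (\<Sum>k\<in>S \<inter> X. (norm (a k))\<^sup>2) \<le> \<epsilon> * (\<Sum>k\<in>S. (norm (a k))\<^sup>2) + C * energy S a"
    by (rule lower_set_bound[OF om assms(2,1)]) auto
  moreover have "(0::real) < 1 / 2" by simp
  ultimately obtain C where C: "0 \<le> C" "\<And>S a. finite S \<and> S \<subseteq> X \<Longrightarrow>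
    (\<Sum>k\<in>S \<inter> X. (norm (a k))\<^sup>2) \<le> 1 / 2 * (\<Sum>k\<in>S. (norm (a k))\<^sup>2) + C * energy S a" by blast
  show ?thesis
  proof (intro exI[of _ "2 * C"] conjI allI impI)
    fix S and a :: "real^2 \<Rightarrow> complex" assume S: "finite S \<and> S \<subseteq> X"
    then have "S \<inter> X = S" by auto
    then show "(\<Sum>k\<in>S. (norm (a k))\<^sup>2) \<le> 2 * C * energy S a" using C(2)[OF S, of a] by simp
  qed (use C in simp)
qed

text \<open>Cauchy-Schwarz over pairs: the coefficients give at most \<open>N * N\<close>, the
  weight gives a Bessel tail. Pairs with a common difference are boundedly many:
  \<open>k - l = k' - l'\<close> makes \<open>k - k'\<close> equal to \<open>l - l'\<close>, which
  the first strip bounds along \<mu> and the second along \<mu>'.\<close>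

lemma cross_far_bound:
  assumes ind: "independent_dirs \<mu> \<mu>'" and \<epsilon>: "0 < \<epsilon>"
  obtains J where "finite J" "J \<subseteq> int_lattice"
    "\<And>S T b b' (a :: real^2 \<Rightarrow> complex) N. \<lbrakk>finite S; S \<subseteq> int_lattice; finite T; T \<subseteq> int_lattice;
      \<forall>k\<in>S. \<bar>k \<bullet> \<mu> - b\<bar> \<le> 1; \<forall>k\<in>T. \<bar>k \<bullet> \<mu>' - b'\<bar> \<le> 1;
      (\<Sum>k\<in>S. (norm (a k))\<^sup>2) \<le> N; (\<Sum>k\<in>T. (norm (a k))\<^sup>2) \<le> N\<rbrakk> \<Longrightarrow>
      (\<Sum>(k, l) | k \<in> S \<and> l \<in> T \<and> k - l \<notin> J. norm (a k) * norm (a l) * norm (ghat (k - l))) \<le> \<epsilon> * N"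
proof -
  obtain D where D: "0 < D" "\<And>w. norm w \<le> D * (\<bar>w \<bullet> \<mu>\<bar> + \<bar>w \<bullet> \<mu>'\<bar>)"
    using independent_dirs_bound[OF ind] by blast
  \<comment> \<open>An upper bound for the number of pairs with a given difference; the tail level
    \<open>\<epsilon>\<^sup>2 / Q\<close> below compensates for it.\<close>
  define Q where "Q = real (card (int_lattice \<inter> cball 0 (D * 4))) + 1"
  have Q: "0 < Q" by (simp add: Q_def)
  obtain J where J: "finite J" "J \<subseteq> int_lattice"
    "\<And>F. finite F \<Longrightarrow> F \<subseteq> int_lattice - J \<Longrightarrow> (\<Sum>k\<in>F. (norm (ghat k))\<^sup>2) \<le> \<epsilon>\<^sup>2 / Q"
    using bessel_tail[of "\<epsilon>\<^sup>2 / Q"] \<epsilon> Q by (metis divide_pos_pos zero_less_power)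
  show ?thesis
  proof (rule that[OF J(1,2)])
    fix S T b b' and a :: "real^2 \<Rightarrow> complex" and N
    assume S: "finite S" "S \<subseteq> int_lattice" "\<forall>k\<in>S. \<bar>k \<bullet> \<mu> - b\<bar> \<le> 1"
      and T: "finite T" "T \<subseteq> int_lattice" "\<forall>k\<in>T. \<bar>k \<bullet> \<mu>' - b'\<bar> \<le> 1"
      and N: "(\<Sum>k\<in>S. (norm (a k))\<^sup>2) \<le> N" "(\<Sum>k\<in>T. (norm (a k))\<^sup>2) \<le> N"
    define Z where "Z = {(k, l). k \<in> S \<and> l \<in> T \<and> k - l \<notin> J}"
    have Zs: "Z \<subseteq> S \<times> T" by (auto simp: Z_def)
    have finZ: "finite Z" by (rule finite_subset[OF Zs]) (use S T in simp)
    have N0: "0 \<le> N" using N(1) sum_nonneg[of S "\<lambda>k. (norm (a k))\<^sup>2"] by simp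
    let ?d = "\<lambda>z. fst z - snd z :: real^2"
    have ghat_sum: "(\<Sum>z\<in>Z. (norm (ghat (?d z)))\<^sup>2) \<le> \<epsilon>\<^sup>2"
    proof -
      have "(\<Sum>z\<in>Z. (norm (ghat (?d z)))\<^sup>2) = (\<Sum>k\<in>?d ` Z. \<Sum>z\<in>{z \<in> Z. ?d z = k}. (norm (ghat (?d z)))\<^sup>2)"
        by (rule sum.image_gen[OF finZ])
      also have "\<dots> \<le> (\<Sum>k\<in>?d ` Z. Q * (norm (ghat k))\<^sup>2)"
      proof (rule sum_mono)
        fix k assume "k \<in> ?d ` Z"
        let ?Zk = "{z \<in> Z. ?d z = k}"
        have inj: "inj_on fst ?Zk" by (auto simp: inj_on_def)
        have "card (fst ` ?Zk) \<le> card (int_lattice \<inter> cball 0 (D * 4))"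
        proof (rule conjunct2[OF card_le_of_differences])
          show "fst ` ?Zk \<subseteq> int_lattice" using S by (auto simp: Z_def)
          fix x y assume "x \<in> fst ` ?Zk" "y \<in> fst ` ?Zk"
          then obtain x' y' where xy: "(x, x') \<in> Z" "(y, y') \<in> Z" "x - x' = k" "y - y' = k" by force
          have xy': "x \<in> S" "y \<in> S" "x' \<in> T" "y' \<in> T" using xy by (auto simp: Z_def)
          have d: "x - y = x' - y'" using xy by (simp add: algebra_simps)
          have "\<bar>x \<bullet> \<mu> - b\<bar> \<le> 1" "\<bar>y \<bullet> \<mu> - b\<bar> \<le> 1" using S xy' by auto
          then have 1: "\<bar>(x - y) \<bullet> \<mu>\<bar> \<le> 2" unfolding inner_diff_left by linarith
          have "\<bar>x' \<bullet> \<mu>' - b'\<bar> \<le> 1" "\<bar>y' \<bullet> \<mu>' - b'\<bar> \<le> 1" using T xy' by auto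
          then have 2: "\<bar>(x - y) \<bullet> \<mu>'\<bar> \<le> 2" unfolding d inner_diff_left by linarith
          have "norm (x - y) \<le> D * (\<bar>(x - y) \<bullet> \<mu>\<bar> + \<bar>(x - y) \<bullet> \<mu>'\<bar>)" by (rule D(2))
          also have "\<dots> \<le> D * 4" using 1 2 D(1) by (intro mult_left_mono) auto
          finally show "norm (x - y) \<le> D * 4" .
        qed
        then have "real (card ?Zk) \<le> Q" unfolding Q_def card_image[OF inj] by simp
        then have "real (card ?Zk) * (norm (ghat k))\<^sup>2 \<le> Q * (norm (ghat k))\<^sup>2"
          by (intro mult_right_mono) auto
        then show "(\<Sum>z\<in>?Zk. (norm (ghat (?d z)))\<^sup>2) \<le> Q * (norm (ghat k))\<^sup>2" by simp
      qed
      also have "\<dots> = Q * (\<Sum>k\<in>?d ` Z. (norm (ghat k))\<^sup>2)" by (simp add: sum_distrib_left)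
      also have "\<dots> \<le> Q * (\<epsilon>\<^sup>2 / Q)"
      proof (intro mult_left_mono J(3))
        show "?d ` Z \<subseteq> int_lattice - J"
          using S(2) T(2) by (auto simp: Z_def intro!: int_lattice_diff)
      qed (use Q finZ in auto)
      finally show ?thesis using Q by simp
    qed
    have a_sum: "(\<Sum>z\<in>Z. (norm (a (fst z)) * norm (a (snd z)))\<^sup>2) \<le> N * N"
    proof -
      have "(\<Sum>z\<in>Z. (norm (a (fst z)) * norm (a (snd z)))\<^sup>2) \<le> (\<Sum>z\<in>S \<times> T. (norm (a (fst z)) * norm (a (snd z)))\<^sup>2)"
        by (rule sum_mono2[OF _ Zs]) (use S T in auto)
      also have "\<dots> = (\<Sum>k\<in>S. (norm (a k))\<^sup>2) * (\<Sum>k\<in>T. (norm (a k))\<^sup>2)"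
        by (simp add: sum_product sum.cartesian_product power_mult_distrib split_beta')
      also have "\<dots> \<le> N * N" by (intro mult_mono N N0 sum_nonneg) auto
      finally show ?thesis .
    qed
    have "(\<Sum>z\<in>Z. norm (a (fst z)) * norm (a (snd z)) * norm (ghat (?d z)))\<^sup>2
      \<le> (\<Sum>z\<in>Z. (norm (a (fst z)) * norm (a (snd z)))\<^sup>2) * (\<Sum>z\<in>Z. (norm (ghat (?d z)))\<^sup>2)"
      by (rule Cauchy_Schwarz_ineq_sum)
    also have "\<dots> \<le> (N * N) * \<epsilon>\<^sup>2"
      by (intro mult_mono a_sum ghat_sum mult_nonneg_nonneg N0 sum_nonneg) auto
    also have "\<dots> = (\<epsilon> * N)\<^sup>2" by (simp add: power2_eq_square)
    finally have "(\<Sum>z\<in>Z. norm (a (fst z)) * norm (a (snd z)) * norm (ghat (?d z))) \<le> \<epsilon> * N"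
      by (rule power2_le_imp_le) (use \<epsilon> N0 in simp)
    then show "(\<Sum>(k, l) | k \<in> S \<and> l \<in> T \<and> k - l \<notin> J. norm (a k) * norm (a l) * norm (ghat (k - l))) \<le> \<epsilon> * N"
      unfolding Z_def[symmetric] by (simp add: split_beta')
  qed
qed

text \<open>If the difference of a pair lies in the finite set \<open>J\<close>, its first component
  is near both lines, so all first components lie in one ball around any one of them,
  \<open>l\<close>. The product of coefficients is split with a small parameter \<delta>: the second
  component, known only to be bounded by the norm, gets the factor \<delta>; the first gets
  \<open>1 / \<delta>\<close>, which is affordable since it is controlled near the corner.\<close>

lemma cross_bound:
  assumes ind: "independent_dirs \<mu> \<mu>'" and \<epsilon>: "0 < \<epsilon>"
  shows "\<exists>C\<ge>0. cross_control \<epsilon> C \<mu> \<mu>'"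
proof -
  obtain D where D: "0 < D" "\<And>w. norm w \<le> D * (\<bar>w \<bullet> \<mu>\<bar> + \<bar>w \<bullet> \<mu>'\<bar>)"
    using independent_dirs_bound[OF ind] by blast
  have \<epsilon>2: "0 < \<epsilon> / 2" using \<epsilon> by simp
  obtain J where J: "finite J" "J \<subseteq> int_lattice"
    and far: "\<And>S T b b' (a :: real^2 \<Rightarrow> complex) N. \<lbrakk>finite S; S \<subseteq> int_lattice; finite T; T \<subseteq> int_lattice;
      \<forall>k\<in>S. \<bar>k \<bullet> \<mu> - b\<bar> \<le> 1; \<forall>k\<in>T. \<bar>k \<bullet> \<mu>' - b'\<bar> \<le> 1;
      (\<Sum>k\<in>S. (norm (a k))\<^sup>2) \<le> N; (\<Sum>k\<in>T. (norm (a k))\<^sup>2) \<le> N\<rbrakk> \<Longrightarrow>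
      (\<Sum>(k, l) | k \<in> S \<and> l \<in> T \<and> k - l \<notin> J. norm (a k) * norm (a l) * norm (ghat (k - l))) \<le> \<epsilon> / 2 * N"
    by (rule cross_far_bound[OF ind \<epsilon>2]) blast
  \<comment> \<open>A bound for the shift along \<mu>' when a difference from \<open>J\<close>
    carries a point of \<open>T\<close> to one of \<open>S\<close>.\<close>
  define P where "P = (\<Sum>j\<in>J. \<bar>j \<bullet> \<mu>'\<bar>)"
  have P: "\<bar>j \<bullet> \<mu>'\<bar> \<le> P" if "j \<in> J" for j
    unfolding P_def by (rule member_le_sum[OF that]) (use J in auto)
  have P0: "0 \<le> P" unfolding P_def by (intro sum_nonneg) auto
  define Q where "Q = (M + 1) * (real (card J) + 1)"
  have Q: "0 < Q" using M_nonneg by (simp add: Q_def)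
  \<comment> \<open>\<delta> and \<epsilon>' are tuned so that \<open>Q * \<delta>\<close> and
    \<open>Q * \<epsilon>' / \<delta>\<close> both equal \<open>\<epsilon> / 4\<close>; with the far
    part \<open>\<epsilon> / 2\<close> this makes \<epsilon>.\<close>
  define \<delta> where "\<delta> = \<epsilon> / (4 * Q)"
  have \<delta>: "0 < \<delta>" using \<epsilon> Q by (simp add: \<delta>_def)
  define r where "r = D * (4 + 2 * P)"
  define \<epsilon>' where "\<epsilon>' = \<epsilon> * \<delta> / (4 * Q)"
  have \<epsilon>': "0 < \<epsilon>'" using \<epsilon> \<delta> Q by (simp add: \<epsilon>'_def)
  obtain C where C: "0 \<le> C" "\<And>U a l. finite U \<and> U \<subseteq> int_lattice \<and> l \<in> int_lattice
      \<and> (\<forall>k\<in>U. (k - l) \<bullet> \<mu> \<le> 2 + P \<and> (k - l) \<bullet> \<mu>' \<le> 2 + P) \<Longrightarrow>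
    (\<Sum>k | k \<in> U \<and> norm (k - l) \<le> r. (norm (a k))\<^sup>2) \<le> \<epsilon>' * (\<Sum>k\<in>U. (norm (a k))\<^sup>2) + C * energy U a"
    using near_bound[OF ind \<epsilon>', of "2 + P" r] by blast
  show ?thesis unfolding cross_control_def
  proof (intro exI[of _ "Q / \<delta> * C"] conjI allI impI; (elim conjE)?)
    show "0 \<le> Q / \<delta> * C" using Q \<delta> C by simp
    fix U S T and a :: "real^2 \<Rightarrow> complex" and b b'
    assume U: "finite U" "U \<subseteq> int_lattice" "\<forall>k\<in>U. k \<bullet> \<mu> \<le> b + 1" "\<forall>k\<in>U. k \<bullet> \<mu>' \<le> b' + 1"
      and ST: "S \<subseteq> U" "T \<subseteq> U" "\<forall>k\<in>S. \<bar>k \<bullet> \<mu> - b\<bar> \<le> 1" "\<forall>k\<in>T. \<bar>k \<bullet> \<mu>' - b'\<bar> \<le> 1"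
    have fin: "finite S" "finite T" using ST(1,2) U(1) by (auto intro: finite_subset)
    define N where "N = (\<Sum>k\<in>U. (norm (a k))\<^sup>2)"
    have NS: "(\<Sum>k\<in>S. (norm (a k))\<^sup>2) \<le> N" "(\<Sum>k\<in>T. (norm (a k))\<^sup>2) \<le> N"
      unfolding N_def using ST U by (auto intro!: sum_mono2)
    have N0: "0 \<le> N" unfolding N_def by (intro sum_nonneg) auto
    have E0: "0 \<le> energy U a" by (rule energy_nonneg)
    define Zi where "Zi = {(k, l). k \<in> S \<and> l \<in> T \<and> k - l \<in> J}"
    define Zo where "Zo = {(k, l). k \<in> S \<and> l \<in> T \<and> k - l \<notin> J}"
    define h where "h = (\<lambda>(k, l). norm (a k) * norm (a l) * norm (ghat (k - l)))"
    have Z: "S \<times> T = Zi \<union> Zo" "Zi \<inter> Zo = {}" by (auto simp: Zi_def Zo_def)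
    have finZ: "finite Zi" "finite Zo"
      using Z(1) fin by (metis finite_SigmaI finite_Un)+
    have "norm (cross S T a) \<le> (\<Sum>z\<in>S \<times> T. norm (case z of (k, l) \<Rightarrow> a k * cnj (a l) * ghat (k - l)))"
      unfolding cross_eq[OF fin] by (rule norm_sum)
    also have "\<dots> = (\<Sum>z\<in>S \<times> T. h z)" by (rule sum.cong) (auto simp: h_def norm_mult)
    also have "\<dots> = sum h Zi + sum h Zo" unfolding Z(1) by (rule sum.union_disjoint[OF finZ Z(2)])
    also have "sum h Zo \<le> \<epsilon> / 2 * N"
      unfolding h_def Zo_def by (rule far) (use fin ST U NS in auto)
    also have "sum h Zi \<le> \<epsilon> / 2 * N + Q / \<delta> * C * energy U a"
    proof (cases "Zi = {}")
      case True
      then show ?thesis using \<epsilon> N0 Q \<delta> C(1) E0 by simp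
    next
      case False
      then obtain l l' where l: "l \<in> S" "l' \<in> T" "l - l' \<in> J" by (auto simp: Zi_def)
      have S\<mu>': "\<bar>k \<bullet> \<mu>' - b'\<bar> \<le> 1 + P" if "(k, k') \<in> Zi" for k k'
      proof -
        have "\<bar>k' \<bullet> \<mu>' - b'\<bar> \<le> 1" "\<bar>(k - k') \<bullet> \<mu>'\<bar> \<le> P" using that P ST by (auto simp: Zi_def)
        then show ?thesis unfolding inner_diff_left by linarith
      qed
      have lS: "\<bar>l \<bullet> \<mu> - b\<bar> \<le> 1" "\<bar>l \<bullet> \<mu>' - b'\<bar> \<le> 1 + P"
        using l ST S\<mu>'[of l l'] by (auto simp: Zi_def)
      let ?V = "{k \<in> U. norm (k - l) \<le> r}"
      have V: "k \<in> ?V" if "(k, k') \<in> Zi" for k k'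
      proof -
        have k: "k \<in> S" using that by (auto simp: Zi_def)
        have "\<bar>k \<bullet> \<mu> - b\<bar> \<le> 1" using k ST by auto
        then have 1: "\<bar>(k - l) \<bullet> \<mu>\<bar> \<le> 2" using lS unfolding inner_diff_left by linarith
        have 2: "\<bar>(k - l) \<bullet> \<mu>'\<bar> \<le> 2 + 2 * P" using lS S\<mu>'[OF that] unfolding inner_diff_left by linarith
        have "norm (k - l) \<le> D * (\<bar>(k - l) \<bullet> \<mu>\<bar> + \<bar>(k - l) \<bullet> \<mu>'\<bar>)" by (rule D(2))
        also have "\<dots> \<le> r" unfolding r_def using 1 2 D(1) by (intro mult_left_mono) auto
        finally show ?thesis using k ST by auto
      qed
      have near: "(\<Sum>k\<in>?V. (norm (a k))\<^sup>2) \<le> \<epsilon>' * N + C * energy U a"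
        unfolding N_def
      proof (rule C(2), intro conjI ballI)
        fix k assume "k \<in> U"
        then have "k \<bullet> \<mu> \<le> b + 1" "k \<bullet> \<mu>' \<le> b' + 1" using U by auto
        then show "(k - l) \<bullet> \<mu> \<le> 2 + P" "(k - l) \<bullet> \<mu>' \<le> 2 + P"
          using lS P0 unfolding inner_diff_left by linarith+
      qed (use U l ST in auto)
      have "sum h Zi \<le> (\<Sum>z\<in>Zi. M * (\<delta> * (norm (a (snd z)))\<^sup>2 + (norm (a (fst z)))\<^sup>2 / \<delta>))"
      proof (rule sum_mono)
        fix z assume "z \<in> Zi"
        obtain k k' where z: "z = (k, k')" by (cases z)
        have "norm (a k) * norm (a k') \<le> \<delta> * (norm (a k'))\<^sup>2 + (norm (a k))\<^sup>2 / \<delta>"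
        proof -
          have "0 \<le> (\<delta> * norm (a k') - norm (a k))\<^sup>2" by simp
          then have "2 * \<delta> * (norm (a k) * norm (a k')) \<le> \<delta>\<^sup>2 * (norm (a k'))\<^sup>2 + (norm (a k))\<^sup>2"
            by (simp add: power2_diff power_mult_distrib mult_ac)
          moreover have "0 \<le> \<delta> * (norm (a k) * norm (a k'))" using \<delta> by simp
          ultimately have "\<delta> * (norm (a k) * norm (a k')) \<le> \<delta>\<^sup>2 * (norm (a k'))\<^sup>2 + (norm (a k))\<^sup>2"
            by linarith
          also have "\<dots> = \<delta> * (\<delta> * (norm (a k'))\<^sup>2 + (norm (a k))\<^sup>2 / \<delta>)"
            using \<delta> by (simp add: distrib_left power2_eq_square mult.assoc)
          finally have "\<delta> * (norm (a k) * norm (a k')) \<le> \<delta> * (\<delta> * (norm (a k'))\<^sup>2 + (norm (a k))\<^sup>2 / \<delta>)" .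
          then show ?thesis using \<delta> by (simp only: mult_le_cancel_left_pos)
        qed
        then have "norm (a k) * norm (a k') * norm (ghat (k - k')) \<le> (\<delta> * (norm (a k'))\<^sup>2 + (norm (a k))\<^sup>2 / \<delta>) * M"
          using \<delta> by (intro mult_mono norm_ghat_le) auto
        then show "h z \<le> M * (\<delta> * (norm (a (snd z)))\<^sup>2 + (norm (a (fst z)))\<^sup>2 / \<delta>)"
          by (simp add: h_def z mult.commute)
      qed
      also have "\<dots> = M * (\<delta> * (\<Sum>z\<in>Zi. (norm (a (snd z)))\<^sup>2) + (\<Sum>z\<in>Zi. (norm (a (fst z)))\<^sup>2) / \<delta>)"
        by (simp add: sum.distrib sum_divide_distrib flip: sum_distrib_left)
      also have "\<dots> \<le> M * (\<delta> * (real (card J) * N) + (real (card J) * (\<Sum>k\<in>?V. (norm (a k))\<^sup>2)) / \<delta>)"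
      proof (intro mult_left_mono add_mono divide_right_mono)
        \<comment> \<open>A pair in \<open>Zi\<close> is determined by its difference in
          \<open>J\<close> and either component, so each coefficient is counted at most
          \<open>card J\<close> times.\<close>
        have "(\<Sum>z\<in>Zi. (norm (a (snd z)))\<^sup>2) \<le> (\<Sum>z\<in>J \<times> T. (norm (a (snd z)))\<^sup>2)"
        proof (rule sum_le_included[where i="\<lambda>z. (fst z + snd z, snd z)"])
          show "\<forall>z\<in>Zi. \<exists>y\<in>J \<times> T. (fst y + snd y, snd y) = z \<and> (norm (a (snd z)))\<^sup>2 \<le> (norm (a (snd y)))\<^sup>2"
          proof
            fix z assume z: "z \<in> Zi"
            then show "\<exists>y\<in>J \<times> T. (fst y + snd y, snd y) = z \<and> (norm (a (snd z)))\<^sup>2 \<le> (norm (a (snd y)))\<^sup>2"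
              by (intro bexI[of _ "(fst z - snd z, snd z)"]) (auto simp: Zi_def)
          qed
        qed (use finZ J fin in auto)
        also have "\<dots> = real (card J) * (\<Sum>k\<in>T. (norm (a k))\<^sup>2)"
          using sum.cartesian_product[of "\<lambda>_ k. (norm (a k))\<^sup>2" T J] by (simp add: split_beta')
        also have "\<dots> \<le> real (card J) * N" using NS by (intro mult_left_mono) auto
        finally show "(\<Sum>z\<in>Zi. (norm (a (snd z)))\<^sup>2) \<le> real (card J) * N" .
        have "(\<Sum>z\<in>Zi. (norm (a (fst z)))\<^sup>2) \<le> (\<Sum>z\<in>J \<times> ?V. (norm (a (snd z)))\<^sup>2)"
        proof (rule sum_le_included[where i="\<lambda>z. (snd z, snd z - fst z)"])
          show "\<forall>z\<in>Zi. \<exists>y\<in>J \<times> ?V. (snd y, snd y - fst y) = z \<and> (norm (a (fst z)))\<^sup>2 \<le> (norm (a (snd y)))\<^sup>2"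
          proof
            fix z assume z: "z \<in> Zi"
            then show "\<exists>y\<in>J \<times> ?V. (snd y, snd y - fst y) = z \<and> (norm (a (fst z)))\<^sup>2 \<le> (norm (a (snd y)))\<^sup>2"
              using V[of "fst z" "snd z"] by (intro bexI[of _ "(fst z - snd z, fst z)"]) (auto simp: Zi_def)
          qed
        qed (use finZ J U in auto)
        also have "\<dots> = real (card J) * (\<Sum>k\<in>?V. (norm (a k))\<^sup>2)"
          using sum.cartesian_product[of "\<lambda>_ k. (norm (a k))\<^sup>2" ?V J] by (simp add: split_beta')
        finally show "(\<Sum>z\<in>Zi. (norm (a (fst z)))\<^sup>2) \<le> real (card J) * (\<Sum>k\<in>?V. (norm (a k))\<^sup>2)" .
      qed (use \<delta> M_nonneg in auto)
      also have "\<dots> = (M * real (card J)) * (\<delta> * N + (\<Sum>k\<in>?V. (norm (a k))\<^sup>2) / \<delta>)"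
        by (simp add: algebra_simps)
      also have "\<dots> \<le> Q * (\<delta> * N + (\<epsilon>' * N + C * energy U a) / \<delta>)"
      proof (intro mult_mono add_left_mono divide_right_mono near)
        show "M * real (card J) \<le> Q" unfolding Q_def using M_nonneg by (intro mult_mono) auto
      qed (use \<delta> Q N0 in \<open>auto intro!: add_nonneg_nonneg divide_nonneg_nonneg sum_nonneg\<close>)
      also have "\<dots> = (Q * \<delta>) * N + (Q * \<epsilon>' / \<delta>) * N + Q / \<delta> * C * energy U a"
        by (simp add: algebra_simps add_divide_distrib)
      also have "Q * \<delta> = \<epsilon> / 4" using Q by (simp add: \<delta>_def)
      also have "Q * \<epsilon>' / \<delta> = \<epsilon> / 4" using Q \<delta> by (simp add: \<epsilon>'_def)
      finally show ?thesis by (simp add: mult_ac)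
    qed
    finally show "norm (cross S T a) \<le> \<epsilon> * (\<Sum>k\<in>U. (norm (a k))\<^sup>2) + Q / \<delta> * C * energy U a"
      unfolding N_def[symmetric] by (simp add: mult_ac)
  qed
qed

end

section \<open>Tube averages and segment integrals\<close>

lemmas integrable_tm_tm =
  integrable_pair_bounded[OF tm.finite_measure_axioms tm.finite_measure_axioms sets_tm sets_tm, where A=UNIV, simplified]

definition lattice_ball :: "real \<Rightarrow> (real^2) set" where
  "lattice_ball \<delta> = (\<Union>k\<in>int_lattice. ball k \<delta>)"

lemma lattice_ball_iff: "z \<in> lattice_ball \<delta> \<longleftrightarrow> (\<exists>k\<in>int_lattice. norm (z - k) < \<delta>)"
  by (auto simp: lattice_ball_def dist_norm norm_minus_commute)

lemma sets_lattice_ball [measurable]: "lattice_ball \<delta> \<in> sets borel"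
  unfolding lattice_ball_def by (intro borel_open) auto

lemma lattice_ball_periodic: "k \<in> int_lattice \<Longrightarrow> x + k \<in> lattice_ball \<delta> \<longleftrightarrow> x \<in> lattice_ball \<delta>"
  unfolding lattice_ball_iff
proof safe
  fix l assume "k \<in> int_lattice" "l \<in> int_lattice" "norm (x + k - l) < \<delta>"
  then show "\<exists>l\<in>int_lattice. norm (x - l) < \<delta>"
    by (intro bexI[of _ "l - k"]) (auto simp: algebra_simps)
next
  fix l assume "k \<in> int_lattice" "l \<in> int_lattice" "norm (x - l) < \<delta>"
  then show "\<exists>l\<in>int_lattice. norm (x + k - l) < \<delta>"
    by (intro bexI[of _ "l + k"]) (auto simp: algebra_simps)
qed

text \<open>Moved to the centre \<open>p\<close> of the cell, a ball of radius less than
  \<open>1 / 2\<close> lies inside the cell, and no other lattice translate of it enters.\<close>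

lemma measure_lattice_ball:
  assumes "0 < \<delta>" "\<delta> < 1 / 2"
  shows "measure tm (lattice_ball \<delta>) = unit_ball_vol 2 * \<delta>\<^sup>2"
proof -
  define p :: "real^2" where "p = (\<chi> i. 1/2)"
  have [measurable]: "ball p \<delta> \<in> sets borel" by simp
  have "(LINT x|tm. indicator (lattice_ball \<delta>) x :: real) = (LINT x|tm. indicator (lattice_ball \<delta>) (x + (- p)))"
    by (rule integral_tm_shift[symmetric])
       (auto simp: lattice_periodic_def indicator_def lattice_ball_periodic)
  also have "\<dots> = (LINT x|tm. indicator (ball p \<delta>) x)"
  proof (rule integral_cong_AE)
    show "AE x in tm. indicator (lattice_ball \<delta>) (x + - p) = (indicator (ball p \<delta>) x :: real)"
      using AE_tm_cell
    proof eventually_elim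
      case (elim x)
      have "x + - p \<in> lattice_ball \<delta> \<longleftrightarrow> x \<in> ball p \<delta>"
      proof
        assume "x + - p \<in> lattice_ball \<delta>"
        then obtain k where k: "k \<in> int_lattice" "norm (x + - p - k) < \<delta>" by (auto simp: lattice_ball_iff)
        have "k $ i = 0" for i
        proof -
          have "\<bar>(x + - p - k) $ i\<bar> < 1 / 2"
            using component_le_norm_cart[of "x + - p - k" i] k assms by linarith
          moreover have "0 \<le> x $ i" "x $ i < 1" using elim by (auto simp: unit_cell_def)
          ultimately have "\<bar>k $ i\<bar> < 1" by (simp add: p_def) (auto simp: abs_if split: if_splits)
          moreover have "k $ i \<in> \<int>" using k by (simp add: int_lattice_def)
          ultimately show ?thesis by (metis Ints_nonzero_abs_less1)
        qed
        then have "k = 0" by (simp add: vec_eq_iff)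
        then show "x \<in> ball p \<delta>" using k by (simp add: dist_norm norm_minus_commute)
      next
        assume "x \<in> ball p \<delta>"
        then show "x + - p \<in> lattice_ball \<delta>"
          unfolding lattice_ball_iff by (intro bexI[of _ 0]) (auto simp: dist_norm norm_minus_commute)
      qed
      then show ?case by (simp add: indicator_def)
    qed
  qed measurable
  also have "\<dots> = measure tm (ball p \<delta>)" by simp
  also have "\<dots> = measure lborel (ball p \<delta> \<inter> unit_cell)"
    by (simp add: measure_def emeasure_tm)
  also have "ball p \<delta> \<inter> unit_cell = ball p \<delta>"
  proof -
    have "x \<in> unit_cell" if "x \<in> ball p \<delta>" for x
      unfolding unit_cell_def
    proof (intro CollectI allI)
      fix i
      have "\<bar>(x - p) $ i\<bar> < 1 / 2"
        using component_le_norm_cart[of "x - p" i] that assms by (simp add: dist_norm norm_minus_commute)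
      then show "0 \<le> x $ i \<and> x $ i < 1" by (simp add: p_def) (auto simp: abs_if split: if_splits)
    qed
    then show ?thesis by blast
  qed
  also have "measure lborel (ball p \<delta>) = unit_ball_vol 2 * \<delta>\<^sup>2"
    using content_ball[of \<delta> p] assms by simp
  finally show ?thesis by simp
qed

lemma geodesic_nonempty: "0 \<le> L \<Longrightarrow> geodesic x \<nu> L \<noteq> {}"
  unfolding geodesic_def using int_lattice_0 by blast

lemma tube_iff:
  assumes "0 \<le> L"
  shows "y \<in> tube x \<nu> L \<delta> \<longleftrightarrow> (\<exists>t\<in>{0..L}. y + - (x + t *\<^sub>R \<nu>) \<in> lattice_ball \<delta>)"
proof -
  have "y \<in> tube x \<nu> L \<delta> \<longleftrightarrow> (\<exists>p\<in>geodesic x \<nu> L. dist y p < \<delta>)"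
    unfolding tube_def mem_Collect_eq infdist_notempty[OF geodesic_nonempty[OF assms]]
    by (subst cInf_less_iff) (use geodesic_nonempty[OF assms] in auto)
  also have "\<dots> \<longleftrightarrow> (\<exists>t\<in>{0..L}. \<exists>k\<in>int_lattice. dist y (x + t *\<^sub>R \<nu> + k) < \<delta>)"
  proof
    assume "\<exists>p\<in>geodesic x \<nu> L. dist y p < \<delta>"
    then show "\<exists>t\<in>{0..L}. \<exists>k\<in>int_lattice. dist y (x + t *\<^sub>R \<nu> + k) < \<delta>"
      unfolding geodesic_def by auto
  next
    assume "\<exists>t\<in>{0..L}. \<exists>k\<in>int_lattice. dist y (x + t *\<^sub>R \<nu> + k) < \<delta>"
    then obtain t k where "t \<in> {0..L}" "k \<in> int_lattice" "dist y (x + t *\<^sub>R \<nu> + k) < \<delta>" by blast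
    then show "\<exists>p\<in>geodesic x \<nu> L. dist y p < \<delta>"
      unfolding geodesic_def by (intro bexI[of _ "x + t *\<^sub>R \<nu> + k"]) auto
  qed
  also have "\<dots> \<longleftrightarrow> (\<exists>t\<in>{0..L}. y + - (x + t *\<^sub>R \<nu>) \<in> lattice_ball \<delta>)"
    by (simp add: lattice_ball_iff dist_norm algebra_simps)
  finally show ?thesis .
qed

lemma sets_tube [measurable]: "tube x \<nu> L \<delta> \<in> sets borel"
  unfolding tube_def by (intro borel_open open_Collect_less continuous_intros)

text \<open>Doubling the radius turns one close point of the segment into a whole stretch of them.
  At an end of the segment only one half of the stretch survives, hence the length \<delta> instead
  of \<open>2 * \<delta>\<close>, and the condition \<open>\<delta> \<le> L\<close>.\<close>

lemma indicator_tube_le: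
  assumes "0 < \<delta>" "\<delta> \<le> L" "norm \<nu> = 1"
  shows "\<delta> * indicator (tube x \<nu> L \<delta>) y \<le> (LINT t|seg L. indicator (lattice_ball (2 * \<delta>)) (y + - (x + t *\<^sub>R \<nu>)))"
proof (cases "y \<in> tube x \<nu> L \<delta>")
  case True
  define A where "A = {t. y + - (x + t *\<^sub>R \<nu>) \<in> lattice_ball (2 * \<delta>)}"
  have A: "A \<in> sets borel" unfolding A_def by measurable
  obtain s k where s: "s \<in> {0..L}" "k \<in> int_lattice" "norm (y + - (x + s *\<^sub>R \<nu>) - k) < \<delta>"
    using True assms by (auto simp: tube_iff lattice_ball_iff)
  define I where "I = {max 0 (s - \<delta>)..min L (s + \<delta>)}"
  have IA: "I \<subseteq> A"
  proof
    fix t assume t: "t \<in> I"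
    have eq: "y + - (x + t *\<^sub>R \<nu>) - k = (y + - (x + s *\<^sub>R \<nu>) - k) + (s - t) *\<^sub>R \<nu>"
      by (simp add: algebra_simps)
    have "norm (y + - (x + t *\<^sub>R \<nu>) - k) \<le> norm (y + - (x + s *\<^sub>R \<nu>) - k) + \<bar>s - t\<bar>"
      unfolding eq by (rule order_trans[OF norm_triangle_ineq]) (simp add: assms(3))
    moreover have "\<bar>s - t\<bar> \<le> \<delta>" using t by (auto simp: I_def abs_if)
    ultimately have "norm (y + - (x + t *\<^sub>R \<nu>) - k) < 2 * \<delta>" using s(3) by linarith
    then show "t \<in> A" unfolding A_def mem_Collect_eq lattice_ball_iff using s(2) by blast
  qed
  have "\<delta> \<le> min L (s + \<delta>) - max 0 (s - \<delta>)" using s assms by auto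
  then have "\<delta> \<le> measure lborel I" using assms unfolding I_def by simp
  also have "\<dots> = measure (seg L) I"
    by (subst measure_seg) (use s assms in \<open>auto simp: I_def intro!: arg_cong[where f="measure lborel"]\<close>)
  also have "\<dots> \<le> measure (seg L) A" using A IA by (intro seg.finite_measure_mono) auto
  also have "\<dots> = (LINT t|seg L. indicator A t)" by simp
  also have "\<dots> = (LINT t|seg L. indicator (lattice_ball (2 * \<delta>)) (y + - (x + t *\<^sub>R \<nu>)))"
    by (intro Bochner_Integration.integral_cong) (auto simp: A_def indicator_def)
  finally show ?thesis using True by simp
qed (auto intro!: integral_nonneg_AE)

text \<open>A long geodesic can return to the same ball many times. On a piece of length
  \<open>L' \<le> 1 / 4\<close>, with \<open>\<delta> \<le> 1 / 8\<close>, two visits must use the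
  same lattice vector, so their times differ by less than \<open>2 * \<delta>\<close> and all of
  them fit into an interval of length \<open>4 * \<delta>\<close>.\<close>

lemma indicator_tube_ge:
  assumes "0 < \<delta>" "\<delta> \<le> 1 / 8" "0 < L'" "L' \<le> L" "L' \<le> 1 / 4" "norm \<nu> = 1"
  shows "(LINT t|seg L'. indicator (lattice_ball \<delta>) (y + - (x + t *\<^sub>R \<nu>))) \<le> 4 * \<delta> * indicator (tube x \<nu> L \<delta>) y"
proof -
  define A where "A = {t. y + - (x + t *\<^sub>R \<nu>) \<in> lattice_ball \<delta>}"
  have A: "A \<in> sets borel" unfolding A_def by measurable
  have eq: "(LINT t|seg L'. indicator (lattice_ball \<delta>) (y + - (x + t *\<^sub>R \<nu>))) = measure lborel (A \<inter> {0..L'})"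
  proof -
    have "(LINT t|seg L'. indicator (lattice_ball \<delta>) (y + - (x + t *\<^sub>R \<nu>))) = (LINT t|seg L'. indicator A t)"
      by (intro Bochner_Integration.integral_cong) (auto simp: A_def indicator_def)
    also have "\<dots> = measure (seg L') A" by simp
    also have "\<dots> = measure lborel (A \<inter> {0..L'})" by (rule measure_seg[OF A])
    finally show ?thesis .
  qed
  show ?thesis
  proof (cases "A \<inter> {0..L'} = {}")
    case True
    then show ?thesis unfolding eq using assms by (auto simp: indicator_def)
  next
    case False
    then obtain s where s: "s \<in> A" "s \<in> {0..L'}" by blast
    then have y: "y \<in> tube x \<nu> L \<delta>" using assms by (auto simp: tube_iff A_def)
    have "A \<inter> {0..L'} \<subseteq> {s - 2 * \<delta>..s + 2 * \<delta>}"
    proof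
      fix t assume t: "t \<in> A \<inter> {0..L'}"
      obtain k where k: "k \<in> int_lattice" "norm (y + - (x + s *\<^sub>R \<nu>) - k) < \<delta>"
        using s by (auto simp: A_def lattice_ball_iff)
      obtain l where l: "l \<in> int_lattice" "norm (y + - (x + t *\<^sub>R \<nu>) - l) < \<delta>"
        using t by (auto simp: A_def lattice_ball_iff)
      have eq: "(t - s) *\<^sub>R \<nu> + (l - k) = (y + - (x + s *\<^sub>R \<nu>) - k) - (y + - (x + t *\<^sub>R \<nu>) - l)"
        by (simp add: algebra_simps)
      have d: "norm ((t - s) *\<^sub>R \<nu> + (l - k)) < 2 * \<delta>"
        unfolding eq by (rule le_less_trans[OF norm_triangle_ineq4]) (use k l in linarith)
      have "norm (l - k) \<le> norm ((t - s) *\<^sub>R \<nu> + (l - k)) + norm ((t - s) *\<^sub>R \<nu>)"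
        using norm_triangle_ineq4[of "(t - s) *\<^sub>R \<nu> + (l - k)" "(t - s) *\<^sub>R \<nu>"] by simp
      also have "norm ((t - s) *\<^sub>R \<nu>) = \<bar>t - s\<bar>" using assms by simp
      also have "\<bar>t - s\<bar> \<le> 1 / 4" using t s assms by (auto simp: abs_if)
      finally have "norm (l - k) < 1" using d assms by simp
      then have "l - k = 0" using int_lattice_norm_lt_1[of "l - k"] k l by blast
      then have "\<bar>t - s\<bar> < 2 * \<delta>" using d assms by simp
      then show "t \<in> {s - 2 * \<delta>..s + 2 * \<delta>}" by (auto simp: abs_if split: if_splits)
    qed
    then have "measure lborel (A \<inter> {0..L'}) \<le> measure lborel {s - 2 * \<delta>..s + 2 * \<delta>}"
      using A by (intro measure_mono_fmeasurable) (auto intro!: fmeasurableI simp: emeasure_lborel_Icc_eq)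
    also have "\<dots> = 4 * \<delta>" using assms by simp
    finally show ?thesis unfolding eq using y by simp
  qed
qed

text \<open>Tubes may overlap themselves, but their measure is still at least of order \<delta>:
  integrate the preceding pointwise bound over \<open>y\<close>, using that all translates of the
  ball have the same measure.\<close>

lemma measure_tube_ge:
  assumes "0 < \<delta>" "\<delta> \<le> 1 / 8" "0 < L'" "L' \<le> L" "L' \<le> 1 / 4" "norm \<nu> = 1"
  shows "L' * measure tm (lattice_ball \<delta>) \<le> 4 * \<delta> * measure tm (tube x \<nu> L \<delta>)"
proof -
  let ?f = "\<lambda>y t. indicator (lattice_ball \<delta>) (y + - (x + t *\<^sub>R \<nu>)) :: real"
  note F = integrable_tm_seg[of ?f L' 1]
  have F: "integrable tm (\<lambda>y. LINT t|seg L'. ?f y t)"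
    "(LINT t|seg L'. LINT y|tm. ?f y t) = (LINT y|tm. LINT t|seg L'. ?f y t)"
    by (rule F; simp add: split_beta' indicator_def)+
  have "(LINT y|tm. ?f y t) = measure tm (lattice_ball \<delta>)" for t
    by (subst integral_tm_shift) (auto simp: lattice_periodic_def indicator_def lattice_ball_periodic)
  then have "L' * measure tm (lattice_ball \<delta>) = (LINT t|seg L'. LINT y|tm. ?f y t)"
    using assms by simp
  also have "\<dots> \<le> (LINT y|tm. 4 * \<delta> * indicator (tube x \<nu> L \<delta>) y)"
    unfolding F(2)
  proof (rule integral_mono[OF F(1)])
    show "integrable tm (\<lambda>y. 4 * \<delta> * indicator (tube x \<nu> L \<delta>) y)"
      by (intro integrable_mult_right integrable_tm_bounded[of _ 1]) auto
  qed (intro indicator_tube_ge assms)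
  finally show ?thesis by simp
qed

lemma lattice_periodicD: "lattice_periodic g \<Longrightarrow> k \<in> int_lattice \<Longrightarrow> g (x + k) = g x"
  by (simp add: lattice_periodic_def)

text \<open>The tube is swept out by the segments starting at \<open>x + z\<close> with
  \<open>z\<close> in a small ball; Fubini and translation invariance pass from one description to
  the other.\<close>

lemma tube_integral_le:
  assumes "torus_weight g M" and per: "lattice_periodic g"
    and "0 < \<delta>" "\<delta> \<le> L" "norm \<nu> = 1"
  shows "\<delta> * (LINT y|tm. indicator (tube x \<nu> L \<delta>) y * g y)
    \<le> (LINT z|tm. indicator (lattice_ball (2 * \<delta>)) z * (LINT t|seg L. g (x + z + t *\<^sub>R \<nu>)))"
proof -
  interpret torus_weight g M by fact
  let ?B = "indicator (lattice_ball (2 * \<delta>)) :: real^2 \<Rightarrow> real"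
  let ?f = "\<lambda>y t. ?B (y + - (x + t *\<^sub>R \<nu>)) * g y"
  let ?h = "\<lambda>z t. ?B z * g (z + (x + t *\<^sub>R \<nu>))"
  have gb: "\<bar>g y\<bar> \<le> M" for y using g_nonneg[of y] g_le[of y] by simp
  have B: "\<bar>?B y * g z\<bar> \<le> M" for y z using gb[of z] M_nonneg by (simp add: indicator_def)
  note F = integrable_tm_seg[of ?f L M]
  have F: "integrable tm (\<lambda>y. LINT t|seg L. ?f y t)"
    "(LINT t|seg L. LINT y|tm. ?f y t) = (LINT y|tm. LINT t|seg L. ?f y t)"
    by (rule F; use B in \<open>simp add: split_beta'\<close>)+
  note H = integrable_tm_seg[of ?h L M]
  have H: "(LINT t|seg L. LINT z|tm. ?h z t) = (LINT z|tm. LINT t|seg L. ?h z t)"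
    by (rule H; use B in \<open>simp add: split_beta'\<close>)
  have "\<delta> * (LINT y|tm. indicator (tube x \<nu> L \<delta>) y * g y) = (LINT y|tm. \<delta> * indicator (tube x \<nu> L \<delta>) y * g y)"
    by (simp add: mult.assoc)
  also have "\<dots> \<le> (LINT y|tm. LINT t|seg L. ?f y t)"
  proof (rule integral_mono[OF _ F(1)])
    show "integrable tm (\<lambda>y. \<delta> * indicator (tube x \<nu> L \<delta>) y * g y)"
      by (rule integrable_tm_bounded[of _ "\<delta> * M"])
         (use gb assms M_nonneg in \<open>auto simp: abs_mult indicator_def intro!: mult_left_mono\<close>)
    fix y
    have "\<delta> * indicator (tube x \<nu> L \<delta>) y * g y \<le> (LINT t|seg L. ?B (y + - (x + t *\<^sub>R \<nu>))) * g y"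
      by (intro mult_right_mono indicator_tube_le g_nonneg assms)
    then show "\<delta> * indicator (tube x \<nu> L \<delta>) y * g y \<le> (LINT t|seg L. ?f y t)" by simp
  qed
  also have "\<dots> = (LINT t|seg L. LINT y|tm. ?f y t)" by (rule F(2)[symmetric])
  also have "\<dots> = (LINT t|seg L. LINT z|tm. ?h z t)"
  proof (rule Bochner_Integration.integral_cong[OF refl])
    fix t
    have "(LINT z|tm. ?f (z + (x + t *\<^sub>R \<nu>)) t) = (LINT y|tm. ?f y t)"
    proof (rule integral_tm_shift)
      show "lattice_periodic (\<lambda>y. ?f y t)"
      proof (rule lattice_periodicI)
        fix y k :: "real^2" assume k: "k \<in> int_lattice"
        have "(y + k) + - (x + t *\<^sub>R \<nu>) = (y + - (x + t *\<^sub>R \<nu>)) + k" by simp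
        then have "?B ((y + k) + - (x + t *\<^sub>R \<nu>)) = ?B (y + - (x + t *\<^sub>R \<nu>))"
          using lattice_ball_periodic[OF k, of "y + - (x + t *\<^sub>R \<nu>)"] by (simp only: indicator_def)
        then show "?f (y + k) t = ?f y t" using lattice_periodicD[OF per k] by simp
      qed
    qed measurable
    then show "(LINT y|tm. ?f y t) = (LINT z|tm. ?h z t)" by simp
  qed
  also have "\<dots> = (LINT z|tm. ?B z * (LINT t|seg L. g (x + z + t *\<^sub>R \<nu>)))"
    unfolding H by (simp add: add_ac)
  finally show ?thesis .
qed

section \<open>From averages over balls to almost every segment\<close>

lemma closed_int_lattice: "closed int_lattice"
proof -
  have "int_lattice = (\<Inter>i. (\<lambda>x. x $ i) -` \<int>)" by (auto simp: int_lattice_def)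
  also have "closed \<dots>"
    by (intro closed_INT ballI closed_vimage closed_Ints continuous_intros)
  finally show ?thesis .
qed

text \<open>
  This replaces the Lebesgue differentiation theorem: the neighbourhoods of a compact set \<open>K\<close> on which
  \<open>F < c\<close> decrease to \<open>K\<close>, so the ball averages of \<open>F\<close>, integrated over \<open>K\<close>, are in the limit at most
  the integral of \<open>F\<close> over \<open>K\<close>.
\<close>

lemma ball_average_imp_AE:
  fixes F :: "real^2 \<Rightarrow> real"
  assumes [measurable]: "F \<in> borel_measurable borel" and F: "\<And>x. 0 \<le> F x" "\<And>x. F x \<le> B"
    and per: "lattice_periodic F" and r0: "0 < r0" "r0 \<le> 1 / 2"
    and avg: "\<And>x r. 0 < r \<Longrightarrow> r < r0 \<Longrightarrow>
      c * measure tm (lattice_ball r) \<le> (LINT z|tm. indicator (lattice_ball r) z * F (x + z))"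
  shows "AE x in tm. c \<le> F x"
proof (rule ccontr)
  assume neg: "\<not> ?thesis"
  have B: "0 \<le> B" using F order_trans by blast
  have Fb: "\<bar>F x\<bar> \<le> B" for x using F by simp
  \<comment> \<open>A quantitative gap below \<open>c\<close> makes the final comparison of
    integrals strict.\<close>
  define A where "A n = {x \<in> unit_cell. F x \<le> c - 1 / real (Suc n)}" for n
  have A[measurable]: "A n \<in> sets borel" for n unfolding A_def by measurable
  have "\<exists>n. emeasure tm (A n) \<noteq> 0"
  proof (rule ccontr)
    assume "\<not> (\<exists>n. emeasure tm (A n) \<noteq> 0)"
    then have "AE x in tm. x \<notin> A n" for n by (subst AE_iff_measurable[of "A n"]) auto
    then have "AE x in tm. \<forall>n. x \<notin> A n" by (simp add: AE_all_countable)
    with AE_tm_cell have "AE x in tm. c \<le> F x"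
    proof eventually_elim
      case (elim x)
      show ?case
      proof (rule ccontr)
        assume "\<not> c \<le> F x"
        then obtain n where "1 / real (Suc n) < c - F x" using nat_approx_posE[of "c - F x"] by auto
        then have "x \<in> A n" using elim(1) unfolding A_def by simp
        then show False using elim(2) by blast
      qed
    qed
    then show False using neg by blast
  qed
  then obtain n where n: "emeasure tm (A n) \<noteq> 0" by blast
  then obtain K where K: "K \<subseteq> A n" "compact K" "0 < measure tm K"
    using compact_positive_subset[OF A] by blast
  \<comment> \<open>Saturating \<open>K\<close> by the lattice makes its neighbourhoods periodic, so
    that translation invariance applies; as \<open>K\<close> is compact, its sum with the closed
    lattice is closed.\<close>
  define P where "P = (\<Union>x\<in>K. \<Union>k\<in>int_lattice. {x + k})"
  have P: "closed P" unfolding P_def by (rule compact_closed_sums[OF K(2) closed_int_lattice])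
  have [measurable]: "P \<in> sets borel" using P by (rule borel_closed)
  have KP: "K \<subseteq> P" unfolding P_def by (auto intro!: bexI[of _ 0])
  have "K \<noteq> {}" using K(3) by auto
  then have Pne: "P \<noteq> {}" using KP by blast
  have Pper: "x + k \<in> P" if x: "x \<in> P" and k: "k \<in> int_lattice" for x k
  proof -
    obtain y l where "y \<in> K" "l \<in> int_lattice" "x = y + l" using x unfolding P_def by blast
    then have "y \<in> K" "l + k \<in> int_lattice" "x + k = y + (l + k)" using k by (auto simp: add.assoc)
    then show ?thesis unfolding P_def by blast
  qed
  have Pper_iff: "x + k \<in> P \<longleftrightarrow> x \<in> P" if "k \<in> int_lattice" for x k
    using Pper[of x k] Pper[of "x + k" "- k"] that by auto
  have PF: "F x \<le> c - 1 / real (Suc n)" if "x \<in> P" for x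
    using that K(1) per unfolding P_def A_def by (auto simp: lattice_periodicD)
  have mP: "0 < measure tm P"
    using K(3) tm.finite_measure_mono[OF KP] by simp
  define h where "h r x = (indicator {x. infdist x P \<le> r} x :: real)" for r x
  have [measurable]: "h r \<in> borel_measurable borel" for r
  proof -
    have "{x. infdist x P \<le> r} \<in> sets borel"
      by (intro borel_closed closed_Collect_le continuous_intros)
    then show ?thesis unfolding h_def by (intro borel_measurable_indicator)
  qed
  have h: "0 \<le> h r x" "h r x \<le> 1" for r x by (auto simp: h_def indicator_def)
  have hF: "\<bar>h r x * F x\<bar> \<le> B" for r x using Fb[of x] B by (simp add: h_def indicator_def)
  have key: "c * measure tm P \<le> (LINT x|tm. h r x * F x)" if r: "0 < r" "r < r0" for r
  proof -
    define b where "b = measure tm (lattice_ball r)"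
    have b: "0 < b" unfolding b_def using r r0 by (subst measure_lattice_ball) auto
    let ?b = "indicator (lattice_ball r) :: real^2 \<Rightarrow> real"
    let ?p = "indicator P :: real^2 \<Rightarrow> real"
    let ?f = "\<lambda>x z. ?p x * (?b z * F (x + z))"
    have bd: "\<bar>?f x z\<bar> \<le> B" for x z using Fb[of "x + z"] B by (simp add: indicator_def)
    note I = integrable_tm_tm[of ?f B]
    have I: "integrable tm (\<lambda>x. LINT z|tm. ?f x z)" "integrable tm (\<lambda>z. LINT x|tm. ?f x z)"
      "(LINT z|tm. LINT x|tm. ?f x z) = (LINT x|tm. LINT z|tm. ?f x z)"
      by (rule I; use bd in \<open>simp add: split_beta'\<close>)+
    have "(c * measure tm P) * b = (LINT x|tm. ?p x * (c * b))" by simp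
    also have "\<dots> \<le> (LINT x|tm. LINT z|tm. ?f x z)"
    proof (rule integral_mono[OF _ I(1)])
      fix x
      have "?p x * (c * b) \<le> ?p x * (LINT z|tm. ?b z * F (x + z))"
        using avg[OF r, of x] by (intro mult_left_mono) (auto simp: b_def)
      then show "?p x * (c * b) \<le> (LINT z|tm. ?f x z)" by simp
    qed (intro integrable_mult_left integrable_tm_bounded[of _ 1]; auto)
    also have "\<dots> = (LINT z|tm. LINT x|tm. ?f x z)" by (rule I(3)[symmetric])
    also have "\<dots> \<le> (LINT z|tm. ?b z * (LINT x|tm. h r x * F x))"
    proof (rule integral_mono[OF I(2)])
      fix z
      show "(LINT x|tm. ?f x z) \<le> ?b z * (LINT x|tm. h r x * F x)"
      proof (cases "z \<in> lattice_ball r")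
        case True
        then obtain k where k: "k \<in> int_lattice" "norm (z - k) < r" by (auto simp: lattice_ball_iff)
        \<comment> \<open>For \<open>z\<close> within \<open>r\<close> of \<open>k\<close>, a point
          \<open>x\<close> with \<open>x - z\<close> in \<open>P\<close> has distance less than
          \<open>r\<close> from the point \<open>x - z + k\<close> of \<open>P\<close>.\<close>
        let ?G = "\<lambda>x. ?p (x + - z) * F x"
        have "(LINT x|tm. ?f x z) = (LINT x|tm. ?G (x + z))" using True by simp
        also have "\<dots> = (LINT x|tm. ?G x)"
        proof (rule integral_tm_shift)
          show "lattice_periodic ?G"
          proof (rule lattice_periodicI)
            fix x l :: "real^2" assume l: "l \<in> int_lattice"
            have "x + l + - z = (x + - z) + l" by simp
            then have "?p (x + l + - z) = ?p (x + - z)"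
              using Pper_iff[OF l, of "x + - z"] by (simp only: indicator_def)
            then show "?G (x + l) = ?G x" using lattice_periodicD[OF per l] by simp
          qed
        qed measurable
        also have "\<dots> \<le> (LINT x|tm. h r x * F x)"
        proof (rule integral_mono)
          show "integrable tm ?G"
            by (rule integrable_tm_bounded[of _ B]) (use Fb B in \<open>auto simp: indicator_def\<close>)
          show "integrable tm (\<lambda>x. h r x * F x)"
            by (rule integrable_tm_bounded[of _ B]) (use hF in simp_all)
          fix x
          show "?G x \<le> h r x * F x"
          proof (cases "x + - z \<in> P")
            case True
            then have "x + - z + k \<in> P" by (rule Pper) (rule k)
            then have "infdist x P \<le> dist x (x + - z + k)" by (rule infdist_le)
            also have "\<dots> = norm (z - k)" by (simp add: dist_norm)
            finally show ?thesis using k F(1)[of x] by (simp add: h_def indicator_def)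
          qed (use h F in auto)
        qed
        finally show ?thesis using True by simp
      qed simp
    qed (intro integrable_mult_left integrable_tm_bounded[of _ 1]; auto)
    also have "\<dots> = (LINT x|tm. h r x * F x) * b" by (simp add: b_def)
    finally show ?thesis using b by (simp only: mult_le_cancel_right_pos)
  qed
  define R where "R m = r0 / (real m + 2)" for m :: nat
  have R: "0 < R m" "R m < r0" for m using r0 by (auto simp: R_def field_simps intro: add_pos_nonneg)
  have R0: "R \<longlonglongrightarrow> 0" unfolding R_def by real_asymp
  have "(\<lambda>m. LINT x|tm. h (R m) x * F x) \<longlonglongrightarrow> (LINT x|tm. indicator P x * F x)"
  proof (rule integral_dominated_convergence[where w="\<lambda>_. B"])
    show "AE x in tm. (\<lambda>m. h (R m) x * F x) \<longlonglongrightarrow> indicator P x * F x"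
    proof (intro AE_I2 tendsto_mult_right)
      fix x
      show "(\<lambda>m. h (R m) x) \<longlonglongrightarrow> indicator P x"
      proof (cases "x \<in> P")
        case True
        then have "h (R m) x = 1" for m using R(1)[of m] by (simp add: h_def)
        then show ?thesis using True by simp
      next
        case False
        then have "0 < infdist x P" using P Pne by (simp add: infdist_pos_not_in_closed)
        then have "\<forall>\<^sub>F m in sequentially. R m < infdist x P" by (rule order_tendstoD(2)[OF R0])
        then have "\<forall>\<^sub>F m in sequentially. h (R m) x = indicator P x"
          by eventually_elim (use False in \<open>simp add: h_def\<close>)
        then show ?thesis by (rule tendsto_eventually)
      qed
    qed
    show "AE x in tm. norm (h (R m) x * F x) \<le> B" for m
      by (intro AE_I2) (use hF in simp)
  qed auto
  then have "c * measure tm P \<le> (LINT x|tm. indicator P x * F x)"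
    by (rule LIMSEQ_le_const) (use key[OF R] in blast)
  also have "\<dots> \<le> (LINT x|tm. indicator P x * (c - 1 / real (Suc n)))"
  proof (rule integral_mono)
    show "integrable tm (\<lambda>x. indicator P x * F x)"
      by (rule integrable_tm_bounded[of _ B]) (use Fb B in \<open>auto simp: indicator_def\<close>)
    show "indicator P x * F x \<le> indicator P x * (c - 1 / real (Suc n))" for x
      using PF[of x] by (simp add: indicator_def)
  qed (intro integrable_mult_left integrable_tm_bounded[of _ 1]; auto)
  also have "\<dots> = measure tm P * (c - 1 / real (Suc n))" by simp
  also have "\<dots> < measure tm P * c" using mP by (intro mult_strict_left_mono) auto
  finally show False by (simp add: mult.commute)
qed

text \<open>The ball of radius \<open>2 * \<delta>\<close> has 4 times the measure of the
  \<delta>-ball, and the tube has at least \<open>L' / (4 * \<delta>)\<close> times the measure of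
  the latter; together these give the loss of 16. So the ball averages of the fibre integrals are
  bounded below, and the bound passes to almost every point.\<close>

lemma tube_average_imp_fibre:
  assumes "torus_weight g M" and per: "lattice_periodic g"
    and L: "0 < L" and c0: "0 < c0" and \<nu>: "norm \<nu> = 1" and \<delta>0: "0 < \<delta>0"
    and avg: "\<And>x \<delta>. 0 < \<delta> \<Longrightarrow> \<delta> < \<delta>0 \<Longrightarrow>
      c0 * measure tm (tube x \<nu> L \<delta>) \<le> (LINT y|tm. indicator (tube x \<nu> L \<delta>) y * g y)"
  shows "AE x in tm. c0 * min L (1 / 4) / 16 \<le> (LINT t|seg L. g (x + t *\<^sub>R \<nu>))"
proof -
  interpret torus_weight g M by fact
  define L' where "L' = min L (1 / 4)"
  have L': "0 < L'" "L' \<le> L" "L' \<le> 1 / 4" using L by (auto simp: L'_def)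
  define d where "d = min \<delta>0 (min L (1 / 8))"
  have d: "0 < d" "d \<le> \<delta>0" "d \<le> L" "d \<le> 1 / 8" using \<delta>0 L by (auto simp: d_def)
  define F where "F x = (LINT t|seg L. g (x + t *\<^sub>R \<nu>))" for x
  have [measurable]: "F \<in> borel_measurable borel"
    unfolding F_def by (intro seg.borel_measurable_lebesgue_integral) measurable
  have "AE x in tm. c0 * L' / 16 \<le> F x"
  proof (rule ball_average_imp_AE[where B="L * M" and ?r0.0="2 * d"])
    show "F x \<le> L * M" for x
    proof -
      have "F x \<le> (LINT t|seg L. M)" unfolding F_def
        by (intro integral_mono integrable_seg_bounded[of _ _ M]) (use g_nonneg g_le M_nonneg in auto)
      then show ?thesis using L by simp
    qed
    show "0 \<le> F x" for x unfolding F_def by (intro integral_nonneg_AE AE_I2 g_nonneg)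
    show "lattice_periodic F"
    proof (rule lattice_periodicI)
      fix x k :: "real^2" assume k: "k \<in> int_lattice"
      have "g (x + k + t *\<^sub>R \<nu>) = g (x + t *\<^sub>R \<nu>)" for t
        using lattice_periodicD[OF per k, of "x + t *\<^sub>R \<nu>"] by (simp add: add_ac)
      then show "F (x + k) = F x" by (simp add: F_def)
    qed
    fix x r assume r: "0 < r" "r < 2 * d"
    define \<delta> where "\<delta> = r / 2"
    have \<delta>: "0 < \<delta>" "\<delta> < d" "r = 2 * \<delta>" using r by (auto simp: \<delta>_def)
    have "measure tm (lattice_ball r) = 4 * measure tm (lattice_ball \<delta>)"
      unfolding \<delta>(3) using \<delta> d by (subst (1 2) measure_lattice_ball) (auto simp: power2_eq_square)
    then have "\<delta> * (c0 * L' / 16 * measure tm (lattice_ball r)) = \<delta> * (c0 / 4 * (L' * measure tm (lattice_ball \<delta>)))"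
      by simp
    also have "\<dots> \<le> \<delta> * (c0 / 4 * (4 * \<delta> * measure tm (tube x \<nu> L \<delta>)))"
      using \<delta> d c0 by (intro mult_left_mono measure_tube_ge L' \<nu>) auto
    also have "\<dots> = \<delta> * (\<delta> * (c0 * measure tm (tube x \<nu> L \<delta>)))" by simp
    also have "\<dots> \<le> \<delta> * (\<delta> * (LINT y|tm. indicator (tube x \<nu> L \<delta>) y * g y))"
      using \<delta> d by (intro mult_left_mono avg) auto
    also have "\<dots> \<le> \<delta> * (LINT z|tm. indicator (lattice_ball (2 * \<delta>)) z * F (x + z))"
      unfolding F_def using \<delta> d by (intro mult_left_mono tube_integral_le[OF assms(1) per] \<nu>) auto
    finally show "c0 * L' / 16 * measure tm (lattice_ball r) \<le> (LINT z|tm. indicator (lattice_ball r) z * F (x + z))"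
      using \<delta> by (simp only: mult_le_cancel_left_pos)
  qed (use d in auto)
  then show ?thesis unfolding F_def L'_def .
qed

section \<open>Geometry of the polygon\<close>

text \<open>Lagrange's identity \<open>?d\<^sup>2 + (\<mu> \<bullet> \<mu>')\<^sup>2 = 1\<close>:
  the determinant vanishes only when the inner product is 1 or -1, that is, for equal or opposite
  vectors. Otherwise Cramer's rule gives \<open>w = 0\<close>.\<close>

lemma independent_unit_vectors:
  fixes \<mu> \<mu>' :: "real^2"
  assumes "norm \<mu> = 1" "norm \<mu>' = 1" "\<mu>' \<noteq> \<mu>" "\<mu>' \<noteq> - \<mu>"
  shows "independent_dirs \<mu> \<mu>'"
  unfolding independent_dirs_def
proof (intro allI impI)
  fix w :: "real^2" assume w: "w \<bullet> \<mu> = 0" "w \<bullet> \<mu>' = 0"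
  let ?d = "\<mu> $ 1 * \<mu>' $ 2 - \<mu> $ 2 * \<mu>' $ 1"
  have in2: "x \<bullet> y = x $ 1 * y $ 1 + x $ 2 * y $ 2" for x y :: "real^2"
    by (simp add: inner_vec_def sum_2)
  have n: "\<mu> \<bullet> \<mu> = 1" "\<mu>' \<bullet> \<mu>' = 1" using assms by (simp_all add: norm_eq_1)
  have "?d\<^sup>2 + (\<mu> \<bullet> \<mu>')\<^sup>2 = (\<mu> \<bullet> \<mu>) * (\<mu>' \<bullet> \<mu>')"
    unfolding in2 by (simp add: power2_eq_square algebra_simps)
  then have lag: "?d\<^sup>2 + (\<mu> \<bullet> \<mu>')\<^sup>2 = 1" using n by simp
  have "?d \<noteq> 0"
  proof
    assume "?d = 0"
    then have "(\<mu> \<bullet> \<mu>')\<^sup>2 = 1" using lag by simp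
    then consider "\<mu> \<bullet> \<mu>' = 1" | "\<mu> \<bullet> \<mu>' = - 1" by (auto simp: power2_eq_1_iff)
    then show False
    proof cases
      case 1
      then have "(\<mu>' - \<mu>) \<bullet> (\<mu>' - \<mu>) = 0" using n by (simp add: inner_diff inner_commute)
      then show False using assms by simp
    next
      case 2
      then have "(\<mu>' + \<mu>) \<bullet> (\<mu>' + \<mu>) = 0" using n by (simp add: inner_add inner_commute)
      then show False using assms by (simp add: add_eq_0_iff)
    qed
  qed
  moreover have "w $ 1 * ?d = \<mu>' $ 2 * (w \<bullet> \<mu>) - \<mu> $ 2 * (w \<bullet> \<mu>')"
    "w $ 2 * ?d = \<mu> $ 1 * (w \<bullet> \<mu>') - \<mu>' $ 1 * (w \<bullet> \<mu>)"
    unfolding in2 by (simp_all add: algebra_simps)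
  ultimately have "w $ 1 = 0" "w $ 2 = 0" using w by simp_all
  then show "w = 0" by (simp add: vec_eq_iff forall_2)
qed

text \<open>\<open>b\<close> is the support function of \<open>P\<close>. \<open>N\<close> consists
  of the outer normals and their negatives, so that every side has an opposite partner, possibly a
  mere supporting line through a vertex. \<open>b \<mu> + b (- \<mu>)\<close> is the width in that
  direction, positive because \<open>P\<close> has interior points.\<close>

lemma polygon_normals:
  assumes "convex_polygon P"
  obtains N b where "finite N" "N \<subseteq> side_normals P" "N \<noteq> {}" "\<And>\<mu>. \<mu> \<in> N \<Longrightarrow> - \<mu> \<in> N"
    "\<And>\<mu> p. p \<in> P \<Longrightarrow> p \<bullet> \<mu> \<le> b \<mu>"
    "\<And>\<mu>. \<mu> \<in> N \<Longrightarrow> 0 < b \<mu> + b (- \<mu>)"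
    "\<And>p. p \<in> frontier P \<Longrightarrow> \<exists>\<mu>\<in>N. p \<bullet> \<mu> = b \<mu>" "frontier P \<noteq> {}" "frontier P \<subseteq> P" "bounded P"
proof -
  have poly: "polytope P" and int: "interior P \<noteq> {}" using assms by (auto simp: convex_polygon_def)
  have ph: "polyhedron P" using poly by (rule polytope_imp_polyhedron)
  have comp: "compact P" using poly by (rule polytope_imp_compact)
  have bdd: "bounded P" using comp by (rule compact_imp_bounded)
  have dimP: "aff_dim P = 2" using aff_dim_nonempty_interior[OF int] by simp
  have frP: "frontier P \<subseteq> P" using comp compact_imp_closed frontier_subset_closed by blast
  have frontier: "frontier P = \<Union>{F. F facet_of P}"
    using rel_frontier_of_polyhedron[OF ph] rel_frontier_nonempty_interior[OF int] by simp
  have Pne: "P \<noteq> {}" using int interior_subset by blast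
  have "P \<noteq> UNIV" using bdd by (metis not_bounded_UNIV)
  then have frne: "frontier P \<noteq> {}" using Pne frontier_eq_empty by blast
  define b where "b \<mu> = Sup ((\<lambda>p. p \<bullet> \<mu>) ` P)" for \<mu>
  have bnd: "bdd_above ((\<lambda>p. p \<bullet> \<mu>) ` P)" for \<mu>
    by (intro bounded_imp_bdd_above compact_imp_bounded compact_continuous_image comp continuous_intros)
  have b: "p \<bullet> \<mu> \<le> b \<mu>" if "p \<in> P" for p \<mu>
    unfolding b_def by (rule cSup_upper) (use that bnd in auto)
  have "\<exists>a. norm a = 1 \<and> a \<in> side_normals P \<and> (\<forall>p\<in>F. p \<bullet> a = b a)" if F: "F facet_of P" for F
  proof -
    obtain a \<beta> where a: "a \<noteq> 0" "P \<subseteq> {x. a \<bullet> x \<le> \<beta>}" "F = P \<inter> {x. a \<bullet> x = \<beta>}"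
      using facet_of_polyhedron[OF ph F] by blast
    define u where "u = (1 / norm a) *\<^sub>R a"
    have nu: "norm u = 1" using a by (simp add: u_def)
    have pu: "p \<bullet> u = (a \<bullet> p) / norm a" for p by (simp add: u_def inner_commute)
    have Fne: "F \<noteq> {}" using F by (auto simp: facet_of_def)
    have bu: "b u = \<beta> / norm a"
      unfolding b_def
    proof (rule cSup_eq_maximum)
      show "\<beta> / norm a \<in> (\<lambda>p. p \<bullet> u) ` P" using Fne a(3) unfolding pu by auto
      fix y assume "y \<in> (\<lambda>p. p \<bullet> u) ` P"
      then show "y \<le> \<beta> / norm a" using a(2) unfolding pu by (auto intro!: divide_right_mono)
    qed
    \<comment> \<open>In dimension 2 facets and edges are the same faces: both have dimension
      1.\<close>
    have "F edge_of P" using F dimP by (simp add: facet_of_def edge_of_def)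
    moreover have "\<forall>x\<in>F. \<forall>y\<in>F. orthogonal u (x - y)"
      using a(3) by (auto simp: orthogonal_def u_def inner_diff_right)
    ultimately have "u \<in> side_normals P" using nu by (auto simp: side_normals_def)
    moreover have "\<forall>p\<in>F. p \<bullet> u = b u" using a(3) by (simp add: pu bu)
    ultimately show ?thesis using nu by blast
  qed
  then obtain a where a: "\<And>F. F facet_of P \<Longrightarrow> norm (a F) = 1 \<and> a F \<in> side_normals P \<and> (\<forall>p\<in>F. p \<bullet> a F = b (a F))"
    by metis
  define N where "N = a ` {F. F facet_of P} \<union> (\<lambda>F. - a F) ` {F. F facet_of P}"
  have "finite {F. F facet_of P}" using finite_polyhedron_facets[OF ph] .
  then have finN: "finite N" by (simp add: N_def)
  have neg: "- \<mu> \<in> side_normals P" if "\<mu> \<in> side_normals P" for \<mu>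
    using that by (auto simp: side_normals_def orthogonal_def)
  have Nside: "N \<subseteq> side_normals P" using a neg by (auto simp: N_def)
  have touch: "\<exists>\<mu>\<in>N. p \<bullet> \<mu> = b \<mu>" if p: "p \<in> frontier P" for p
  proof -
    have "p \<in> \<Union>{F. F facet_of P}" using p unfolding frontier .
    then obtain F where "F facet_of P" "p \<in> F" by blast
    then show ?thesis using a[of F] by (auto simp: N_def)
  qed
  show ?thesis
  proof (rule that[of N b])
    show "N \<noteq> {}" using frne touch by blast
    show "- \<mu> \<in> N" if "\<mu> \<in> N" for \<mu> using that by (auto simp: N_def)
    show "0 < b \<mu> + b (- \<mu>)" if \<mu>: "\<mu> \<in> N" for \<mu>
    proof -
      obtain q where "q \<in> interior P" using int by blast
      then obtain e where e: "0 < e" "cball q e \<subseteq> P" using mem_interior_cball by blast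
      have n\<mu>: "\<mu> \<bullet> \<mu> = 1" using \<mu> Nside by (auto simp: side_normals_def norm_eq_1)
      then have "norm \<mu> = 1" by (simp add: norm_eq_1)
      then have "q + e *\<^sub>R \<mu> \<in> P" using e by (auto simp: dist_norm intro!: subsetD[OF e(2)])
      then have "(q + e *\<^sub>R \<mu>) \<bullet> \<mu> \<le> b \<mu>" by (rule b)
      moreover have "q \<in> P" using e by auto
      then have "q \<bullet> (- \<mu>) \<le> b (- \<mu>)" by (rule b)
      ultimately show ?thesis using e(1) n\<mu> by (simp add: inner_add_left)
    qed
  qed (use finN Nside b touch frne frP bdd in auto)
qed

section \<open>The quadratic form split over all pairs of sides\<close>

context torus_weight
begin

lemma energy_Re_cross: "energy S a = Re (cross S S a)"
proof -
  have int: "integrable tm (\<lambda>x. complex_of_real (g x) * (tsum S a x * cnj (tsum S a x)))"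
    by (rule integrable_tsum_cnj[where M=M]) (use norm_g in auto)
  have "energy S a = (LINT x|tm. Re (complex_of_real (g x) * (tsum S a x * cnj (tsum S a x))))"
    unfolding energy_def
    by (intro Bochner_Integration.integral_cong refl) (simp flip: complex_norm_square)
  also have "\<dots> = Re (cross S S a)" unfolding cross_def by (rule integral_Re[OF int])
  finally show ?thesis .
qed

lemma cross_swap: "Re (cross T S a) = Re (cross S T a)"
proof -
  have "cross T S a = (LINT x|tm. cnj (complex_of_real (g x) * (tsum S a x * cnj (tsum T a x))))"
    unfolding cross_def by (simp add: mult_ac)
  also have "\<dots> = cnj (cross S T a)" unfolding cross_def by (rule Bochner_Integration.integral_cnj)
  finally show ?thesis by simp
qed

lemma cross_union_left:
  assumes "finite S" "finite S'" "S \<inter> S' = {}" "finite T"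
  shows "cross (S \<union> S') T a = cross S T a + cross S' T a"
proof -
  have "(S \<union> S') \<times> T = S \<times> T \<union> S' \<times> T" "(S \<times> T) \<inter> (S' \<times> T) = {}" using assms by auto
  then show ?thesis using assms by (simp add: cross_eq sum.union_disjoint)
qed

lemma energy_union:
  assumes "finite S" "finite T" "S \<inter> T = {}"
  shows "energy (S \<union> T) a = energy S a + energy T a + 2 * Re (cross S T a)"
proof -
  have "Re (cross (S \<union> T) (S \<union> T) a) = Re (cross S (S \<union> T) a) + Re (cross T (S \<union> T) a)"
    using assms by (simp add: cross_union_left)
  also have "\<dots> = Re (cross (S \<union> T) S a) + Re (cross (S \<union> T) T a)"
    by (simp add: cross_swap)
  also have "\<dots> = Re (cross S S a) + Re (cross T S a) + (Re (cross S T a) + Re (cross T T a))"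
    using assms by (simp add: cross_union_left)
  finally show ?thesis unfolding energy_Re_cross using cross_swap[of T S a] by simp
qed

lemma energy_partition:
  assumes "finite S" "finite N" "m ` S \<subseteq> N"
  shows "energy S a = (\<Sum>\<mu>\<in>N. \<Sum>\<mu>'\<in>N. Re (cross {k\<in>S. m k = \<mu>} {k\<in>S. m k = \<mu>'} a))"
proof -
  let ?h = "\<lambda>k l. a k * cnj (a l) * ghat (k - l)"
  have "cross S S a = (\<Sum>k\<in>S. \<Sum>l\<in>S. ?h k l)"
    using assms(1) by (simp add: cross_eq sum.cartesian_product)
  also have "\<dots> = (\<Sum>\<mu>\<in>N. \<Sum>k\<in>{k\<in>S. m k = \<mu>}. \<Sum>l\<in>S. ?h k l)"
    by (rule sum.group[OF assms(1,2,3), symmetric])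
  also have "\<dots> = (\<Sum>\<mu>\<in>N. \<Sum>k\<in>{k\<in>S. m k = \<mu>}. \<Sum>\<mu>'\<in>N. \<Sum>l\<in>{l\<in>S. m l = \<mu>'}. ?h k l)"
    by (intro sum.cong refl sum.group[OF assms(1,2,3), symmetric])
  also have "\<dots> = (\<Sum>\<mu>\<in>N. \<Sum>\<mu>'\<in>N. \<Sum>k\<in>{k\<in>S. m k = \<mu>}. \<Sum>l\<in>{l\<in>S. m l = \<mu>'}. ?h k l)"
    by (intro sum.cong refl sum.swap)
  also have "\<dots> = (\<Sum>\<mu>\<in>N. \<Sum>\<mu>'\<in>N. cross {k\<in>S. m k = \<mu>} {k\<in>S. m k = \<mu>'} a)"
    using assms(1) by (simp add: cross_eq sum.cartesian_product)
  finally show ?thesis by (simp add: energy_Re_cross)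
qed

end

context positive_torus_weight
begin

lemma cross_bound_uniform:
  assumes N: "finite N" "\<And>\<mu>. \<mu> \<in> N \<Longrightarrow> norm \<mu> = 1" and \<epsilon>: "0 < \<epsilon>"
  shows "\<exists>C\<ge>0. \<forall>\<mu>\<in>N. \<forall>\<mu>'\<in>N. \<mu>' \<noteq> \<mu> \<longrightarrow> \<mu>' \<noteq> - \<mu> \<longrightarrow> cross_control \<epsilon> C \<mu> \<mu>'"
proof -
  have "\<exists>C\<ge>0. \<mu> \<in> N \<and> \<mu>' \<in> N \<and> \<mu>' \<noteq> \<mu> \<and> \<mu>' \<noteq> - \<mu> \<longrightarrow> cross_control \<epsilon> C \<mu> \<mu>'" for \<mu> \<mu>'
  proof (cases "\<mu> \<in> N \<and> \<mu>' \<in> N \<and> \<mu>' \<noteq> \<mu> \<and> \<mu>' \<noteq> - \<mu>")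
    case True
    then have "independent_dirs \<mu> \<mu>'" using N independent_unit_vectors by blast
    from cross_bound[OF this \<epsilon>] show ?thesis by blast
  qed auto
  then obtain C where C: "\<And>\<mu> \<mu>'. 0 \<le> C \<mu> \<mu>'"
    "\<And>\<mu> \<mu>'. \<mu> \<in> N \<Longrightarrow> \<mu>' \<in> N \<Longrightarrow> \<mu>' \<noteq> \<mu> \<Longrightarrow> \<mu>' \<noteq> - \<mu> \<Longrightarrow> cross_control \<epsilon> (C \<mu> \<mu>') \<mu> \<mu>'"
    by metis
  define D where "D = (\<Sum>\<mu>\<in>N. \<Sum>\<mu>'\<in>N. C \<mu> \<mu>')"
  have D: "C \<mu> \<mu>' \<le> D" if "\<mu> \<in> N" "\<mu>' \<in> N" for \<mu> \<mu>'
  proof -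
    have "C \<mu> \<mu>' \<le> (\<Sum>\<mu>'\<in>N. C \<mu> \<mu>')" by (rule member_le_sum[OF that(2) C(1) N(1)])
    also have "\<dots> \<le> D" unfolding D_def
      by (rule member_le_sum[OF that(1) _ N(1)]) (use C(1) in \<open>auto intro: sum_nonneg\<close>)
    finally show ?thesis .
  qed
  show ?thesis
  proof (intro exI[of _ D] conjI ballI impI)
    show "0 \<le> D" unfolding D_def by (intro sum_nonneg C(1))
    fix \<mu> \<mu>' assume "\<mu> \<in> N" "\<mu>' \<in> N" "\<mu>' \<noteq> \<mu>" "\<mu>' \<noteq> - \<mu>"
    then show "cross_control \<epsilon> D \<mu> \<mu>'" using C(2) D cross_control_mono by blast
  qed
qed

text \<open>Each frequency is assigned to one side. The blocks \<open>{\<mu>, - \<mu>}\<close> bound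
  the diagonal and opposite entries of the form from below; all other entries are transversal and
  are added back at the price of at most \<open>n\<^sup>2\<close> interaction errors. The sum over
  \<open>N\<close> counts every block twice, and this factor cancels.\<close>

lemma boundary_spectrum_bound_large:
  assumes per: "lattice_periodic g" and L: "0 < L" and c: "0 < c" and M: "0 < M"
    and N: "finite N" "N \<noteq> {}" "\<And>\<mu>. \<mu> \<in> N \<Longrightarrow> norm \<mu> = 1" "\<And>\<mu>. \<mu> \<in> N \<Longrightarrow> - \<mu> \<in> N"
    and fib: "\<And>\<mu>. \<mu> \<in> N \<Longrightarrow> AE x in tm. c \<le> (LINT t|seg L. g (x + t *\<^sub>R \<mu>))"
    and b: "\<And>\<mu>. \<mu> \<in> N \<Longrightarrow> 0 < b \<mu> + b (- \<mu>)"
  shows "\<exists>C>0. \<exists>R0>0. \<forall>R\<ge>R0. \<forall>S a. finite S \<and> S \<subseteq> int_lattice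
    \<and> (\<forall>k\<in>S. \<exists>\<mu>\<in>N. \<bar>k \<bullet> \<mu> - R * b \<mu>\<bar> \<le> 1) \<and> (\<forall>k\<in>S. \<forall>\<mu>\<in>N. k \<bullet> \<mu> \<le> R * b \<mu> + 1) \<longrightarrow>
    (\<Sum>k\<in>S. (norm (a k))\<^sup>2) \<le> C * energy S a"
proof -
  from double_strip_bound[OF L c M] obtain \<kappa> W where \<kappa>: "0 < \<kappa>" "0 < W"
    and strips: "\<And>g \<nu> lam1 lam2 S1 S2 a. torus_weight g M \<and> lattice_periodic g
    \<and> (AE x in tm. c \<le> (LINT t|seg L. g (x + t *\<^sub>R \<nu>)))
    \<and> finite S1 \<and> S1 \<subseteq> int_lattice \<and> (\<forall>k\<in>S1. \<bar>k \<bullet> \<nu> - lam1\<bar> \<le> 1)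
    \<and> finite S2 \<and> S2 \<subseteq> int_lattice \<and> (\<forall>k\<in>S2. \<bar>k \<bullet> \<nu> - lam2\<bar> \<le> 1)
    \<and> S1 \<inter> S2 = {} \<and> W \<le> \<bar>lam2 - lam1\<bar> \<Longrightarrow>
    \<kappa> * (\<Sum>k\<in>S1 \<union> S2. (norm (a k))\<^sup>2) \<le> (LINT x|tm. g x * (norm (tsum (S1 \<union> S2) a x))\<^sup>2)" by blast
  define n where "n = real (card N)"
  have n: "0 < n" using N by (simp add: n_def card_gt_0_iff)
  \<comment> \<open>With this value \<open>n\<^sup>2\<close> interaction errors use up just half of
    the main term \<kappa>.\<close>
  define \<epsilon> where "\<epsilon> = \<kappa> / (2 * n\<^sup>2)"
  have \<epsilon>: "0 < \<epsilon>" using \<kappa> n by (simp add: \<epsilon>_def)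
  obtain C where C: "0 \<le> C"
    and cr: "\<forall>\<mu>\<in>N. \<forall>\<mu>'\<in>N. \<mu>' \<noteq> \<mu> \<longrightarrow> \<mu>' \<noteq> - \<mu> \<longrightarrow> cross_control \<epsilon> C \<mu> \<mu>'"
    using cross_bound_uniform[OF N(1,3) \<epsilon>] by blast
  \<comment> \<open>The sum dominates each quotient \<open>W / (b \<mu> + b (- \<mu>))\<close>, so
    from \<open>R0\<close> on the centre lines of opposite strips are at distance at least
    \<open>W\<close>.\<close>
  define R0 where "R0 = (\<Sum>\<mu>\<in>N. W / (b \<mu> + b (- \<mu>)))"
  have R0: "W \<le> R * (b \<mu> + b (- \<mu>))" if "R0 \<le> R" "\<mu> \<in> N" for R \<mu>
  proof -
    have "W / (b \<mu> + b (- \<mu>)) \<le> R0" unfolding R0_def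
      by (rule member_le_sum[OF that(2) _ N(1)]) (use \<kappa> b in \<open>auto simp: less_imp_le\<close>)
    then have "W / (b \<mu> + b (- \<mu>)) \<le> R" using that(1) by simp
    then show ?thesis using b[OF that(2)] by (simp add: divide_le_eq)
  qed
  have "0 < R0" unfolding R0_def using N \<kappa> b by (intro sum_pos) auto
  define C' where "C' = 2 / \<kappa> * (1 + n\<^sup>2 * C)"
  have C': "0 < C'" using \<kappa> C by (simp add: C'_def add_pos_nonneg)
  show ?thesis
  proof (rule exI[of _ C'], rule conjI[OF C'], rule exI[of _ R0], rule conjI[OF \<open>0 < R0\<close>],
      intro allI impI, elim conjE)
    fix R S and a :: "real^2 \<Rightarrow> complex"
    assume R: "R0 \<le> R" and S: "finite S" "S \<subseteq> int_lattice"
      "\<forall>k\<in>S. \<exists>\<mu>\<in>N. \<bar>k \<bullet> \<mu> - R * b \<mu>\<bar> \<le> 1" "\<forall>k\<in>S. \<forall>\<mu>\<in>N. k \<bullet> \<mu> \<le> R * b \<mu> + 1"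
    \<comment> \<open>A frequency near a corner is close to several sides; one of them is chosen, so
      that the parts \<open>A \<mu>\<close> are disjoint.\<close>
    from S(3) obtain m where m: "\<And>k. k \<in> S \<Longrightarrow> m k \<in> N \<and> \<bar>k \<bullet> m k - R * b (m k)\<bar> \<le> 1" by metis
    define A where "A \<mu> = {k\<in>S. m k = \<mu>}" for \<mu>
    have A: "finite (A \<mu>)" "A \<mu> \<subseteq> S" "A \<mu> \<subseteq> int_lattice" "\<forall>k\<in>A \<mu>. \<bar>k \<bullet> \<mu> - R * b \<mu>\<bar> \<le> 1" for \<mu>
      using S m by (auto simp: A_def)
    have Adis: "A \<mu> \<inter> A \<mu>' = {}" if "\<mu> \<noteq> \<mu>'" for \<mu> \<mu>' using that by (auto simp: A_def)
    have nz: "- \<mu> \<noteq> \<mu>" if "\<mu> \<in> N" for \<mu>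
    proof
      assume "- \<mu> = \<mu>"
      then have "\<mu> = 0" unfolding vec_eq_iff by auto
      then show False using N(3)[OF that] by simp
    qed
    let ?n = "\<lambda>S. \<Sum>k\<in>S. (norm (a k))\<^sup>2"
    define X where "X \<mu> \<mu>' = Re (cross (A \<mu>) (A \<mu>') a)" for \<mu> \<mu>'
    have mS: "m ` S \<subseteq> N" using m by blast
    have NS: "?n S = (\<Sum>\<mu>\<in>N. ?n (A \<mu>))"
      unfolding A_def by (rule sum.group[OF S(1) N(1) mS, symmetric])
    have flip: "(\<Sum>\<mu>\<in>N. f (- \<mu>)) = (\<Sum>\<mu>\<in>N. f \<mu>)" for f :: "real^2 \<Rightarrow> real"
      by (rule sum.reindex_bij_witness[of _ uminus uminus]) (use N(4) in auto)
    have E0: "0 \<le> energy S a" by (rule energy_nonneg)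
    have N0: "0 \<le> ?n S" by (intro sum_nonneg) auto
    have par: "\<kappa> * (?n (A \<mu>) + ?n (A (- \<mu>))) \<le> X \<mu> \<mu> + X (- \<mu>) (- \<mu>) + 2 * X \<mu> (- \<mu>)" if \<mu>: "\<mu> \<in> N" for \<mu>
    proof -
      have dis: "A \<mu> \<inter> A (- \<mu>) = {}" by (rule Adis) (use nz[OF \<mu>] in auto)
      have "\<kappa> * ?n (A \<mu> \<union> A (- \<mu>)) \<le> (LINT x|tm. g x * (norm (tsum (A \<mu> \<union> A (- \<mu>)) a x))\<^sup>2)"
      \<comment> \<open>Measured along \<mu>, the strip belonging to \<open>- \<mu>\<close> is
        centred at the negative of its own level.\<close>
      proof (rule strips[where \<nu>=\<mu> and ?lam1.0="R * b \<mu>" and ?lam2.0="- (R * b (- \<mu>))"], intro conjI)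
        show "torus_weight g M" by unfold_locales
        show "\<forall>k\<in>A (- \<mu>). \<bar>k \<bullet> \<mu> - - (R * b (- \<mu>))\<bar> \<le> 1"
          using A(4)[of "- \<mu>"] by (auto simp: abs_minus_commute algebra_simps)
        have "- (R * b (- \<mu>)) - R * b \<mu> = - (R * (b \<mu> + b (- \<mu>)))" by (simp add: algebra_simps)
        then show "W \<le> \<bar>- (R * b (- \<mu>)) - R * b \<mu>\<bar>" using R0[OF R \<mu>] \<kappa>(2) by simp
      qed (use per fib[OF \<mu>] A dis in auto)
      also have "\<dots> = energy (A \<mu> \<union> A (- \<mu>)) a" by (simp add: energy_def)
      also have "\<dots> = X \<mu> \<mu> + X (- \<mu>) (- \<mu>) + 2 * X \<mu> (- \<mu>)"
        unfolding X_def energy_Re_cross[symmetric] by (rule energy_union[OF A(1) A(1) dis])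
      also have "?n (A \<mu> \<union> A (- \<mu>)) = ?n (A \<mu>) + ?n (A (- \<mu>))"
        by (rule sum.union_disjoint[OF A(1) A(1) dis])
      finally show ?thesis .
    qed
    have "2 * (\<kappa> * ?n S) = (\<Sum>\<mu>\<in>N. \<kappa> * (?n (A \<mu>) + ?n (A (- \<mu>))))"
      unfolding NS using flip[of "\<lambda>\<mu>. ?n (A \<mu>)"] by (simp add: sum.distrib distrib_left flip: sum_distrib_left)
    also have "\<dots> \<le> (\<Sum>\<mu>\<in>N. X \<mu> \<mu> + X (- \<mu>) (- \<mu>) + 2 * X \<mu> (- \<mu>))" by (intro sum_mono par)
    also have "\<dots> = 2 * (\<Sum>\<mu>\<in>N. X \<mu> \<mu> + X \<mu> (- \<mu>))"
      using flip[of "\<lambda>\<mu>. X \<mu> \<mu>"] by (simp add: sum.distrib flip: sum_distrib_left)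
    finally have diag: "\<kappa> * ?n S \<le> (\<Sum>\<mu>\<in>N. X \<mu> \<mu> + X \<mu> (- \<mu>))" by simp
    have row: "X \<mu> \<mu> + X \<mu> (- \<mu>) \<le> (\<Sum>\<mu>'\<in>N. X \<mu> \<mu>') + n * (\<epsilon> * ?n S + C * energy S a)" if \<mu>: "\<mu> \<in> N" for \<mu>
    proof -
      let ?O = "N - {\<mu>, - \<mu>}"
      have "\<bar>X \<mu> \<mu>'\<bar> \<le> \<epsilon> * ?n S + C * energy S a" if \<mu>': "\<mu>' \<in> ?O" for \<mu>'
      proof -
        have "norm (cross (A \<mu>) (A \<mu>') a) \<le> \<epsilon> * ?n S + C * energy S a"
        proof (rule cr[rule_format, unfolded cross_control_def, rule_format])
          show "finite S \<and> S \<subseteq> int_lattice \<and> A \<mu> \<subseteq> S \<and> A \<mu>' \<subseteq> S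
            \<and> (\<forall>k\<in>S. k \<bullet> \<mu> \<le> R * b \<mu> + 1) \<and> (\<forall>k\<in>S. k \<bullet> \<mu>' \<le> R * b \<mu>' + 1)
            \<and> (\<forall>k\<in>A \<mu>. \<bar>k \<bullet> \<mu> - R * b \<mu>\<bar> \<le> 1) \<and> (\<forall>k\<in>A \<mu>'. \<bar>k \<bullet> \<mu>' - R * b \<mu>'\<bar> \<le> 1)"
            using \<mu> \<mu>' S A by auto
        qed (use \<mu> \<mu>' in auto)
        then show ?thesis unfolding X_def using abs_Re_le_cmod order_trans by blast
      qed
      then have "(\<Sum>\<mu>'\<in>?O. \<bar>X \<mu> \<mu>'\<bar>) \<le> real (card ?O) * (\<epsilon> * ?n S + C * energy S a)"
        by (rule sum_bounded_above)
      also have "\<dots> \<le> n * (\<epsilon> * ?n S + C * energy S a)"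
        unfolding n_def using \<epsilon> N0 C E0 N(1) by (intro mult_right_mono) (auto intro: card_mono)
      finally have o: "(\<Sum>\<mu>'\<in>?O. \<bar>X \<mu> \<mu>'\<bar>) \<le> n * (\<epsilon> * ?n S + C * energy S a)" .
      have "(\<Sum>\<mu>'\<in>N. X \<mu> \<mu>') = (\<Sum>\<mu>'\<in>?O. X \<mu> \<mu>') + (\<Sum>\<mu>'\<in>{\<mu>, - \<mu>}. X \<mu> \<mu>')"
        by (rule sum.subset_diff) (use \<mu> N in auto)
      also have "(\<Sum>\<mu>'\<in>{\<mu>, - \<mu>}. X \<mu> \<mu>') = X \<mu> \<mu> + X \<mu> (- \<mu>)" using nz[OF \<mu>] by simp
      finally have "(\<Sum>\<mu>'\<in>N. X \<mu> \<mu>') = (\<Sum>\<mu>'\<in>?O. X \<mu> \<mu>') + (X \<mu> \<mu> + X \<mu> (- \<mu>))" .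
      moreover have "- (\<Sum>\<mu>'\<in>?O. X \<mu> \<mu>') \<le> (\<Sum>\<mu>'\<in>?O. \<bar>X \<mu> \<mu>'\<bar>)"
        using sum_abs[of "X \<mu>" ?O] by linarith
      ultimately show ?thesis using o by linarith
    qed
    have "\<kappa> * ?n S \<le> (\<Sum>\<mu>\<in>N. (\<Sum>\<mu>'\<in>N. X \<mu> \<mu>') + n * (\<epsilon> * ?n S + C * energy S a))"
      by (rule order_trans[OF diag sum_mono[OF row]])
    also have "\<dots> = energy S a + n * (n * (\<epsilon> * ?n S + C * energy S a))"
      unfolding energy_partition[OF S(1) N(1) mS, of a] X_def A_def by (simp add: sum.distrib n_def)
    also have "\<dots> = (n\<^sup>2 * \<epsilon>) * ?n S + (1 + n\<^sup>2 * C) * energy S a"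
      by (simp add: algebra_simps power2_eq_square)
    also have "n\<^sup>2 * \<epsilon> = \<kappa> / 2" using n by (simp add: \<epsilon>_def)
    finally have "\<kappa> / 2 * ?n S \<le> (1 + n\<^sup>2 * C) * energy S a" by simp
    then show "?n S \<le> C' * energy S a" using \<kappa>(1) by (simp add: C'_def field_simps)
  qed
qed

end

section \<open>Passage from Lebesgue to Borel functions\<close>

lemma AE_torus_iff: "(AE x in torus. P x) \<longleftrightarrow> (AE x in tm. P x)"
  unfolding torus_def AE_tm_iff by (subst AE_restrict_space_iff) (auto simp: AE_completion_iff)

lemma borel_measurable_torus: "f \<in> borel_measurable borel \<Longrightarrow> f \<in> borel_measurable torus"
  unfolding torus_def by (intro measurable_restrict_space1 measurable_completion) simp

lemma integral_torus_eq:
  fixes F :: "real^2 \<Rightarrow> 'b::{banach, second_countable_topology}"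
  assumes "F \<in> borel_measurable torus" "G \<in> borel_measurable borel" "AE x in tm. F x = G x"
  shows "(LINT x|torus. F x) = (LINT x|tm. G x)"
proof -
  have "(LINT x|torus. F x) = (LINT x|torus. G x)"
    by (rule integral_cong_AE) (use assms in \<open>auto simp: borel_measurable_torus AE_torus_iff\<close>)
  then show ?thesis using integral_tm[OF assms(2)] by simp
qed

lemma borel_representative_real:
  fixes f :: "real^2 \<Rightarrow> real"
  assumes "f \<in> borel_measurable torus"
  obtains g where "g \<in> borel_measurable borel" "AE x in tm. f x = g x"
proof -
  have "(\<lambda>x. indicator unit_cell x *\<^sub>R f x) \<in> borel_measurable lebesgue"
    using assms unfolding torus_def by (subst (asm) borel_measurable_restrict_space_iff) auto
  then obtain g where g: "g \<in> borel_measurable lborel" "AE x in lborel. indicator unit_cell x *\<^sub>R f x = g x"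
    using completion_ex_borel_measurable_real[of "\<lambda>x. indicator unit_cell x *\<^sub>R f x" lborel] by auto
  have "AE x in tm. f x = g x"
    unfolding AE_tm_iff using g(2) by eventually_elim (auto simp: indicator_def)
  then show ?thesis using that g(1) by simp
qed

lemma borel_representative_complex:
  fixes f :: "real^2 \<Rightarrow> complex"
  assumes "f \<in> borel_measurable torus"
  obtains g where "g \<in> borel_measurable borel" "AE x in tm. f x = g x"
proof -
  obtain u where u: "u \<in> borel_measurable borel" "AE x in tm. Re (f x) = u x"
    using borel_representative_real[of "\<lambda>x. Re (f x)"] assms by auto
  obtain v where v: "v \<in> borel_measurable borel" "AE x in tm. Im (f x) = v x"
    using borel_representative_real[of "\<lambda>x. Im (f x)"] assms by auto
  show ?thesis
  proof (rule that[of "\<lambda>x. complex_of_real (u x) + \<i> * complex_of_real (v x)"])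
    show "(\<lambda>x. complex_of_real (u x) + \<i> * complex_of_real (v x)) \<in> borel_measurable borel"
      using u v by measurable
    show "AE x in tm. f x = complex_of_real (u x) + \<i> * complex_of_real (v x)"
      using u(2) v(2) by eventually_elim (auto simp: complex_eq_iff)
  qed
qed

text \<open>Clamping to \<open>{0..M}\<close> turns bounds that hold almost everywhere into bounds
  everywhere, and reading the representative through \<open>cell_rep\<close> makes it periodic
  everywhere; \<open>max 1\<close> secures a positive \<open>M\<close>.\<close>

lemma torus_Linf_representative:
  assumes "torus_Linf \<gamma>" "AE x in torus. 0 \<le> \<gamma> x"
  obtains g M where "0 < M" "torus_weight g M" "lattice_periodic g" "AE x in tm. \<gamma> x = g x"
proof -
  obtain M0 where M0: "AE x in torus. \<bar>\<gamma> x\<bar> \<le> M0" using assms by (auto simp: torus_Linf_def)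
  obtain h where h: "h \<in> borel_measurable borel" "AE x in tm. \<gamma> x = h x"
    using borel_representative_real assms(1) unfolding torus_Linf_def by metis
  define M where "M = max 1 M0"
  define g where "g x = max 0 (min M (h (cell_rep x)))" for x
  note [measurable] = h(1)
  have "AE x in tm. \<gamma> x = g x"
    using h(2) M0[unfolded AE_torus_iff] assms(2)[unfolded AE_torus_iff] AE_tm_cell
    by eventually_elim (auto simp: g_def M_def cell_rep_id)
  moreover have "torus_weight g M"
  proof
    show "g \<in> borel_measurable borel" unfolding g_def by measurable
  qed (auto simp: g_def M_def)
  moreover have "lattice_periodic g"
    using lattice_periodic_cell_rep_comp[of "\<lambda>y. max 0 (min M (h y))"] unfolding g_def .
  ultimately show ?thesis using that[of M g] by (auto simp: M_def)
qed

text \<open>With finite support the trigonometric sum has the same Fourier coefficients as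
  \<open>f\<close>, and uniqueness identifies the two almost everywhere.\<close>

lemma torus_L2_eq_tsum:
  assumes f: "torus_L2 f" and fin: "finite (fourier_support f)"
  shows "AE x in tm. f x = tsum (fourier_support f) (fourier_coeff f) x"
proof -
  let ?S = "fourier_support f" and ?a = "fourier_coeff f"
  have S: "?S \<subseteq> int_lattice" by (auto simp: fourier_support_def)
  have mf: "f \<in> borel_measurable torus" using f by (simp add: torus_L2_def)
  obtain h where h[measurable]: "h \<in> borel_measurable borel" and fh: "AE x in tm. f x = h x"
    by (rule borel_representative_complex[OF mf]) blast
  have "integrable torus (\<lambda>x. (norm (h x))\<^sup>2)"
  proof (subst integrable_cong_AE[of _ _ "\<lambda>x. (norm (f x))\<^sup>2"])
    show "AE x in torus. (norm (h x))\<^sup>2 = (norm (f x))\<^sup>2"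
      unfolding AE_torus_iff using fh by eventually_elim simp
  qed (use f mf in \<open>auto simp: torus_L2_def intro!: borel_measurable_torus\<close>)
  then have h2: "integrable tm (\<lambda>x. (norm (h x))\<^sup>2)"
    unfolding tm_def torus_def
    by (subst integrable_density) (auto simp: integrable_restrict_space integrable_completion)
  have ih: "integrable tm h"
  proof (rule Bochner_Integration.integrable_bound[of tm "\<lambda>x. 1 + (norm (h x))\<^sup>2"])
    show "integrable tm (\<lambda>x. 1 + (norm (h x))\<^sup>2)" using h2 by simp
    have "norm z \<le> 1 + (norm z)\<^sup>2" for z :: complex
      using sum_squares_bound[of "norm z" 1] norm_ge_zero[of z] by (simp del: norm_ge_zero)
    then show "AE x in tm. norm (h x) \<le> norm (1 + (norm (h x))\<^sup>2)" by (intro AE_I2) simp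
  qed simp
  have coeff: "(LINT x|tm. h x * ech (- k) x) = ?a k" for k
  proof -
    have "?a k = (LINT x|torus. f x * ech (- k) x)"
      by (simp add: fourier_coeff_def ech_def cis_conv_exp mult_ac)
    also have "\<dots> = (LINT x|tm. h x * ech (- k) x)"
    proof (rule integral_torus_eq)
      show "AE x in tm. f x * ech (- k) x = h x * ech (- k) x" using fh by eventually_elim simp
      show "(\<lambda>x. f x * ech (- k) x) \<in> borel_measurable torus"
        by (intro borel_measurable_times mf borel_measurable_torus measurable_ech)
    qed measurable
    finally show ?thesis by simp
  qed
  have itsum: "integrable tm (tsum ?S ?a)"
    by (rule integrable_tm_bounded[OF _ norm_tsum_le]) simp
  have imul: "integrable tm (\<lambda>x. u x * ech k x)" if "integrable tm u" for u k
    by (rule Bochner_Integration.integrable_bound[OF that]) (use that in \<open>auto simp: norm_mult\<close>)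
  have "AE x in tm. h x - tsum ?S ?a x = 0"
  proof (rule fourier_uniqueness)
    show "integrable tm (\<lambda>x. h x - tsum ?S ?a x)" using ih itsum by simp
    fix k assume k: "k \<in> int_lattice"
    then have k': "- k \<in> int_lattice" by blast
    have "(LINT x|tm. (h x - tsum ?S ?a x) * ech k x)
        = (LINT x|tm. h x * ech k x) - (LINT x|tm. tsum ?S ?a x * ech k x)"
      unfolding left_diff_distrib by (rule Bochner_Integration.integral_diff) (intro imul ih itsum)+
    also have "(LINT x|tm. h x * ech k x) = ?a (- k)" using coeff[of "- k"] by simp
    also have "(LINT x|tm. tsum ?S ?a x * ech k x) = (if - k \<in> ?S then ?a (- k) else 0)"
      using integral_tsum_ech[OF fin S k', of ?a] by (simp add: cnj_ech)
    also have "\<dots> = ?a (- k)" using k' by (auto simp: fourier_support_def)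
    finally show "(LINT x|tm. (h x - tsum ?S ?a x) * ech k x) = 0" by simp
  qed
  with fh show ?thesis by eventually_elim simp
qed

lemma tube_average_eq:
  assumes w: "torus_weight g M" and \<gamma>: "\<gamma> \<in> borel_measurable torus" "AE x in tm. \<gamma> x = g x"
  shows "tube_average \<gamma> x \<nu> L \<delta>
    = (LINT y|tm. indicator (tube x \<nu> L \<delta>) y * g y) / measure tm (tube x \<nu> L \<delta>)"
proof -
  interpret torus_weight g M by fact
  let ?T = "tube x \<nu> L \<delta>"
  have "(LINT y:?T|torus. \<gamma> y) = (LINT y|tm. indicator ?T y * g y)"
    unfolding set_lebesgue_integral_def
  proof (rule integral_torus_eq)
    show "(\<lambda>y. indicator ?T y *\<^sub>R \<gamma> y) \<in> borel_measurable torus"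
      by (intro borel_measurable_scaleR borel_measurable_torus \<gamma>) simp
    show "AE y in tm. indicator ?T y *\<^sub>R \<gamma> y = indicator ?T y * g y"
      using \<gamma>(2) by eventually_elim simp
  qed measurable
  moreover have "measure torus (?T \<inter> unit_cell) = measure tm ?T"
  proof -
    have "measure torus (?T \<inter> unit_cell) = measure lebesgue (?T \<inter> unit_cell)"
      unfolding torus_def by (rule measure_restrict_space) auto
    also have "\<dots> = measure lborel (?T \<inter> unit_cell)" by (rule measure_completion) simp
    also have "\<dots> = measure tm ?T" by (simp add: measure_def emeasure_tm)
    finally show ?thesis .
  qed
  ultimately show ?thesis by (simp add: tube_average_def)
qed

lemma generalized_GCC_imp_fibre:
  assumes w: "torus_weight g M" and per: "lattice_periodic g"
    and \<gamma>: "\<gamma> \<in> borel_measurable torus" "AE x in tm. \<gamma> x = g x"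
    and gcc: "generalized_GCC \<gamma> \<Theta>" and \<Theta>: "\<And>\<nu>. \<nu> \<in> \<Theta> \<Longrightarrow> norm \<nu> = 1"
  obtains L c where "0 < L" "0 < c"
    "\<And>\<nu>. \<nu> \<in> \<Theta> \<Longrightarrow> AE x in tm. c \<le> (LINT t|seg L. g (x + t *\<^sub>R \<nu>))"
proof -
  interpret torus_weight g M by fact
  obtain L c0 where L: "0 < L" and c0: "0 < c0"
    and lim: "ereal c0 \<le> Liminf (at_right 0) (\<lambda>\<delta>. INF x. INF \<nu>\<in>\<Theta>. ereal (tube_average \<gamma> x \<nu> L \<delta>))"
    using gcc by (auto simp: generalized_GCC_def)
  have "\<forall>\<^sub>F \<delta> in at_right 0. ereal (c0 / 2) < (INF x. INF \<nu>\<in>\<Theta>. ereal (tube_average \<gamma> x \<nu> L \<delta>))"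
    using lim c0 unfolding le_Liminf_iff by (auto dest: spec[of _ "ereal (c0 / 2)"])
  then obtain \<delta>0 where \<delta>0: "0 < \<delta>0"
    "\<And>\<delta>. 0 < \<delta> \<Longrightarrow> \<delta> < \<delta>0 \<Longrightarrow> ereal (c0 / 2) < (INF x. INF \<nu>\<in>\<Theta>. ereal (tube_average \<gamma> x \<nu> L \<delta>))"
    unfolding eventually_at_right_field by auto
  \<comment> \<open>\<open>c0 / 2\<close> takes the place of \<open>c0\<close>, since a lower limit
    of at least \<open>c0\<close> yields eventual bounds only by smaller numbers.\<close>
  have avg: "c0 / 2 * measure tm (tube x \<nu> L \<delta>) \<le> (LINT y|tm. indicator (tube x \<nu> L \<delta>) y * g y)"
    if "0 < \<delta>" "\<delta> < \<delta>0" "\<nu> \<in> \<Theta>" for x \<nu> \<delta>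
  proof -
    have "(INF x. INF \<nu>\<in>\<Theta>. ereal (tube_average \<gamma> x \<nu> L \<delta>)) \<le> ereal (tube_average \<gamma> x \<nu> L \<delta>)"
      by (rule INF_lower2[OF UNIV_I]) (rule INF_lower[OF that(3)])
    then have "c0 / 2 < tube_average \<gamma> x \<nu> L \<delta>"
      using less_le_trans[OF \<delta>0(2)[OF that(1,2)]] by (metis less_ereal.simps(1))
    then have *: "c0 / 2 < (LINT y|tm. indicator (tube x \<nu> L \<delta>) y * g y) / measure tm (tube x \<nu> L \<delta>)"
      unfolding tube_average_eq[OF w \<gamma>] .
    \<comment> \<open>Division by zero yields 0, so the strict lower bound excludes a null
      tube.\<close>
    then have "measure tm (tube x \<nu> L \<delta>) \<noteq> 0" using c0 by auto
    then have "0 < measure tm (tube x \<nu> L \<delta>)" by (simp add: zero_less_measure_iff)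
    then show ?thesis using * by (simp add: field_simps)
  qed
  show ?thesis
  proof (rule that[OF L])
    show "0 < c0 / 2 * min L (1 / 4) / 16" using c0 L by simp
    fix \<nu> assume \<nu>: "\<nu> \<in> \<Theta>"
    show "AE x in tm. c0 / 2 * min L (1 / 4) / 16 \<le> (LINT t|seg L. g (x + t *\<^sub>R \<nu>))"
      by (rule tube_average_imp_fibre[OF w per L _ \<Theta>[OF \<nu>] \<delta>0(1)]) (use c0 avg \<nu> in auto)
  qed
qed

text \<open>By Fubini and translation invariance the fibre integrals would have mean zero if
  \<open>g\<close> vanished almost everywhere, against \<open>c > 0\<close>.\<close>

lemma fibre_imp_positive_weight:
  assumes w: "torus_weight g M" and per: "lattice_periodic g" and c: "0 < c"
    and fib: "AE x in tm. c \<le> (LINT t|seg L. g (x + t *\<^sub>R \<nu>))"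
  shows "positive_torus_weight g M"
proof -
  interpret torus_weight g M by fact
  show ?thesis
  proof
    show "\<not> (AE x in tm. g x = 0)"
    proof
      assume 0: "AE x in tm. g x = 0"
      let ?f = "\<lambda>x t. g (x + t *\<^sub>R \<nu>)"
      note F = integrable_tm_seg[of ?f L M]
      have F: "integrable tm (\<lambda>x. LINT t|seg L. ?f x t)"
        "(LINT t|seg L. LINT x|tm. ?f x t) = (LINT x|tm. LINT t|seg L. ?f x t)"
        by (rule F; use g_nonneg g_le in \<open>simp add: split_beta'\<close>)+
      have "(LINT x|tm. ?f x t) = 0" for t
      proof -
        have "(LINT x|tm. ?f x t) = (LINT x|tm. g x)" by (rule integral_tm_shift[OF g_measurable per])
        also have "\<dots> = 0" using 0 by (intro integral_eq_zero_AE)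
        finally show ?thesis .
      qed
      then have z: "(LINT x|tm. LINT t|seg L. ?f x t) = 0" using F(2) by simp
      have "(LINT x|tm. c) \<le> (LINT x|tm. LINT t|seg L. ?f x t)"
        by (rule integral_mono_AE[OF _ F(1) fib]) simp
      then show False using z c tm.prob_space by simp
    qed
  qed
qed

theorem theorem1p4:
  fixes P :: "(real^2) set" and \<gamma> :: "real^2 \<Rightarrow> real"
  assumes "convex_polygon P"
    and "torus_Linf \<gamma>"
    and "AE x in torus. 0 \<le> \<gamma> x"
    and "generalized_GCC \<gamma> (side_normals P)"
  shows "\<exists>C>0. \<forall>R\<ge>1. \<forall>f. torus_L2 f \<and> fourier_support f \<subseteq> boundary_frequencies R P \<longrightarrow>
    (L2_norm_torus f)\<^sup>2 \<le> C * (LINT x|torus. (norm (f x))\<^sup>2 * \<gamma> x)"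
proof -
  have m\<gamma>: "\<gamma> \<in> borel_measurable torus" using assms(2) by (simp add: torus_Linf_def)
  obtain g M where M: "0 < M" and w: "torus_weight g M" and per: "lattice_periodic g"
    and \<gamma>g: "AE x in tm. \<gamma> x = g x"
    by (rule torus_Linf_representative[OF assms(2,3)]) blast
  obtain N b where N: "finite N" "N \<subseteq> side_normals P" "N \<noteq> {}" "\<And>\<mu>. \<mu> \<in> N \<Longrightarrow> - \<mu> \<in> N"
    and b: "\<And>\<mu> p. p \<in> P \<Longrightarrow> p \<bullet> \<mu> \<le> b \<mu>" "\<And>\<mu>. \<mu> \<in> N \<Longrightarrow> 0 < b \<mu> + b (- \<mu>)"
    and touch: "\<And>p. p \<in> frontier P \<Longrightarrow> \<exists>\<mu>\<in>N. p \<bullet> \<mu> = b \<mu>"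
    and fr: "frontier P \<noteq> {}" "frontier P \<subseteq> P" and bdd: "bounded P"
    by (rule polygon_normals[OF assms(1)]) blast
  have N1: "norm \<mu> = 1" if "\<mu> \<in> N" for \<mu> using that N(2) by (auto simp: side_normals_def)
  obtain L c where L: "0 < L" and c: "0 < c"
    and fib: "\<And>\<nu>. \<nu> \<in> side_normals P \<Longrightarrow> AE x in tm. c \<le> (LINT t|seg L. g (x + t *\<^sub>R \<nu>))"
  proof (rule generalized_GCC_imp_fibre[OF w per m\<gamma> \<gamma>g assms(4)])
    show "norm \<nu> = 1" if "\<nu> \<in> side_normals P" for \<nu> using that by (simp add: side_normals_def)
  qed blast
  obtain \<nu>0 where "\<nu>0 \<in> N" using N(3) by blast
  then have "\<nu>0 \<in> side_normals P" using N(2) by blast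
  then interpret positive_torus_weight g M
    using fibre_imp_positive_weight[OF w per c fib] by blast
  have fibN: "AE x in tm. c \<le> (LINT t|seg L. g (x + t *\<^sub>R \<mu>))" if "\<mu> \<in> N" for \<mu>
    using fib that N(2) by blast
  obtain C1 R0 where C1: "0 < C1" and R0: "0 < R0"
    and large: "\<forall>R\<ge>R0. \<forall>S a. finite S \<and> S \<subseteq> int_lattice
    \<and> (\<forall>k\<in>S. \<exists>\<mu>\<in>N. \<bar>k \<bullet> \<mu> - R * b \<mu>\<bar> \<le> 1) \<and> (\<forall>k\<in>S. \<forall>\<mu>\<in>N. k \<bullet> \<mu> \<le> R * b \<mu> + 1) \<longrightarrow>
    (\<Sum>k\<in>S. (norm (a k))\<^sup>2) \<le> C1 * energy S a"
    using boundary_spectrum_bound_large[where b=b, OF per L c M N(1,3) N1 N(4) fibN b(2)] by blast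
  obtain B where B: "0 < B" "\<And>p. p \<in> P \<Longrightarrow> norm p \<le> B" using bdd bounded_pos by blast
  \<comment> \<open>For \<open>R < R0\<close> every frequency lies in this fixed finite set:
    \<open>B\<close> bounds the polygon, and 1 is the distance allowed from its dilated
    boundary.\<close>
  define X where "X = int_lattice \<inter> cball 0 (R0 * B + 1)"
  have "finite X" unfolding X_def by (rule finite_int_lattice_bounded) auto
  moreover have "X \<subseteq> int_lattice" by (simp add: X_def)
  ultimately obtain C2 where C2: "0 \<le> C2"
    and small: "\<And>S a. finite S \<and> S \<subseteq> X \<Longrightarrow> (\<Sum>k\<in>S. (norm (a k))\<^sup>2) \<le> C2 * energy S a"
    using finite_spectrum_bound by blast
  have near: "\<exists>p\<in>frontier P. norm (k - R *\<^sub>R p) \<le> 1" if "k \<in> boundary_frequencies R P" for k R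
  proof -
    let ?A = "(\<lambda>p. R *\<^sub>R p) ` frontier P"
    \<comment> \<open>The boundary is compact, so the distance is attained and
      \<open>infdist\<close> at most 1 provides an actual boundary point within 1.\<close>
    have "compact (frontier P)" using bdd by (rule compact_frontier_bounded)
    then have "compact ?A" by (intro compact_continuous_image continuous_intros)
    then have "closed ?A" by (rule compact_imp_closed)
    then obtain q where "q \<in> ?A" "infdist k ?A = dist k q"
      using infdist_attains_inf[of ?A k] fr(1) by auto
    then show ?thesis using that by (auto simp: boundary_frequencies_def dist_norm)
  qed
  define C where "C = C1 + C2"
  have C: "0 < C" using C1 C2 by (simp add: C_def)
  show ?thesis
  proof (intro exI[of _ C] conjI allI impI C)
    fix R :: real and f
    assume R: "1 \<le> R" and f: "torus_L2 f \<and> fourier_support f \<subseteq> boundary_frequencies R P"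
    define S where "S = fourier_support f"
    define a where "a = fourier_coeff f"
    have SZ: "S \<subseteq> int_lattice" by (auto simp: S_def fourier_support_def)
    have Snear: "\<exists>p\<in>frontier P. norm (k - R *\<^sub>R p) \<le> 1" if "k \<in> S" for k
      using near that f by (auto simp: S_def)
    have Snorm: "norm k \<le> R * B + 1" if k: "k \<in> S" for k
    proof -
      obtain p where p: "p \<in> frontier P" "norm (k - R *\<^sub>R p) \<le> 1" using Snear[OF k] by blast
      have "norm k \<le> norm (k - R *\<^sub>R p) + norm (R *\<^sub>R p)"
        using norm_triangle_ineq[of "k - R *\<^sub>R p" "R *\<^sub>R p"] by simp
      moreover have "norm (R *\<^sub>R p) \<le> R * B" using B(2)[of p] p fr(2) R by (auto intro: mult_left_mono)
      ultimately show ?thesis using p(2) by linarith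
    qed
    \<comment> \<open>A bounded spectrum is finite, so \<open>f\<close> is a trigonometric
      polynomial and the estimates for \<open>tsum\<close> apply.\<close>
    then have finS: "finite S"
      by (intro finite_int_lattice_bounded[OF SZ]) (auto simp: bounded_iff)
    have fS: "AE x in tm. f x = tsum S a x"
      unfolding S_def a_def by (rule torus_L2_eq_tsum) (use f finS in \<open>auto simp: S_def\<close>)
    have mf: "f \<in> borel_measurable torus" using f by (simp add: torus_L2_def)
    have lhs: "(L2_norm_torus f)\<^sup>2 = (\<Sum>k\<in>S. (norm (a k))\<^sup>2)"
    proof -
      have "(LINT x|torus. (norm (f x))\<^sup>2) = (LINT x|tm. (norm (tsum S a x))\<^sup>2)"
      proof (rule integral_torus_eq)
        show "AE x in tm. (norm (f x))\<^sup>2 = (norm (tsum S a x))\<^sup>2" using fS by eventually_elim simp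
      qed (use mf in measurable)
      then show ?thesis by (simp add: L2_norm_torus_def parseval[OF finS SZ] sum_nonneg)
    qed
    have rhs: "(LINT x|torus. (norm (f x))\<^sup>2 * \<gamma> x) = energy S a"
      unfolding energy_def
    proof (rule integral_torus_eq)
      show "AE x in tm. (norm (f x))\<^sup>2 * \<gamma> x = g x * (norm (tsum S a x))\<^sup>2"
        using fS \<gamma>g by eventually_elim simp
    qed (use mf m\<gamma> in measurable)
    have E0: "0 \<le> energy S a" by (rule energy_nonneg)
    show "(L2_norm_torus f)\<^sup>2 \<le> C * (LINT x|torus. (norm (f x))\<^sup>2 * \<gamma> x)"
    proof (cases "R0 \<le> R")
      case True
      have "(\<Sum>k\<in>S. (norm (a k))\<^sup>2) \<le> C1 * energy S a"
      proof (rule large[rule_format, OF True], intro conjI ballI finS SZ)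
        fix k assume k: "k \<in> S"
        obtain p where p: "p \<in> frontier P" "norm (k - R *\<^sub>R p) \<le> 1" using Snear[OF k] by blast
        \<comment> \<open>The normals are unit vectors, so a distance of at most 1 becomes a strip
          of half-width 1.\<close>
        have d: "\<bar>(k - R *\<^sub>R p) \<bullet> \<mu>\<bar> \<le> 1" if "\<mu> \<in> N" for \<mu>
          using Cauchy_Schwarz_ineq2[of "k - R *\<^sub>R p" \<mu>] N1[OF that] p(2) by simp
        obtain \<mu> where \<mu>: "\<mu> \<in> N" "p \<bullet> \<mu> = b \<mu>" using touch[OF p(1)] by blast
        then have "\<bar>k \<bullet> \<mu> - R * b \<mu>\<bar> \<le> 1" using d[OF \<mu>(1)] by (simp add: inner_diff_left)
        with \<mu>(1) show "\<exists>\<mu>\<in>N. \<bar>k \<bullet> \<mu> - R * b \<mu>\<bar> \<le> 1" by blast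
      next
        fix k \<mu> assume k: "k \<in> S" and \<mu>: "\<mu> \<in> N"
        obtain p where p: "p \<in> frontier P" "norm (k - R *\<^sub>R p) \<le> 1" using Snear[OF k] by blast
        have d: "\<bar>(k - R *\<^sub>R p) \<bullet> \<mu>\<bar> \<le> 1"
          using Cauchy_Schwarz_ineq2[of "k - R *\<^sub>R p" \<mu>] N1[OF \<mu>] p(2) by simp
        have "p \<bullet> \<mu> \<le> b \<mu>" using b(1) p(1) fr(2) by blast
        then have "R * (p \<bullet> \<mu>) \<le> R * b \<mu>" using R by (intro mult_left_mono) auto
        then show "k \<bullet> \<mu> \<le> R * b \<mu> + 1" using d by (simp add: inner_diff_left)
      qed
      also have "\<dots> \<le> C * energy S a" using C2 E0 by (intro mult_right_mono) (auto simp: C_def)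
      finally show ?thesis unfolding lhs rhs .
    next
      case False
      then have "R * B \<le> R0 * B" using B(1) by (intro mult_right_mono) auto
      then have "norm k \<le> R0 * B + 1" if "k \<in> S" for k using Snorm[OF that] by linarith
      then have "S \<subseteq> X" using SZ by (auto simp: X_def)
      then have "(\<Sum>k\<in>S. (norm (a k))\<^sup>2) \<le> C2 * energy S a" using small finS by blast
      also have "\<dots> \<le> C * energy S a" using C1 E0 by (intro mult_right_mono) (auto simp: C_def)
      finally show ?thesis unfolding lhs rhs .
    qed
  qed
qed

end
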